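(* Let $D\in\mathcal{D}(A(\mathbb{D}))$ be a bounded derivation from the disc algebra $A(\mathbb{D})$ to its dual. Then there is a unique $h_D\in \operatorname{Conj} H^1_0$ such that $$ D(f)(\mathbf{1})=\int_{\mathbb{T}} f(z)\,h_D(z)\,|dz| \qquad\text{for all } f\in A(\mathbb{D}). $$ Furthermore, $\mathsf{E}: D\mapsto h_D$ defines a bounded linear isomorphism from $\mathcal{D}(A(\mathbb{D}))$ onto $\operatorname{Conj} H^1_0$.
   Context: $\mathbb{D}$ is the open unit disc in $\mathbb{C}$, $\Delta$ its closure and $\mathbb{T}$ its boundary. $A(\mathbb{D})$ is the disc algebra: all functions continuous on $\Delta$ and analytic on $\mathbb{D}$, with the supremum norm; via restriction it is regarded as a closed subalgebra of $C(\mathbb{T})$. $\mathbf{1}$ is the constant function $1$. $|dz|$ is arc length measure on $\mathbb{T}$, with total mass $2\pi$, and $\|f\|_p=\left(\int_{\mathbb{T}}|f|^p\,|dz|\right)^{1/p}$ for $1\le p<\infty$. A bounded derivation $D: A(\mathbb{D})\to A(\mathbb{D})^*$ is a bounded linear map with $D(fg)=f\cdot D(g)+g\cdot D(f)$, where the module action on the dual is $(f\cdot\varphi)(k)=\varphi(fk)$; i.e. $D(fg)(k)=D(g)(fk)+D(f)(gk)$ for all $f,g,k\in A(\mathbb{D})$. $\mathcal{D}(A(\mathbb{D}))$ is the space of all bounded derivations $A(\mathbb{D})\to A(\mathbb{D})^*$, with the operator norm. $H^1$ is the Hardy space on $\mathbb{D}$, identified via radial limits with the functions in $L^1(\mathbb{T})$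 whose negative Fourier coefficients vanish. $H^1_0=\{f\in H^1: f(0)=0\}$, equivalently those $f \in H^1$ with $\int_{\mathbb{T}} f\,|dz|=0$. $\operatorname{Conj} H^1_0=\{\overline{f}: f\in H^1_0\}$, with the $L^1(\mathbb{T})$ norm. *)

theory Defs
  imports "HOL-Complex_Analysis.Complex_Analysis"
begin

section \<open>Complex normed spaces\<close>

text \<open>
  HOL-Analysis only has real normed spaces; \<open>blinfun\<close> is the space of bounded real-linear maps.
\<close>

class scaleC =
  fixes scaleC :: "complex \<Rightarrow> 'a \<Rightarrow> 'a"  (infixr \<open>*\<^sub>C\<close> 75)

class complex_normed_vector = real_normed_vector + scaleC +
  assumes scaleC_add_right: "a *\<^sub>C (x + y) = a *\<^sub>C x + a *\<^sub>C y"
    and scaleC_add_left: "(a + b) *\<^sub>C x = a *\<^sub>C x + b *\<^sub>C x"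
    and scaleC_scaleC: "a *\<^sub>C b *\<^sub>C x = (a * b) *\<^sub>C x"
    and scaleC_one: "1 *\<^sub>C x = x"
    and scaleC_of_real: "complex_of_real r *\<^sub>C x = r *\<^sub>R x"
    and norm_scaleC: "norm (a *\<^sub>C x) = norm a * norm x"

lemma scaleC_scaleR_commute:
  fixes x :: "'a::complex_normed_vector"
  shows "a *\<^sub>C (r *\<^sub>R x) = r *\<^sub>R (a *\<^sub>C x)"
  by (metis scaleC_of_real scaleC_scaleC mult.commute)

lemma bounded_linear_scaleC: "bounded_linear (\<lambda>x::'a::complex_normed_vector. a *\<^sub>C x)"
  by (rule bounded_linear_intro[where K = "norm a"])
    (simp_all add: scaleC_add_right scaleC_scaleR_commute norm_scaleC mult.commute)

instantiation complex :: complex_normed_vector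
begin

definition scaleC_complex :: "complex \<Rightarrow> complex \<Rightarrow> complex"
  where "scaleC_complex a x = a * x"

instance
  by standard (simp_all add: scaleC_complex_def algebra_simps norm_mult scaleR_conv_of_real)

end

instantiation blinfun :: (real_normed_vector, complex_normed_vector) complex_normed_vector
begin

lift_definition scaleC_blinfun :: "complex \<Rightarrow> 'a \<Rightarrow>\<^sub>L 'b \<Rightarrow> 'a \<Rightarrow>\<^sub>L 'b"
  is "\<lambda>a F x. a *\<^sub>C F x"
  by (rule bounded_linear_compose[OF bounded_linear_scaleC])

instance
proof
  fix a b :: complex and F G :: "'a \<Rightarrow>\<^sub>L 'b" and r :: real
  show "a *\<^sub>C (F + G) = a *\<^sub>C F + a *\<^sub>C G"
    by transfer (simp add: scaleC_add_right)
  show "(a + b) *\<^sub>C F = a *\<^sub>C F + b *\<^sub>C F"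
    by transfer (simp add: scaleC_add_left)
  show "a *\<^sub>C b *\<^sub>C F = (a * b) *\<^sub>C F"
    by transfer (simp add: scaleC_scaleC)
  show "1 *\<^sub>C F = F"
    by transfer (simp add: scaleC_one)
  show "complex_of_real r *\<^sub>C F = r *\<^sub>R F"
    by transfer (simp add: scaleC_of_real)
  have le: "norm (c *\<^sub>C H) \<le> norm c * norm H" for c and H :: "'a \<Rightarrow>\<^sub>L 'b"
  proof (rule norm_blinfun_bound)
    fix x
    have "norm (blinfun_apply (c *\<^sub>C H) x) = norm c * norm (blinfun_apply H x)"
      by transfer (simp add: norm_scaleC)
    also have "\<dots> \<le> norm c * (norm H * norm x)"
      by (intro mult_left_mono norm_blinfun) auto
    finally show "norm (blinfun_apply (c *\<^sub>C H) x) \<le> norm c * norm H * norm x"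
      by (simp add: mult.assoc)
  qed simp
  show "norm (a *\<^sub>C F) = norm a * norm F"
  proof (cases "a = 0")
    case True
    then show ?thesis using le[of a F] by simp
  next
    case False
    have "inverse a *\<^sub>C a *\<^sub>C F = F"
      using False by transfer (simp add: scaleC_scaleC scaleC_one)
    then have "norm F \<le> norm (inverse a) * norm (a *\<^sub>C F)"
      by (metis le)
    then have "norm a * norm F \<le> norm (a *\<^sub>C F)"
      using False by (simp add: norm_inverse norm_divide field_simps)
    then show ?thesis using le[of a F] by simp
  qed
qed

end

definition complex_dual :: "('a::complex_normed_vector \<Rightarrow>\<^sub>L complex) set" where
  "complex_dual = {\<phi>. \<forall>a x. blinfun_apply \<phi> (a *\<^sub>C x) = a *\<^sub>C blinfun_apply \<phi> x}"

text \<open>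
  \<open>S\<close> and \<open>T\<close> are meant to be complex linear subspaces; the last conjunct bounds the inverse map.
\<close>

definition bounded_linear_iso_on ::
    "('a::complex_normed_vector \<Rightarrow> 'b::complex_normed_vector) \<Rightarrow> 'a set \<Rightarrow> 'b set \<Rightarrow> bool" where
  "bounded_linear_iso_on E S T \<longleftrightarrow>
     bij_betw E S T \<and>
     (\<forall>x\<in>S. \<forall>y\<in>S. E (x + y) = E x + E y) \<and>
     (\<forall>a. \<forall>x\<in>S. E (a *\<^sub>C x) = a *\<^sub>C E x) \<and>
     (\<exists>K. \<forall>x\<in>S. norm (E x) \<le> K * norm x) \<and>
     (\<exists>K. \<forall>x\<in>S. norm x \<le> K * norm (E x))"


section \<open>The disc algebra\<close>

text \<open>
  Functions are extended by \<open>0\<close> outside the closed disc, so that equality in the type is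
  equality on the closed disc.
\<close>

typedef disc_algebra =
  "{f :: complex \<Rightarrow> complex.
      continuous_on (cball 0 1) f \<and> f holomorphic_on ball 0 1 \<and> (\<forall>z. z \<notin> cball 0 1 \<longrightarrow> f z = 0)}"
  morphisms disc_fun Abs_disc_algebra
  by (rule exI[of _ "\<lambda>z. 0"]) auto

setup_lifting type_definition_disc_algebra

lemma disc_fun_continuous: "continuous_on (cball 0 1) (disc_fun f)"
  and disc_fun_holomorphic: "disc_fun f holomorphic_on ball 0 1"
  and disc_fun_outside: "z \<notin> cball 0 1 \<Longrightarrow> disc_fun f z = 0"
  using disc_fun[of f] by auto

lemma disc_fun_bdd: "bdd_above ((\<lambda>z. norm (disc_fun f z)) ` cball 0 1)"
  by (intro bounded_imp_bdd_above compact_imp_bounded compact_continuous_image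
      continuous_on_norm disc_fun_continuous compact_cball)

instantiation disc_algebra :: "{real_normed_algebra_1, complex_normed_vector}"
begin

lift_definition zero_disc_algebra :: disc_algebra is "\<lambda>z. 0" by auto

lift_definition one_disc_algebra :: disc_algebra is "\<lambda>z. if z \<in> cball 0 1 then 1 else 0"
proof -
  have "continuous_on (cball 0 1) (\<lambda>z::complex. if z \<in> cball 0 1 then 1 else (0::complex))
          = continuous_on (cball 0 1) (\<lambda>z::complex. 1::complex)"
    by (rule continuous_on_cong) auto
  moreover have "(\<lambda>z::complex. if z \<in> cball 0 1 then 1 else (0::complex)) holomorphic_on ball 0 1
          \<longleftrightarrow> (\<lambda>z::complex. 1::complex) holomorphic_on ball 0 1"
    by (rule holomorphic_cong) auto
  ultimately show "?thesis" by simp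
qed

lift_definition plus_disc_algebra :: "disc_algebra \<Rightarrow> disc_algebra \<Rightarrow> disc_algebra"
  is "\<lambda>f g z. f z + g z" by (auto intro!: continuous_intros holomorphic_intros)

lift_definition minus_disc_algebra :: "disc_algebra \<Rightarrow> disc_algebra \<Rightarrow> disc_algebra"
  is "\<lambda>f g z. f z - g z" by (auto intro!: continuous_intros holomorphic_intros)

lift_definition uminus_disc_algebra :: "disc_algebra \<Rightarrow> disc_algebra"
  is "\<lambda>f z. - f z" by (auto intro!: continuous_intros holomorphic_intros)

lift_definition times_disc_algebra :: "disc_algebra \<Rightarrow> disc_algebra \<Rightarrow> disc_algebra"
  is "\<lambda>f g z. f z * g z" by (auto intro!: continuous_intros holomorphic_intros)

lift_definition scaleR_disc_algebra :: "real \<Rightarrow> disc_algebra \<Rightarrow> disc_algebra"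
  is "\<lambda>r f z. complex_of_real r * f z" by (auto intro!: continuous_intros holomorphic_intros)

lift_definition scaleC_disc_algebra :: "complex \<Rightarrow> disc_algebra \<Rightarrow> disc_algebra"
  is "\<lambda>a f z. a * f z" by (auto intro!: continuous_intros holomorphic_intros)

definition norm_disc_algebra :: "disc_algebra \<Rightarrow> real"
  where "norm_disc_algebra f = (SUP z\<in>cball 0 1. norm (disc_fun f z))"

definition dist_disc_algebra :: "disc_algebra \<Rightarrow> disc_algebra \<Rightarrow> real"
  where "dist_disc_algebra f g = norm (f - g)"

definition sgn_disc_algebra :: "disc_algebra \<Rightarrow> disc_algebra"
  where "sgn_disc_algebra f = inverse (norm f) *\<^sub>R f"

definition uniformity_disc_algebra :: "(disc_algebra \<times> disc_algebra) filter"
  where "uniformity_disc_algebra = (INF e\<in>{0<..}. principal {(f, g). dist f g < e})"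

definition open_disc_algebra :: "disc_algebra set \<Rightarrow> bool"
  where "open_disc_algebra U \<longleftrightarrow> (\<forall>f\<in>U. \<forall>\<^sub>F (f', g) in uniformity. f' = f \<longrightarrow> g \<in> U)"

lemma norm_disc_algebra_upper: "norm (disc_fun f z) \<le> norm f"
proof (cases "z \<in> cball 0 1")
  case True
  then show ?thesis unfolding norm_disc_algebra_def by (intro cSUP_upper disc_fun_bdd)
next
  case False
  have "norm (disc_fun f 0) \<le> norm f"
    unfolding norm_disc_algebra_def by (intro cSUP_upper disc_fun_bdd) auto
  then have "0 \<le> norm f" by (rule order_trans[OF norm_ge_zero])
  then show ?thesis using disc_fun_outside[OF False, of f] by simp
qed

lemma norm_disc_algebra_least: "(\<And>z. z \<in> cball 0 1 \<Longrightarrow> norm (disc_fun f z) \<le> c) \<Longrightarrow> norm f \<le> c"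
  unfolding norm_disc_algebra_def by (intro cSUP_least) auto

lemma disc_fun_eqI: "(\<And>z. disc_fun f z = disc_fun g z) \<Longrightarrow> f = g"
  by (simp add: disc_fun_inject[symmetric] fun_eq_iff)

instance
proof
  fix f g h :: disc_algebra and a b :: complex and r s :: real
  show "f + g + h = f + (g + h)" "f + g = g + f" "0 + f = f" "- f + f = 0" "f - g = f + - g"
    "r *\<^sub>R (f + g) = r *\<^sub>R f + r *\<^sub>R g" "(r + s) *\<^sub>R f = r *\<^sub>R f + s *\<^sub>R f"
    "r *\<^sub>R s *\<^sub>R f = (r * s) *\<^sub>R f" "1 *\<^sub>R f = f"
    "f * g * h = f * (g * h)" "(f + g) * h = f * h + g * h" "f * (g + h) = f * g + f * h"
    "r *\<^sub>R f * g = r *\<^sub>R (f * g)" "f * r *\<^sub>R g = r *\<^sub>R (f * g)"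
    "a *\<^sub>C (f + g) = a *\<^sub>C f + a *\<^sub>C g" "(a + b) *\<^sub>C f = a *\<^sub>C f + b *\<^sub>C f"
    "a *\<^sub>C b *\<^sub>C f = (a * b) *\<^sub>C f" "1 *\<^sub>C f = f" "complex_of_real r *\<^sub>C f = r *\<^sub>R f"
    by (transfer; simp add: fun_eq_iff algebra_simps)+
  show "1 * f = f" "f * 1 = f"
    by (transfer; auto simp: fun_eq_iff)+
  show "(0::disc_algebra) \<noteq> 1"
    by transfer (auto simp: fun_eq_iff intro!: exI[of _ 0])
  show "dist f g = norm (f - g)" by (rule dist_disc_algebra_def)
  show "sgn f = inverse (norm f) *\<^sub>R f" by (rule sgn_disc_algebra_def)
  show "(uniformity :: (disc_algebra \<times> disc_algebra) filter)
      = (INF e\<in>{0<..}. principal {(f, g). dist f g < e})"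
    by (rule uniformity_disc_algebra_def)
  show "open U \<longleftrightarrow> (\<forall>f\<in>U. \<forall>\<^sub>F (f', g) in uniformity. f' = f \<longrightarrow> g \<in> U)" for U :: "disc_algebra set"
    by (rule open_disc_algebra_def)
  have nn: "0 \<le> norm k" for k :: disc_algebra
    by (rule order_trans[OF norm_ge_zero norm_disc_algebra_upper[of k 0]])
  show "norm f = 0 \<longleftrightarrow> f = 0"
  proof
    assume "norm f = 0"
    then show "f = 0"
      using norm_disc_algebra_upper[of f]
      by (intro disc_fun_eqI) (auto simp: zero_disc_algebra.rep_eq)
  next
    assume "f = 0"
    then have "norm f \<le> 0"
      by (intro norm_disc_algebra_least) (auto simp: zero_disc_algebra.rep_eq)
    then show "norm f = 0" using nn[of f] by simp
  qed
  show "norm (f + g) \<le> norm f + norm g"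
    by (intro norm_disc_algebra_least)
      (auto simp: plus_disc_algebra.rep_eq
        intro!: order_trans[OF norm_triangle_ineq] add_mono norm_disc_algebra_upper)
  show "norm (f * g) \<le> norm f * norm g"
    by (intro norm_disc_algebra_least)
      (auto simp: times_disc_algebra.rep_eq norm_mult nn intro!: mult_mono norm_disc_algebra_upper)
  have C: "norm (c *\<^sub>C k) = norm c * norm k" for c and k :: disc_algebra
  proof (rule antisym)
    show le: "norm (c *\<^sub>C k) \<le> norm c * norm k" for c and k :: disc_algebra
      by (intro norm_disc_algebra_least)
        (auto simp: scaleC_disc_algebra.rep_eq norm_mult
          intro!: mult_left_mono norm_disc_algebra_upper)
    show "norm c * norm k \<le> norm (c *\<^sub>C k)"
    proof (cases "c = 0")
      case True
      then show ?thesis using nn by simp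
    next
      case False
      have "inverse c *\<^sub>C c *\<^sub>C k = k"
        using False by transfer (simp add: fun_eq_iff)
      then have "norm k \<le> norm (inverse c) * norm (c *\<^sub>C k)"
        by (metis le)
      then show ?thesis
        using False by (simp add: norm_inverse norm_divide field_simps)
    qed
  qed
  then show "norm (a *\<^sub>C f) = norm a * norm f" .
  have "r *\<^sub>R f = complex_of_real r *\<^sub>C f" by transfer simp
  then show "norm (r *\<^sub>R f) = \<bar>r\<bar> * norm f" using C[of "of_real r" f] by simp
  show "norm (1::disc_algebra) = 1"
  proof (rule antisym)
    show "norm (1::disc_algebra) \<le> 1"
      by (intro norm_disc_algebra_least) (auto simp: one_disc_algebra.rep_eq)
    show "1 \<le> norm (1::disc_algebra)"
      using norm_disc_algebra_upper[of 1 0] by (simp add: one_disc_algebra.rep_eq)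
  qed
qed

end


section \<open>Derivations into the dual\<close>

definition dual_action ::
    "disc_algebra \<Rightarrow> disc_algebra \<Rightarrow>\<^sub>L complex \<Rightarrow> disc_algebra \<Rightarrow>\<^sub>L complex" where
  "dual_action f \<phi> = \<phi> o\<^sub>L blinfun_mult_right f"

lemma dual_action_apply [simp]: "blinfun_apply (dual_action f \<phi>) k = blinfun_apply \<phi> (f * k)"
  by (simp add: dual_action_def)

text \<open>
  For complex-linear maps the norm of \<open>blinfun\<close> is the usual operator norm, so the derivations
  carry their operator norm as a subset of the type below.
\<close>

definition disc_derivations :: "(disc_algebra \<Rightarrow>\<^sub>L disc_algebra \<Rightarrow>\<^sub>L complex) set" where
  "disc_derivations =
     {D. (\<forall>f. blinfun_apply D f \<in> complex_dual) \<and>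
         (\<forall>a f. blinfun_apply D (a *\<^sub>C f) = a *\<^sub>C blinfun_apply D f) \<and>
         (\<forall>f g. blinfun_apply D (f * g)
            = dual_action f (blinfun_apply D g) + dual_action g (blinfun_apply D f))}"


section \<open>\<open>L\<^sup>1\<close> of the circle\<close>

definition arc_length :: "complex measure" where
  "arc_length =
     distr (restrict_space lborel {0..<2 * pi}) (restrict_space borel (sphere 0 1)) cis"

lemma sets_arc_length: "sets arc_length = sets (restrict_space borel (sphere 0 1))"
  by (simp add: arc_length_def)

lemma borel_measurable_arc_length:
  fixes g :: "complex \<Rightarrow> complex"
  assumes "continuous_on (sphere 0 1) g"
  shows "g \<in> borel_measurable arc_length"
  using borel_measurable_continuous_on_restrict[OF assms]
  by (simp add: measurable_cong_sets[OF sets_arc_length refl])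

lemma integral_arc_length_mult_cong:
  fixes f g h :: "complex \<Rightarrow> complex"
  assumes "continuous_on (sphere 0 1) g"
    and "integrable arc_length f \<and> integrable arc_length h \<and> (AE z in arc_length. f z = h z)"
  shows "(\<integral>z. f z * g z \<partial>arc_length) = (\<integral>z. h z * g z \<partial>arc_length)"
  using assms(2) borel_measurable_arc_length[OF assms(1)]
  by (intro integral_cong_AE borel_measurable_times) (auto elim: eventually_mono)

quotient_type L1_circle = "complex \<Rightarrow> complex" /
  partial: "\<lambda>f g. integrable arc_length f \<and> integrable arc_length g \<and> (AE z in arc_length. f z = g z)"
proof (rule part_equivpI)
  show "\<exists>f::complex \<Rightarrow> complex. integrable arc_length f \<and> integrable arc_length f \<and> (AE z in arc_length. f z = f z)"
    by (rule exI[of _ "\<lambda>z. 0"]) auto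
  show "symp (\<lambda>f g::complex \<Rightarrow> complex. integrable arc_length f \<and> integrable arc_length g \<and> (AE z in arc_length. f z = g z))"
    by (rule sympI) (auto elim: eventually_mono)
  show "transp (\<lambda>f g::complex \<Rightarrow> complex. integrable arc_length f \<and> integrable arc_length g \<and> (AE z in arc_length. f z = g z))"
    by (rule transpI) (auto elim: eventually_elim2)
qed

instantiation L1_circle :: complex_normed_vector
begin

lift_definition zero_L1_circle :: L1_circle is "\<lambda>z. 0" by auto

lift_definition plus_L1_circle :: "L1_circle \<Rightarrow> L1_circle \<Rightarrow> L1_circle"
  is "\<lambda>f g z. f z + g z" by (auto elim: eventually_elim2)

lift_definition minus_L1_circle :: "L1_circle \<Rightarrow> L1_circle \<Rightarrow> L1_circle"
  is "\<lambda>f g z. f z - g z" by (auto elim: eventually_elim2)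

lift_definition uminus_L1_circle :: "L1_circle \<Rightarrow> L1_circle"
  is "\<lambda>f z. - f z" by auto

lift_definition scaleR_L1_circle :: "real \<Rightarrow> L1_circle \<Rightarrow> L1_circle"
  is "\<lambda>r f z. complex_of_real r * f z" by (auto elim: eventually_mono)

lift_definition scaleC_L1_circle :: "complex \<Rightarrow> L1_circle \<Rightarrow> L1_circle"
  is "\<lambda>a f z. a * f z" by (auto elim: eventually_mono)

lift_definition norm_L1_circle :: "L1_circle \<Rightarrow> real"
  is "\<lambda>f. \<integral>z. norm (f z) \<partial>arc_length"
  by (auto intro!: integral_cong_AE)

definition dist_L1_circle :: "L1_circle \<Rightarrow> L1_circle \<Rightarrow> real"
  where "dist_L1_circle f g = norm (f - g)"

definition sgn_L1_circle :: "L1_circle \<Rightarrow> L1_circle"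
  where "sgn_L1_circle f = inverse (norm f) *\<^sub>R f"

definition uniformity_L1_circle :: "(L1_circle \<times> L1_circle) filter"
  where "uniformity_L1_circle = (INF e\<in>{0<..}. principal {(f, g). dist f g < e})"

definition open_L1_circle :: "L1_circle set \<Rightarrow> bool"
  where "open_L1_circle U \<longleftrightarrow> (\<forall>f\<in>U. \<forall>\<^sub>F (f', g) in uniformity. f' = f \<longrightarrow> g \<in> U)"

instance
proof
  fix f g h :: L1_circle and a b :: complex and r s :: real
  show "f + g + h = f + (g + h)" "f + g = g + f" "0 + f = f" "- f + f = 0" "f - g = f + - g"
    "r *\<^sub>R (f + g) = r *\<^sub>R f + r *\<^sub>R g" "(r + s) *\<^sub>R f = r *\<^sub>R f + s *\<^sub>R f"
    "r *\<^sub>R s *\<^sub>R f = (r * s) *\<^sub>R f" "1 *\<^sub>R f = f"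
    "a *\<^sub>C (f + g) = a *\<^sub>C f + a *\<^sub>C g" "(a + b) *\<^sub>C f = a *\<^sub>C f + b *\<^sub>C f"
    "a *\<^sub>C b *\<^sub>C f = (a * b) *\<^sub>C f" "1 *\<^sub>C f = f" "complex_of_real r *\<^sub>C f = r *\<^sub>R f"
    by (transfer; simp add: algebra_simps)+
  show "dist f g = norm (f - g)" by (rule dist_L1_circle_def)
  show "sgn f = inverse (norm f) *\<^sub>R f" by (rule sgn_L1_circle_def)
  show "(uniformity :: (L1_circle \<times> L1_circle) filter)
      = (INF e\<in>{0<..}. principal {(f, g). dist f g < e})"
    by (rule uniformity_L1_circle_def)
  show "open U \<longleftrightarrow> (\<forall>f\<in>U. \<forall>\<^sub>F (f', g) in uniformity. f' = f \<longrightarrow> g \<in> U)" for U :: "L1_circle set"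
    by (rule open_L1_circle_def)
  show "norm f = 0 \<longleftrightarrow> f = 0"
    by transfer (simp add: integral_nonneg_eq_0_iff_AE)
  show "norm (f + g) \<le> norm f + norm g"
  proof transfer
    fix f g :: "complex \<Rightarrow> complex"
    assume *: "integrable arc_length f \<and> integrable arc_length f \<and> (AE z in arc_length. f z = f z)"
      "integrable arc_length g \<and> integrable arc_length g \<and> (AE z in arc_length. g z = g z)"
    then have "(\<integral>z. norm (f z + g z) \<partial>arc_length) \<le> (\<integral>z. norm (f z) + norm (g z) \<partial>arc_length)"
      by (intro integral_mono) (auto intro: norm_triangle_ineq)
    with * show "(\<integral>z. norm (f z + g z) \<partial>arc_length)
        \<le> (\<integral>z. norm (f z) \<partial>arc_length) + (\<integral>z. norm (g z) \<partial>arc_length)"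
      by simp
  qed
  show "norm (r *\<^sub>R f) = \<bar>r\<bar> * norm f"
    by transfer (simp add: norm_mult)
  show "norm (a *\<^sub>C f) = norm a * norm f"
    by transfer (simp add: norm_mult)
qed

end

lift_definition cnj_L1 :: "L1_circle \<Rightarrow> L1_circle" is "\<lambda>f z. cnj (f z)"
  by (auto elim: eventually_mono)

lift_definition fourier_coeff :: "L1_circle \<Rightarrow> int \<Rightarrow> complex"
  is "\<lambda>f n. (\<integral>z. f z * z powi (- n) \<partial>arc_length) / (2 * complex_of_real pi)"
  by (rule ext, rule arg_cong[where f = "\<lambda>x. x / _"], rule integral_arc_length_mult_cong)
    (auto intro!: continuous_intros)

lift_definition integral_L1 :: "L1_circle \<Rightarrow> complex" is "\<lambda>f. \<integral>z. f z \<partial>arc_length"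
  by (auto intro!: integral_cong_AE)

lift_definition circle_pairing :: "disc_algebra \<Rightarrow> L1_circle \<Rightarrow> complex"
  is "\<lambda>f h. \<integral>z. f z * h z \<partial>arc_length"
  by (subst (1 2) mult.commute, rule integral_arc_length_mult_cong)
    (auto intro: continuous_on_subset[OF _ sphere_cball])

text \<open>
  Hardy functions are taken as their boundary values on the circle; under this identification
  the value at \<open>0\<close> is the mean over the circle.
\<close>

definition hardy_H1 :: "L1_circle set" where
  "hardy_H1 = {h. \<forall>n<0. fourier_coeff h n = 0}"

definition hardy_H1_0 :: "L1_circle set" where
  "hardy_H1_0 = {h \<in> hardy_H1. integral_L1 h = 0}"

definition conj_hardy_H1_0 :: "L1_circle set" where
  "conj_hardy_H1_0 = cnj_L1 ` hardy_H1_0"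

end

theory Submission
  imports Defs "HOL-Library.Diagonal_Subsequence"
begin

text \<open>
  For \<open>F\<close> in the disc algebra the chain rule gives \<open>D F 1 = D (exp F) (exp (- F))\<close>, so that
  \<open>|D F 1|\<close> is bounded by \<open>e\<^sup>2 * \<parallel>D\<parallel>\<close> as soon as \<open>|Re F| \<le> 1\<close>. By duality with Fejer means, the
  polynomials with coefficients \<open>(1 - n/N) * cnj (D (z^n) 1)\<close> are bounded in \<open>L\<^sup>1\<close>. A polynomial is the
  product of two functions in \<open>H\<^sup>2\<close> whose squared norms are at most its \<open>L\<^sup>1\<close> norm (split off a finite
  Blaschke product and take a square root), and coefficientwise limits preserve such
  factorizations. A product of two \<open>H\<^sup>2\<close> functions is the \<open>L\<^sup>1\<close> limit of products of partial sums,
  which yields \<open>h\<^sub>D\<close> without radial limits or the theorem of F. and M. Riesz.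

  Conversely, \<open>D f g = \<integral> R h |dz|\<close> with \<open>R' = f' g\<close>. Factoring \<open>cnj h = u v\<close> as above and writing
  \<open>f' v = (f v)' - f v'\<close>, Littlewood--Paley together with Cauchy--Schwarz bounds this integral by a
  multiple of \<open>\<parallel>f\<parallel> * \<parallel>g\<parallel> * \<parallel>h\<parallel>\<^sub>1\<close> for polynomials \<open>f\<close> and \<open>g\<close>, which are dense.
\<close>

section \<open>Integration over the circle\<close>

text \<open>A bound of the functional taking F to D F 1 by the sup norm alone would give only a
  representing measure, and cutting that measure down to its negative frequencies can destroy
  integrability: the Riesz projection is unbounded on L^1 and in the sup norm. The bound by |Re F|
  overcomes this. For a real f with |f| \<le> 1 the analytic half of its Fejer mean has no uniform
  bound, but its real part has one. Testing with real and imaginary parts costs the factor 2 in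
  \<open>2 * exp 2\<close>; each of exp F and exp (- F) contributes one factor e.

  In the converse, D f g = D z (f' g) for polynomials, so that D f g = D R 1 whenever R' = f' g: the
  values at 1 determine D. The splitting of f' v takes the place of a Carleson measure estimate for
  |f'|^2, since f v has H^2 norm at most \<parallel>f\<parallel> times that of v. The same estimate,
  applied to a given D, bounds \<parallel>D\<parallel> by 4 times the L^1 norm of its representing
  function. Injectivity and the bound of the inverse thus come without the open mapping
  theorem.\<close>

lemma space_arc_length: "space arc_length = sphere 0 1"
  by (simp add: arc_length_def space_restrict_space)

lemma measurable_cis_arc:
  "cis \<in> restrict_space lborel {0..<2*pi} \<rightarrow>\<^sub>M restrict_space borel (sphere 0 1)"
proof (rule measurable_restrict_space2)
  show "cis \<in> space (restrict_space lborel {0..<2 * pi}) \<rightarrow> sphere 0 1" by auto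
  have "continuous_on UNIV cis" by (intro continuous_intros)
  then have "cis \<in> borel_measurable borel" by (rule borel_measurable_continuous_onI)
  then show "cis \<in> restrict_space lborel {0..<2 * pi} \<rightarrow>\<^sub>M borel"
    by (intro measurable_restrict_space1) simp
qed

lemma finite_measure_arc_length: "finite_measure arc_length"
  unfolding arc_length_def
proof (rule finite_measure.finite_measure_distr[OF _ measurable_cis_arc], rule finite_measureI)
  show "emeasure (restrict_space lborel {0..<2 * pi}) (space (restrict_space lborel {0..<2 * pi})) \<noteq> \<infinity>"
    by (simp add: space_restrict_space emeasure_restrict_space)
qed

interpretation arc: finite_measure arc_length
  by (rule finite_measure_arc_length)

lemma continuous_on_measurable_arc_length:
  fixes f :: "complex \<Rightarrow> 'b::topological_space"
  assumes "continuous_on (sphere 0 1) f"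
  shows "f \<in> borel_measurable arc_length"
  using borel_measurable_continuous_on_restrict[OF assms]
  by (simp add: measurable_cong_sets[OF sets_arc_length refl])

lemma integrable_arc_continuous:
  fixes f :: "complex \<Rightarrow> 'b::{banach, second_countable_topology}"
  assumes "continuous_on (sphere 0 1) f"
  shows "integrable arc_length f"
proof -
  have "bounded (f ` sphere 0 1)"
    by (intro compact_imp_bounded compact_continuous_image assms compact_sphere)
  then obtain B where "\<forall>z\<in>sphere 0 1. norm (f z) \<le> B"
    unfolding bounded_iff by blast
  then have B: "norm (f z) \<le> B" if "z \<in> sphere 0 1" for z
    using that by blast
  show ?thesis
    by (rule arc.integrable_const_bound[where B = B])
      (use B in \<open>auto intro!: AE_I2 continuous_on_measurable_arc_length[OF assms] simp: space_arc_length\<close>)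
qed

lemma integrable_arc_mult:
  fixes f g :: "complex \<Rightarrow> complex"
  assumes f: "integrable arc_length f" and g: "continuous_on (sphere 0 1) g"
  shows "integrable arc_length (\<lambda>z. f z * g z)"
proof -
  have "bounded (g ` sphere 0 1)"
    by (intro compact_imp_bounded compact_continuous_image g compact_sphere)
  then obtain B where "\<forall>z\<in>sphere 0 1. norm (g z) \<le> B"
    unfolding bounded_iff by blast
  then have B: "norm (g z) \<le> B" if "z \<in> sphere 0 1" for z
    using that by blast
  have "B \<ge> 0" using B[of 1] norm_ge_zero[of "g 1"] by (auto intro: order_trans[OF norm_ge_zero])
  show ?thesis
  proof (rule Bochner_Integration.integrable_bound)
    show "integrable arc_length (\<lambda>z. B *\<^sub>R f z)" using f by simp
    show "(\<lambda>z. f z * g z) \<in> borel_measurable arc_length"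
      using f continuous_on_measurable_arc_length[OF g] by auto
    show "AE z in arc_length. norm (f z * g z) \<le> norm (B *\<^sub>R f z)"
      using B \<open>B \<ge> 0\<close>
      by (auto intro!: AE_I2 simp: space_arc_length norm_mult mult.commute[of B] intro: mult_left_mono)
  qed
qed

lemma integral_arc_cong:
  assumes "\<And>z. norm z = 1 \<Longrightarrow> f z = g z"
  shows "(\<integral>z. f z \<partial>arc_length) = (\<integral>z. g z \<partial>arc_length)"
  by (rule Bochner_Integration.integral_cong) (auto simp: space_arc_length assms)

text \<open>Arc length is the image of a half-open interval; closing it adds a null set and gives
  the form that the fundamental theorem of calculus expects.\<close>

lemma integral_arc_cis:
  fixes f :: "complex \<Rightarrow> 'b::{banach, second_countable_topology}"
  assumes "continuous_on (sphere 0 1) f"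
  shows "(\<integral>z. f z \<partial>arc_length) = (\<integral>t. indicator {0..2*pi} t *\<^sub>R f (cis t) \<partial>lborel)"
proof -
  have m: "f \<in> borel_measurable (restrict_space borel (sphere 0 1))"
    using borel_measurable_continuous_on_restrict[OF assms] .
  have c: "continuous_on {0..2*pi} (\<lambda>t. f (cis t))"
    by (rule continuous_on_compose2[OF assms]) (auto intro!: continuous_intros)
  have "(\<lambda>t. indicator {0..2*pi} t *\<^sub>R f (cis t)) \<in> borel_measurable lborel"
    using borel_measurable_continuous_on_indicator[OF _ c] by simp
  moreover have "(\<lambda>t. indicator {0..<2*pi} t *\<^sub>R f (cis t)) \<in> borel_measurable lborel"
    using borel_measurable_continuous_on_indicator[OF _ continuous_on_subset[OF c, of "{0..<2*pi}"]]
    by (simp add: atLeastLessThan_subseteq_atLeastAtMost_iff)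
  moreover have "AE t in lborel. t \<noteq> 2*pi" by (rule AE_lborel_singleton)
  then have "AE t in lborel. indicator {0..<2*pi} t *\<^sub>R f (cis t) = indicator {0..2*pi} t *\<^sub>R f (cis t)"
    by eventually_elim (auto simp: indicator_def)
  ultimately have "(\<integral>t. indicator {0..<2*pi} t *\<^sub>R f (cis t) \<partial>lborel)
      = (\<integral>t. indicator {0..2*pi} t *\<^sub>R f (cis t) \<partial>lborel)"
    by (intro integral_cong_AE) auto
  moreover have "(\<integral>z. f z \<partial>arc_length) = (\<integral>t. indicator {0..<2*pi} t *\<^sub>R f (cis t) \<partial>lborel)"
    unfolding arc_length_def integral_distr[OF measurable_cis_arc m]
    by (subst integral_restrict_space) auto
  ultimately show ?thesis by simp
qed

lemma integral_arc_powi: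
  "(\<integral>z. z powi n \<partial>arc_length) = (if n = 0 then complex_of_real (2 * pi) else 0)"
proof -
  have "(\<integral>z. z powi n \<partial>arc_length)
      = (\<integral>t. indicator {0..2*pi} t *\<^sub>R cis (of_int n * t) \<partial>lborel)"
    by (subst integral_arc_cis) (auto intro!: continuous_intros simp: cis_power_int)
  also have "\<dots> = (if n = 0 then complex_of_real (2 * pi) else 0)"
  proof (cases "n = 0")
    case True
    have "(\<integral>t. indicator {0..2*pi} t *\<^sub>R (1::complex) \<partial>lborel) = complex_of_real (2*pi) - complex_of_real 0"
      by (rule integral_FTC_atLeastAtMost)
        (auto intro!: derivative_eq_intros continuous_intros)
    then show ?thesis using True by simp
  next
    case False
    have "(\<integral>t. indicator {0..2*pi} t *\<^sub>R cis (of_int n * t) \<partial>lborel)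
        = cis (of_int n * (2*pi)) / (\<i> * of_int n) - cis (of_int n * 0) / (\<i> * of_int n)"
    proof (rule integral_FTC_atLeastAtMost)
      fix x :: real
      have "((\<lambda>x. exp (\<i> * of_int n * of_real x) / (\<i> * of_int n)) has_vector_derivative
               exp (\<i> * of_int n * of_real x)) (at x within {0..2*pi})"
        using False
        by (intro has_vector_derivative_real_field)
          (auto intro!: derivative_eq_intros)
      then show "((\<lambda>x. cis (of_int n * x) / (\<i> * of_int n)) has_vector_derivative
               cis (of_int n * x)) (at x within {0..2*pi})"
        by (simp add: cis_conv_exp mult.assoc)
    qed (auto intro!: continuous_intros)
    also have "cis (of_int n * (2*pi)) = 1"
      using cis_multiple_2pi[of "of_int n"] by (simp add: mult.commute)
    finally show ?thesis using False by simp
  qed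
  finally show ?thesis .
qed

lemma integral_arc_poly_powi:
  "(\<integral>z. poly p z * z powi (- int n) \<partial>arc_length) = 2 * pi * coeff p n"
proof -
  have "(\<integral>z. poly p z * z powi (- int n) \<partial>arc_length)
      = (\<integral>z. (\<Sum>i\<le>degree p. coeff p i * z powi (int i - int n)) \<partial>arc_length)"
  proof (rule integral_arc_cong)
    fix z :: complex assume "norm z = 1"
    then have "z \<noteq> 0" by auto
    then have "z ^ i * z powi (- int n) = z powi (int i - int n)" for i
      by (simp add: power_int_diff power_int_minus divide_inverse)
    then show "poly p z * z powi (- int n) = (\<Sum>i\<le>degree p. coeff p i * z powi (int i - int n))"
      by (simp add: poly_altdef sum_distrib_right mult.assoc)
  qed
  also have "\<dots> = (\<Sum>i\<le>degree p. coeff p i * (\<integral>z. z powi (int i - int n) \<partial>arc_length))"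
    by (subst Bochner_Integration.integral_sum)
      (auto intro!: integrable_mult_right integrable_arc_continuous continuous_intros)
  also have "\<dots> = (\<Sum>i\<le>degree p. if i = n then 2 * pi * coeff p i else 0)"
    by (intro sum.cong) (auto simp: integral_arc_powi)
  also have "\<dots> = 2 * pi * coeff p n"
    by (auto simp: sum.delta coeff_eq_0)
  finally show ?thesis .
qed

lemma cnj_eq_powi: "norm z = 1 \<Longrightarrow> cnj (z ^ n) = z powi (- int n)"
  by (metis Reals_cnj_iff complex_cnj_power complex_div_cnj complex_norm_square div_by_1
      inverse_eq_divide mult_1 of_real_1 one_power2 power_int_minus power_int_of_nat power_one_over)

text \<open>Parseval's formula. N is left free so that polynomials of different degrees can share
  one index range.\<close>

lemma integral_arc_poly_cnj:
  assumes "N \<ge> degree q"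
  shows "(\<integral>z. poly p z * cnj (poly q z) \<partial>arc_length) = 2 * pi * (\<Sum>n\<le>N. coeff p n * cnj (coeff q n))"
proof -
  have "(\<integral>z. poly p z * cnj (poly q z) \<partial>arc_length)
    = (\<integral>z. (\<Sum>n\<le>degree q. cnj (coeff q n) * (poly p z * z powi (- int n))) \<partial>arc_length)"
    by (rule integral_arc_cong)
      (simp add: poly_altdef[of q] sum_distrib_left cnj_eq_powi[symmetric] algebra_simps)
  also have "\<dots> = (\<Sum>n\<le>degree q. cnj (coeff q n) * (2 * pi * coeff p n))"
    by (subst Bochner_Integration.integral_sum)
      (auto intro!: integrable_mult_right integrable_arc_continuous continuous_intros
        simp: integral_arc_poly_powi)
  also have "\<dots> = (\<Sum>n\<le>N. cnj (coeff q n) * (2 * pi * coeff p n))"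
    using assms by (intro sum.mono_neutral_left) (auto simp: coeff_eq_0)
  finally show ?thesis by (simp add: sum_distrib_left mult_ac)
qed

lemma integral_arc_poly_norm_square:
  assumes "N \<ge> degree p"
  shows "(\<integral>z. (norm (poly p z))\<^sup>2 \<partial>arc_length) = 2 * pi * (\<Sum>n\<le>N. (norm (coeff p n))\<^sup>2)"
proof -
  have "complex_of_real (\<integral>z. (norm (poly p z))\<^sup>2 \<partial>arc_length) = (\<integral>z. poly p z * cnj (poly p z) \<partial>arc_length)"
    by (subst integral_complex_of_real[symmetric]) (simp only: complex_norm_square)
  also have "\<dots> = complex_of_real (2 * pi * (\<Sum>n\<le>N. (norm (coeff p n))\<^sup>2))"
    by (simp add: integral_arc_poly_cnj[OF assms] complex_norm_square del: of_real_power)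
  finally show ?thesis by (simp only: of_real_eq_iff)
qed

section \<open>A Littlewood--Paley estimate for polynomials\<close>

text \<open>Dividing the n-th coefficient by n replaces g(t) by the integral of g(s)/s from 0 to t,
  which keeps nonnegativity. With \<open>c 0 = 0\<close> the function g(s)/s is a polynomial, and
  the term for n = 0 is 0 / 0 = 0.\<close>

lemma sum_div_index_nonneg:
  fixes c :: "nat \<Rightarrow> real"
  assumes "c 0 = 0" and nn: "\<And>t. 0 \<le> t \<Longrightarrow> t \<le> 1 \<Longrightarrow> 0 \<le> (\<Sum>n\<le>N. c n * t ^ n)" and "0 \<le> t" "t \<le> 1"
  shows "0 \<le> (\<Sum>n\<le>N. c n / real n * t ^ n)"
proof -
  let ?G = "\<lambda>t. \<Sum>n\<le>N. c n / real n * t ^ n"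
  have "?G 0 \<le> ?G t"
  proof (rule DERIV_nonneg_imp_increasing_open[OF \<open>0 \<le> t\<close>])
    fix x assume x: "0 < x" "x < t"
    have D: "(?G has_real_derivative (\<Sum>n\<le>N. c n * x ^ (n - 1))) (at x)"
    proof (rule DERIV_sum)
      fix n
      show "((\<lambda>t. c n / real n * t ^ n) has_real_derivative c n * x ^ (n - 1)) (at x)"
        using \<open>c 0 = 0\<close> by (cases "n = 0") (auto intro!: derivative_eq_intros)
    qed
    have "x * (\<Sum>n\<le>N. c n * x ^ (n - 1)) = (\<Sum>n\<le>N. c n * x ^ n)"
      unfolding sum_distrib_left using \<open>c 0 = 0\<close>
      by (intro sum.cong refl) (auto simp: power_eq_if)
    also have "\<dots> \<ge> 0" using nn[of x] x \<open>t \<le> 1\<close> by simp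
    finally have "(\<Sum>n\<le>N. c n * x ^ (n - 1)) \<ge> 0"
      using x by (simp add: zero_le_mult_iff)
    with D show "\<exists>y. (?G has_real_derivative y) (at x) \<and> 0 \<le> y" by blast
  qed (intro continuous_on_sum continuous_on_mult continuous_on_const continuous_on_power continuous_on_id)
  moreover have "?G 0 = 0" using \<open>c 0 = 0\<close> by (intro sum.neutral) (auto simp: power_0_left)
  ultimately show ?thesis by simp
qed

text \<open>
  This replaces integration over the disc: dividing a power series in \<open>t = r\<^sup>2\<close> by \<open>t\<close> and integrating
  twice amounts to integrating against \<open>log (1/t) dt / t\<close>.
\<close>

lemma sum_div_index_square_mono:
  fixes a b :: "nat \<Rightarrow> real"
  assumes "a 0 = 0" "b 0 = 0"
    and "\<And>t. 0 \<le> t \<Longrightarrow> t \<le> 1 \<Longrightarrow> (\<Sum>n\<le>N. a n * t ^ n) \<le> (\<Sum>n\<le>N. b n * t ^ n)"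
  shows "(\<Sum>n\<le>N. a n / (real n)\<^sup>2) \<le> (\<Sum>n\<le>N. b n / (real n)\<^sup>2)"
proof -
  let ?c = "\<lambda>n. b n - a n"
  have 1: "0 \<le> (\<Sum>n\<le>N. ?c n / real n * t ^ n)" if "0 \<le> t" "t \<le> 1" for t
    by (rule sum_div_index_nonneg) (use assms that in \<open>auto simp: left_diff_distrib sum_subtractf\<close>)
  have "0 \<le> (\<Sum>n\<le>N. ?c n / real n / real n * 1 ^ n)"
    by (rule sum_div_index_nonneg[where c = "\<lambda>n. ?c n / real n"]) (use 1 assms in auto)
  then show ?thesis
    by (simp add: power2_eq_square diff_divide_distrib sum_subtractf)
qed

section \<open>Euler operator and dilations\<close>

definition euler_op :: "complex poly \<Rightarrow> complex poly" where
  "euler_op p = pCons 0 (pderiv p)"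

text \<open>The operator z d/dz is diagonal on monomials. Applied to both factors of a Parseval
  pairing it gives the weight n^2, which \<open>sum_div_index_square_mono\<close> removes
  again.\<close>

lemma coeff_euler_op: "coeff (euler_op p) n = of_nat n * coeff p n"
  by (cases n) (auto simp: euler_op_def coeff_pderiv)

lemma euler_op_mult: "euler_op (p * q) = euler_op p * q + p * euler_op q"
  by (simp add: euler_op_def pderiv_mult algebra_simps)

text \<open>Moves the circle of radius r to the unit circle, so that every integral is over
  \<open>arc_length\<close>.\<close>

definition dilate :: "real \<Rightarrow> complex poly \<Rightarrow> complex poly" where
  "dilate r p = pcompose p [:0, of_real r:]"

lemma poly_dilate: "poly (dilate r p) z = poly p (of_real r * z)"
  by (simp add: dilate_def poly_pcompose mult.commute)

lemma coeff_dilate: "coeff (dilate r p) n = of_real r ^ n * coeff p n"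
  by (simp add: dilate_def coeff_pcompose_linear)

lemma degree_dilate_le: "degree (dilate r p) \<le> degree p"
  by (rule degree_le) (auto simp: coeff_dilate coeff_eq_0)

lemma degree_euler_op_le: "degree (euler_op p) \<le> degree p"
  by (rule degree_le) (auto simp: coeff_euler_op coeff_eq_0)

text \<open>A multiplier bounded by A on the circle has norm at most A on H^2; Parseval expresses
  this by coefficients.\<close>

lemma sum_norm_coeff_mult_le:
  fixes p v :: "complex poly"
  assumes "\<And>z. norm z = 1 \<Longrightarrow> norm (poly p z) \<le> A"
    and N: "degree v \<le> N" "degree (p * v) \<le> N"
  shows "(\<Sum>n\<le>N. (norm (coeff (p * v) n))\<^sup>2) \<le> A\<^sup>2 * (\<Sum>n\<le>N. (norm (coeff v n))\<^sup>2)"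
proof -
  have "(\<integral>z. (norm (poly (p * v) z))\<^sup>2 \<partial>arc_length) \<le> (\<integral>z. A\<^sup>2 * (norm (poly v z))\<^sup>2 \<partial>arc_length)"
  proof (rule integral_mono)
    fix z :: complex assume "z \<in> space arc_length"
    then show "(norm (poly (p * v) z))\<^sup>2 \<le> A\<^sup>2 * (norm (poly v z))\<^sup>2"
      using assms(1)[of z]
      by (auto simp: space_arc_length norm_mult power_mult_distrib intro!: mult_right_mono power_mono)
  qed (auto intro!: integrable_arc_continuous continuous_intros)
  also have "\<dots> = A\<^sup>2 * (\<integral>z. (norm (poly v z))\<^sup>2 \<partial>arc_length)" by simp
  finally show ?thesis
    unfolding integral_arc_poly_norm_square[OF N(1)] integral_arc_poly_norm_square[OF N(2)] by simp
qed

lemma integral_euler_op_dilate: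
  assumes "degree w \<le> N"
  shows "(\<integral>z. (norm (poly (dilate r (euler_op w)) z))\<^sup>2 \<partial>arc_length)
     = 2 * pi * (\<Sum>n\<le>N. (real n)\<^sup>2 * (norm (coeff w n))\<^sup>2 * (r\<^sup>2) ^ n)"
proof -
  have "degree (dilate r (euler_op w)) \<le> N"
    using assms degree_dilate_le degree_euler_op_le le_trans by metis
  then show ?thesis
    by (simp add: integral_arc_poly_norm_square coeff_dilate coeff_euler_op norm_mult norm_power power_even_abs
        power_mult_distrib power_mult[symmetric] mult_ac)
qed

text \<open>At a point, x and y stand for the moduli of the Euler derivatives of R and u v; p', u',
  v', a, b for those of p, u, v, p v, p u. Young's inequality with weight A leaves only squares,
  each of which integrates to a coefficient sum. Once the square sums of a and b are bounded by A^2
  times those of v and u, every term has a factor A.\<close>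

lemma littlewood_paley_pointwise:
  fixes a b :: real
  assumes "A > 0" "B \<ge> 0" and x: "x \<le> B * p'" "p' \<ge> 0" and y: "y \<le> u' * v + u * v'"
    and nn: "0 \<le> u'" "0 \<le> v'" "0 \<le> y"
    and pv: "p' * v \<le> a + A * v'" and pu: "p' * u \<le> b + A * u'"
  shows "x * y \<le> B * (3 / 2 * A * (u'\<^sup>2 + v'\<^sup>2) + (a\<^sup>2 + b\<^sup>2) / (2 * A))"
proof -
  have am: "s * t \<le> A * s\<^sup>2 / 2 + t\<^sup>2 / (2 * A)" for s t
  proof -
    have "0 \<le> (A * s - t)\<^sup>2 / (2 * A)" using \<open>A > 0\<close> by simp
    also have "\<dots> = A * s\<^sup>2 / 2 + t\<^sup>2 / (2 * A) - s * t"
      using \<open>A > 0\<close> by (simp add: power2_eq_square field_simps)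
    finally show ?thesis by simp
  qed
  have "x * y \<le> (B * p') * y" using x nn by (intro mult_right_mono)
  also have "\<dots> \<le> (B * p') * (u' * v + u * v')" using x y \<open>B \<ge> 0\<close> by (intro mult_left_mono) auto
  also have "\<dots> = B * (u' * (p' * v) + v' * (p' * u))" by (simp add: algebra_simps)
  also have "\<dots> \<le> B * (u' * (a + A * v') + v' * (b + A * u'))"
    using nn pv pu \<open>B \<ge> 0\<close> by (intro mult_left_mono add_mono) auto
  also have "\<dots> = B * (u' * a + v' * b + A * (2 * u' * v'))" by (simp add: algebra_simps)
  also have "\<dots> \<le> B * ((A * u'\<^sup>2 / 2 + a\<^sup>2 / (2 * A)) + (A * v'\<^sup>2 / 2 + b\<^sup>2 / (2 * A)) + A * (u'\<^sup>2 + v'\<^sup>2))"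
    using \<open>B \<ge> 0\<close> \<open>A > 0\<close> by (intro mult_left_mono add_mono am sum_squares_bound) auto
  also have "\<dots> = B * (3 / 2 * A * (u'\<^sup>2 + v'\<^sup>2) + (a\<^sup>2 + b\<^sup>2) / (2 * A))"
    using \<open>A > 0\<close> by (simp add: field_simps)
  finally show ?thesis .
qed

text \<open>On each circle of radius r, with E = \<open>euler_op\<close>, one has E R = (E p) q and
  (E p) v = E (p v) - p (E v), likewise for u. So E p never has to be estimated by itself, and p v,
  p u have H^2 norms at most A times those of v, u.\<close>

lemma primitive_pairing_bound:
  fixes p q u v R :: "complex poly"
  assumes p: "\<And>z. norm z \<le> 1 \<Longrightarrow> norm (poly p z) \<le> A"
    and q: "\<And>z. norm z \<le> 1 \<Longrightarrow> norm (poly q z) \<le> B"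
    and "A > 0" and R: "pderiv R = pderiv p * q" "coeff R 0 = 0"
    and N: "degree R \<le> N" "degree p + degree u \<le> N" "degree p + degree v \<le> N" "degree u + degree v \<le> N"
  shows "norm (\<Sum>n\<le>N. coeff R n * cnj (coeff (u * v) n))
     \<le> 2 * A * B * ((\<Sum>n\<le>N. (norm (coeff u n))\<^sup>2) + (\<Sum>n\<le>N. (norm (coeff v n))\<^sup>2))"
proof -
  have "B \<ge> 0" using order_trans[OF norm_ge_zero q[of 0]] by simp
  let ?k = "u * v"
  have deg: "degree u \<le> N" "degree v \<le> N" "degree (p * u) \<le> N" "degree (p * v) \<le> N" "degree ?k \<le> N"
    using N degree_mult_le[of p u] degree_mult_le[of p v] degree_mult_le[of u v] by linarith+
  define S where "S = (\<Sum>n\<le>N. coeff R n * cnj (coeff ?k n))"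
  define w where "w n = 3 / 2 * A * ((norm (coeff u n))\<^sup>2 + (norm (coeff v n))\<^sup>2)
      + ((norm (coeff (p * v) n))\<^sup>2 + (norm (coeff (p * u) n))\<^sup>2) / (2 * A)" for n
  \<comment> \<open>The comparison of power series in t needs real coefficients; the unimodular
    factor allows the passage to real parts.\<close>
  have bound: "Re (\<omega> * S) \<le> (\<Sum>n\<le>N. B * w n)" if \<omega>: "norm \<omega> = 1" for \<omega>
  proof -
    define a where "a n = (real n)\<^sup>2 * Re (\<omega> * (coeff R n * cnj (coeff ?k n)))" for n
    define b where "b n = (real n)\<^sup>2 * (B * w n)" for n
    \<comment> \<open>For t = r^2 both sums are circle integrals up to the factor 2 * pi: the left
      one is the real part of \<omega> * J, the right one the integral of the pointwise
      majorant.\<close>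
    have main: "(\<Sum>n\<le>N. a n * t ^ n) \<le> (\<Sum>n\<le>N. b n * t ^ n)" if t: "0 \<le> t" "t \<le> 1" for t
    proof -
      define r where "r = sqrt t"
      have r: "0 \<le> r" "r \<le> 1" "r\<^sup>2 = t" using t by (auto simp: r_def)
      let ?d = "\<lambda>w z. poly (dilate r (euler_op w)) z"
      define J where "J = (\<integral>z. ?d R z * cnj (?d ?k z) \<partial>arc_length)"
      have "degree (dilate r (euler_op ?k)) \<le> N"
        using deg(5) degree_dilate_le degree_euler_op_le le_trans by metis
      then have "J = 2 * pi * (\<Sum>n\<le>N. of_nat n ^ 2 * (coeff R n * cnj (coeff ?k n)) * of_real t ^ n)"
        unfolding J_def r(3)[symmetric]
        by (simp add: integral_arc_poly_cnj coeff_dilate coeff_euler_op power2_eq_square power_mult_distrib mult_ac)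
      then have "\<omega> * J = (\<Sum>n\<le>N. of_real (2 * pi * (real n)\<^sup>2 * t ^ n) * (\<omega> * (coeff R n * cnj (coeff ?k n))))"
        by (simp add: sum_distrib_left mult_ac)
      then have "Re (\<omega> * J) = (\<Sum>n\<le>N. 2 * pi * (real n)\<^sup>2 * t ^ n * Re (\<omega> * (coeff R n * cnj (coeff ?k n))))"
        by (simp only: Re_sum scaleR_conv_of_real[symmetric] scaleR_complex.sel)
      then have ReJ: "Re (\<omega> * J) = 2 * pi * (\<Sum>n\<le>N. a n * t ^ n)"
        by (simp add: a_def sum_distrib_left mult_ac)
      have "Re (\<omega> * J) \<le> norm J"
        using complex_Re_le_cmod[of "\<omega> * J"] \<omega> by (simp add: norm_mult)
      also have "norm J \<le> (\<integral>z. norm (?d R z * cnj (?d ?k z)) \<partial>arc_length)"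
        unfolding J_def by (rule integral_norm_bound)
      also have "\<dots> \<le> (\<integral>z. B * (3 / 2 * A * ((norm (?d u z))\<^sup>2 + (norm (?d v z))\<^sup>2)
              + ((norm (?d (p * v) z))\<^sup>2 + (norm (?d (p * u) z))\<^sup>2) / (2 * A)) \<partial>arc_length)"
      proof (rule integral_mono)
        fix z :: complex assume "z \<in> space arc_length"
        then have z: "norm (of_real r * z) \<le> 1" using r by (simp add: space_arc_length norm_mult)
        let ?z = "of_real r * z"
        have ER: "euler_op R = euler_op p * q"
          by (simp add: euler_op_def R)
        have 1: "norm (?d R z) \<le> B * norm (?d p z)"
          using q[OF z] by (simp add: ER poly_dilate norm_mult mult.commute mult_right_mono)
        have 2: "norm (?d ?k z) \<le> norm (?d u z) * norm (poly v ?z) + norm (poly u ?z) * norm (?d v z)"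
          by (simp add: euler_op_mult poly_dilate norm_mult[symmetric] norm_triangle_ineq)
        have 3: "norm (?d p z) * norm (poly w ?z) \<le> norm (?d (p * w) z) + A * norm (?d w z)" for w
        proof -
          have "?d p z * poly w ?z = ?d (p * w) z - poly p ?z * ?d w z"
            by (simp add: euler_op_mult poly_dilate)
          then have "norm (?d p z) * norm (poly w ?z) \<le> norm (?d (p * w) z) + norm (poly p ?z) * norm (?d w z)"
            by (metis norm_mult norm_triangle_ineq4)
          also have "\<dots> \<le> norm (?d (p * w) z) + A * norm (?d w z)"
            using p[OF z] by (intro add_left_mono mult_right_mono) auto
          finally show ?thesis .
        qed
        show "norm (?d R z * cnj (?d ?k z)) \<le> B * (3 / 2 * A * ((norm (?d u z))\<^sup>2 + (norm (?d v z))\<^sup>2)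
              + ((norm (?d (p * v) z))\<^sup>2 + (norm (?d (p * u) z))\<^sup>2) / (2 * A))"
          unfolding norm_mult complex_mod_cnj
          by (rule littlewood_paley_pointwise[OF \<open>A > 0\<close> \<open>B \<ge> 0\<close> 1 _ 2 _ _ _ 3 3]) auto
      qed (use \<open>A > 0\<close> in \<open>auto intro!: integrable_arc_continuous continuous_intros\<close>)
      also have "\<dots> = 2 * pi * (\<Sum>n\<le>N. b n * t ^ n)"
      proof -
        have int: "integrable arc_length (\<lambda>z. (norm (?d w z))\<^sup>2)" for w
          by (auto intro!: integrable_arc_continuous continuous_intros)
        define I where "I w n = (real n)\<^sup>2 * (norm (coeff w n))\<^sup>2 * t ^ n" for w :: "complex poly" and n
        have eq: "(\<integral>z. (norm (?d w z))\<^sup>2 \<partial>arc_length) = 2 * pi * (\<Sum>n\<le>N. I w n)" if "degree w \<le> N" for w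
          by (simp only: integral_euler_op_dilate[OF that] r I_def)
        have "(\<integral>z. B * (3 / 2 * A * ((norm (?d u z))\<^sup>2 + (norm (?d v z))\<^sup>2)
              + ((norm (?d (p * v) z))\<^sup>2 + (norm (?d (p * u) z))\<^sup>2) / (2 * A)) \<partial>arc_length)
          = B * (3 / 2 * A * ((\<integral>z. (norm (?d u z))\<^sup>2 \<partial>arc_length) + (\<integral>z. (norm (?d v z))\<^sup>2 \<partial>arc_length))
              + ((\<integral>z. (norm (?d (p * v) z))\<^sup>2 \<partial>arc_length) + (\<integral>z. (norm (?d (p * u) z))\<^sup>2 \<partial>arc_length)) / (2 * A))"
          by (simp add: int)
        also have "\<dots> = 2 * pi * (B * (3 / 2 * A) * (\<Sum>n\<le>N. I u n) + B * (3 / 2 * A) * (\<Sum>n\<le>N. I v n)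
              + B / (2 * A) * (\<Sum>n\<le>N. I (p * v) n) + B / (2 * A) * (\<Sum>n\<le>N. I (p * u) n))"
          using \<open>A > 0\<close> by (simp only: eq deg) (simp add: field_simps)
        also have "\<dots> = 2 * pi * (\<Sum>n\<le>N. b n * t ^ n)"
        proof -
          have "b n * t ^ n = B * (3 / 2 * A) * I u n + B * (3 / 2 * A) * I v n
              + B / (2 * A) * I (p * v) n + B / (2 * A) * I (p * u) n" for n
            using \<open>A > 0\<close> by (simp add: b_def w_def I_def field_simps)
          then show ?thesis by (simp only: sum.distrib sum_distrib_left)
        qed
        finally show ?thesis .
      qed
      finally show ?thesis unfolding ReJ by simp
    qed
    have "(\<Sum>n\<le>N. a n / (real n)\<^sup>2) \<le> (\<Sum>n\<le>N. b n / (real n)\<^sup>2)"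
      by (rule sum_div_index_square_mono[OF _ _ main]) (auto simp: a_def b_def)
    \<comment> \<open>At n = 0 the quotient is 0 by division by zero, which agrees with S because
      \<open>coeff R 0 = 0\<close>.\<close>
    also have "(\<Sum>n\<le>N. a n / (real n)\<^sup>2) = Re (\<omega> * S)"
      unfolding S_def sum_distrib_left Re_sum a_def using R(2)
      by (intro sum.cong refl) auto
    also have "(\<Sum>n\<le>N. b n / (real n)\<^sup>2) \<le> (\<Sum>n\<le>N. B * w n)"
      unfolding b_def using \<open>B \<ge> 0\<close> \<open>A > 0\<close> by (intro sum_mono) (auto simp: w_def)
    finally show ?thesis .
  qed
  let ?U = "\<Sum>n\<le>N. (norm (coeff u n))\<^sup>2" and ?V = "\<Sum>n\<le>N. (norm (coeff v n))\<^sup>2"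
  have "norm S \<le> (\<Sum>n\<le>N. B * w n)"
  proof (cases "S = 0")
    case True
    then show ?thesis using \<open>B \<ge> 0\<close> \<open>A > 0\<close> by (auto simp: w_def intro!: sum_nonneg)
  next
    case False
    have "cnj S / of_real (norm S) * S = (S * cnj S) / of_real (norm S)" by simp
    also have "\<dots> = of_real (norm S)"
      unfolding complex_norm_square[symmetric] using False by (simp add: power2_eq_square)
    finally have eq: "cnj S / of_real (norm S) * S = of_real (norm S)" .
    have "norm (cnj S / of_real (norm S)) = 1" using False by (simp add: norm_divide)
    from bound[OF this] show ?thesis unfolding eq by simp
  qed
  also have "\<dots> = B * (3 / 2 * A * (?U + ?V)
      + ((\<Sum>n\<le>N. (norm (coeff (p * v) n))\<^sup>2) + (\<Sum>n\<le>N. (norm (coeff (p * u) n))\<^sup>2)) / (2 * A))"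
    by (simp add: w_def sum.distrib sum_distrib_left[symmetric] sum_divide_distrib[symmetric])
  also have "\<dots> \<le> B * (3 / 2 * A * (?U + ?V) + (A\<^sup>2 * ?V + A\<^sup>2 * ?U) / (2 * A))"
    using \<open>A > 0\<close> \<open>B \<ge> 0\<close> deg p
    by (intro mult_left_mono add_left_mono divide_right_mono add_mono sum_norm_coeff_mult_le) auto
  \<comment> \<open>The squares of the derivatives of u and v contribute 3/2, the products p u and p
    v contribute 1/2.\<close>
  also have "\<dots> = 2 * A * B * (?U + ?V)"
    using \<open>A > 0\<close> by (simp add: field_simps power2_eq_square)
  finally show ?thesis unfolding S_def .
qed

section \<open>Factorization of polynomials\<close>

lemma blaschke_identity:
  fixes a z :: complex
  shows "(norm (1 - cnj a * z))\<^sup>2 - (norm (z - a))\<^sup>2 = (1 - (norm a)\<^sup>2) * (1 - (norm z)\<^sup>2)"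
  unfolding cmod_power2 by (simp add: power2_eq_square algebra_simps)

text \<open>A zero a inside the disc moves from the polynomial into B: z - a is replaced by 1 - cnj
  a * z, of the same modulus on the circle by \<open>blaschke_identity\<close>, and the quotient of
  the two enters B. Zeros on or outside the circle stay in G, which may therefore vanish on the
  circle.\<close>

lemma blaschke_factor:
  fixes k :: "complex poly"
  assumes "k \<noteq> 0"
  shows "\<exists>G B. B holomorphic_on ball 0 1 \<and>
    (\<forall>z\<in>ball 0 1. norm (B z) \<le> 1 \<and> poly k z = B z * poly G z \<and> poly G z \<noteq> 0) \<and>
    (\<forall>z. norm z = 1 \<longrightarrow> norm (poly G z) = norm (poly k z))"
  using assms
proof (induction "degree k" arbitrary: k)
  case 0
  then obtain c where "k = [:c:]" by (metis degree_eq_zeroE)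
  with 0 show ?case
    by (intro exI[of _ k] exI[of _ "\<lambda>z. 1"]) auto
next
  case (Suc n)
  then have "\<exists>i\<in>{1..degree k}. coeff k i \<noteq> 0"
    by (intro bexI[of _ "degree k"]) auto
  then obtain a where "poly k a = 0"
    unfolding poly_altdef using fundamental_theorem_of_algebra[of "coeff k" "degree k"] by metis
  then obtain q where k: "k = [:-a, 1:] * q" by (auto simp: poly_eq_0_iff_dvd dvd_def)
  have "q \<noteq> 0" using k Suc.prems by auto
  moreover have "n = degree q" using Suc.hyps(2) \<open>q \<noteq> 0\<close> unfolding k by (subst (asm) degree_mult_eq) auto
  ultimately obtain G B where B: "B holomorphic_on ball 0 1"
    and in_disc: "\<And>z. z \<in> ball 0 1 \<Longrightarrow> norm (B z) \<le> 1 \<and> poly q z = B z * poly G z \<and> poly G z \<noteq> 0"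
    and on_circle: "\<And>z. norm z = 1 \<Longrightarrow> norm (poly G z) = norm (poly q z)"
    using Suc.hyps(1) by blast
  show ?case
  proof (cases "norm a < 1")
    case False
    have fac: "poly ([:-a, 1:] * p) z = (z - a) * poly p z" for p z
      by (simp add: algebra_simps)
    show ?thesis
    proof (intro exI[of _ "[:-a, 1:] * G"] exI[of _ B] conjI ballI allI impI)
      show "B holomorphic_on ball 0 1" by (rule B)
    next
      fix z :: complex assume z: "z \<in> ball 0 1"
      then have "z \<noteq> a" using False by auto
      then show "norm (B z) \<le> 1" "poly k z = B z * poly ([:-a, 1:] * G) z" "poly ([:-a, 1:] * G) z \<noteq> 0"
        using in_disc[OF z] unfolding k fac by auto
    next
      fix z :: complex assume "norm z = 1"
      then show "norm (poly ([:-a, 1:] * G) z) = norm (poly k z)"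
        unfolding k fac norm_mult by (simp only: on_circle)
    qed
  next
    case True
    have nz: "1 - cnj a * z \<noteq> 0" if "norm z \<le> 1" for z
    proof -
      have "norm (cnj a * z) \<le> norm a * 1"
        unfolding norm_mult complex_mod_cnj using that by (intro mult_left_mono) auto
      then have "norm (cnj a * z) \<noteq> norm (1::complex)" using True by simp
      then show ?thesis by (metis eq_iff_diff_eq_0)
    qed
    show ?thesis
    proof (intro exI[of _ "[:1, - cnj a:] * G"] exI[of _ "\<lambda>z. B z * ((z - a) / (1 - cnj a * z))"] conjI ballI allI impI)
      show "(\<lambda>z. B z * ((z - a) / (1 - cnj a * z))) holomorphic_on ball 0 1"
        using nz by (intro holomorphic_intros B) auto
    next
      fix z :: complex assume z: "z \<in> ball 0 1"
      then have z1: "norm z \<le> 1" by simp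
      note nz1 = nz[OF z1]
      have "0 \<le> (1 - (norm a)\<^sup>2) * (1 - (norm z)\<^sup>2)"
        using True z1 by (intro mult_nonneg_nonneg) (auto simp: abs_square_le_1)
      then have "(norm (z - a))\<^sup>2 \<le> (norm (1 - cnj a * z))\<^sup>2"
        unfolding blaschke_identity[of a z, symmetric] by linarith
      then have "norm (z - a) \<le> norm (1 - cnj a * z)"
        by (rule power2_le_imp_le) simp
      then have "norm ((z - a) / (1 - cnj a * z)) \<le> 1"
        using nz1 by (simp add: norm_divide)
      then show "norm (B z * ((z - a) / (1 - cnj a * z))) \<le> 1"
        using mult_le_one[OF conjunct1[OF in_disc[OF z]] norm_ge_zero] unfolding norm_mult by blast
      show "poly k z = B z * ((z - a) / (1 - cnj a * z)) * poly ([:1, - cnj a:] * G) z"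
      proof -
        have "poly k z = (z - a) * (B z * poly G z)" using in_disc[OF z] by (simp add: k algebra_simps)
        moreover have "poly ([:1, - cnj a:] * G) z = (1 - cnj a * z) * poly G z" by (simp add: algebra_simps)
        ultimately show ?thesis using nz1 by simp
      qed
      show "poly ([:1, - cnj a:] * G) z \<noteq> 0"
        using in_disc[OF z] nz1 by (simp add: mult.commute)
    next
      fix z :: complex assume z: "norm z = 1"
      have "(norm (1 - cnj a * z))\<^sup>2 = (norm (z - a))\<^sup>2"
        using blaschke_identity[of a z] z by simp
      then have "norm (1 - cnj a * z) = norm (z - a)" by simp
      moreover have "poly ([:1, - cnj a:] * G) z = (1 - cnj a * z) * poly G z" by (simp add: algebra_simps)
      moreover have "poly k z = (z - a) * poly q z" by (simp add: k algebra_simps)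
      ultimately show "norm (poly ([:1, - cnj a:] * G) z) = norm (poly k z)"
        using on_circle[OF z] by (simp add: norm_mult)
    qed
  qed
qed

section \<open>Taylor coefficients and their square sums\<close>

definition taylor_coeff :: "(complex \<Rightarrow> complex) \<Rightarrow> nat \<Rightarrow> complex" where
  "taylor_coeff f n = (deriv ^^ n) f 0 / fact n"

lemma taylor_coeff_mult:
  assumes "f holomorphic_on ball 0 1" "g holomorphic_on ball 0 1"
  shows "taylor_coeff (\<lambda>z. f z * g z) n = (\<Sum>i\<le>n. taylor_coeff f i * taylor_coeff g (n - i))"
proof -
  have "(deriv ^^ n) (\<lambda>z. f z * g z) 0
      = (\<Sum>i\<le>n. of_nat (n choose i) * (deriv ^^ i) f 0 * (deriv ^^ (n - i)) g 0)"
    using higher_deriv_mult[OF assms open_ball, of 0 n] by (simp add: atLeast0AtMost)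
  also have "\<dots> = (\<Sum>i\<le>n. fact n * (taylor_coeff f i * taylor_coeff g (n - i)))"
    by (intro sum.cong refl) (auto simp: taylor_coeff_def binomial_fact)
  finally show ?thesis by (simp add: taylor_coeff_def[of "\<lambda>z. f z * g z"] sum_distrib_left[symmetric])
qed

lemma taylor_coeff_poly: "taylor_coeff (poly p) n = coeff p n"
proof -
  have "(deriv ^^ n) (poly p) = poly ((pderiv ^^ n) p)"
    by (induction n) (auto simp: DERIV_imp_deriv)
  then have "(deriv ^^ n) (poly p) 0 = coeff ((pderiv ^^ n) p) 0"
    by (simp add: poly_0_coeff_0)
  also have "\<dots> = fact n * coeff p n"
    unfolding coeff_higher_pderiv by (simp add: pochhammer_fact)
  finally show ?thesis by (simp add: taylor_coeff_def)
qed

text \<open>On the circle of radius r < 1 the Taylor series converges absolutely, so Parseval for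
  the partial sums passes to the limit by dominated convergence. The radius stays below 1 because f
  need not extend to the boundary.\<close>

lemma bessel_taylor:
  assumes hol: "f holomorphic_on ball 0 1" and r: "0 \<le> r" "r < 1"
  shows "2 * pi * (\<Sum>n<M. (norm (taylor_coeff f n))\<^sup>2 * (r ^ n)\<^sup>2)
     \<le> (\<integral>z. (norm (f (of_real r * z)))\<^sup>2 \<partial>arc_length)"
proof -
  define a where "a = (\<lambda>n. taylor_coeff f n * of_real r ^ n)"
  define P where "P K = (\<Sum>n<K. monom (a n) n)" for K
  have cP: "coeff (P K) n = (if n < K then a n else 0)" for K n
    by (auto simp: P_def coeff_sum sum.delta)
  have dP: "degree (P K) \<le> K" for K
    by (rule degree_le) (auto simp: cP)
  have pP: "poly (P K) z = (\<Sum>n<K. a n * z ^ n)" for K z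
    by (simp add: P_def poly_sum poly_monom)
  have sums: "(\<lambda>n. a n * z ^ n) sums f (of_real r * z)" if "norm z \<le> 1" for z
  proof -
    have "norm (of_real r * z) < 1"
      using that r by (simp add: norm_mult) (metis less_eq_real_def mult.commute mult_left_le_one_le norm_ge_zero order_le_less_trans mult_left_le)
    then have "of_real r * z \<in> ball 0 1" by simp
    from holomorphic_power_series[OF hol this] show ?thesis
      by (simp add: a_def taylor_coeff_def power_mult_distrib mult_ac)
  qed
  have summ: "summable (\<lambda>n. norm (a n))"
  proof -
    \<comment> \<open>Convergence at an intermediate radius s gives absolute convergence at
      r.\<close>
    obtain s where s: "r < s" "s < 1" using r dense by blast
    have "of_real s \<in> ball (0::complex) 1" using s r by simp
    from holomorphic_power_series[OF hol this]
    have "summable (\<lambda>n. taylor_coeff f n * of_real s ^ n)"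
      by (auto simp: taylor_coeff_def sums_iff)
    then have "summable (\<lambda>n. norm (taylor_coeff f n * of_real r ^ n))"
      by (rule powser_insidea) (use s r in auto)
    then show ?thesis by (simp add: a_def)
  qed
  define W where "W = (\<Sum>n. norm (a n))"
  have W: "norm (poly (P K) z) \<le> W" if "norm z = 1" for K z
  proof -
    have "norm (poly (P K) z) \<le> (\<Sum>n<K. norm (a n * z ^ n))" unfolding pP by (rule norm_sum)
    also have "\<dots> = (\<Sum>n<K. norm (a n))" by (simp add: norm_mult norm_power that)
    also have "\<dots> \<le> W" unfolding W_def by (rule sum_le_suminf[OF summ]) auto
    finally show ?thesis .
  qed
  have "continuous_on (sphere 0 1) (\<lambda>z. f (of_real r * z))"
  proof (rule continuous_on_compose2[OF holomorphic_on_imp_continuous_on[OF hol]])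
    show "(\<lambda>z. complex_of_real r * z) ` sphere 0 1 \<subseteq> ball 0 1" using r by (auto simp: norm_mult dist_norm)
  qed (auto intro!: continuous_intros)
  then have cf: "continuous_on (sphere 0 1) (\<lambda>z. (norm (f (of_real r * z)))\<^sup>2)"
    by (intro continuous_intros)
  have "(\<lambda>K. \<integral>z. (norm (poly (P K) z))\<^sup>2 \<partial>arc_length) \<longlonglongrightarrow> (\<integral>z. (norm (f (of_real r * z)))\<^sup>2 \<partial>arc_length)"
  proof (rule integral_dominated_convergence)
    show "(\<lambda>z. (norm (f (of_real r * z)))\<^sup>2) \<in> borel_measurable arc_length"
      using integrable_arc_continuous[OF cf] by auto
    show "(\<lambda>z. (norm (poly (P K) z))\<^sup>2) \<in> borel_measurable arc_length" for K
      by (intro borel_measurable_integrable integrable_arc_continuous continuous_intros)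
    show "AE z in arc_length. (\<lambda>K. (norm (poly (P K) z))\<^sup>2) \<longlonglongrightarrow> (norm (f (of_real r * z)))\<^sup>2"
    proof (rule AE_I2)
      fix z :: complex assume "z \<in> space arc_length"
      then have "norm z \<le> 1" by (simp add: space_arc_length)
      from sums[OF this] have "(\<lambda>K. poly (P K) z) \<longlonglongrightarrow> f (of_real r * z)"
        unfolding sums_def pP .
      then show "(\<lambda>K. (norm (poly (P K) z))\<^sup>2) \<longlonglongrightarrow> (norm (f (of_real r * z)))\<^sup>2"
        by (intro tendsto_intros)
    qed
    show "AE z in arc_length. norm ((norm (poly (P K) z))\<^sup>2) \<le> W\<^sup>2" for K
      by (rule AE_I2) (auto simp: space_arc_length intro!: power_mono W)
  qed auto
  moreover have "2 * pi * (\<Sum>n<M. (norm (taylor_coeff f n))\<^sup>2 * (r ^ n)\<^sup>2)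
      \<le> (\<integral>z. (norm (poly (P K) z))\<^sup>2 \<partial>arc_length)" if "K \<ge> M" for K
  proof -
    have "(\<Sum>n<M. (norm (taylor_coeff f n))\<^sup>2 * (r ^ n)\<^sup>2) = (\<Sum>n<M. (norm (coeff (P K) n))\<^sup>2)"
      using that by (intro sum.cong) (use r in \<open>auto simp: cP a_def norm_mult norm_power power_mult_distrib\<close>)
    also have "\<dots> \<le> (\<Sum>n\<le>K. (norm (coeff (P K) n))\<^sup>2)"
      using that by (intro sum_mono2) auto
    finally show ?thesis
      by (simp add: integral_arc_poly_norm_square[OF dP])
  qed
  ultimately show ?thesis
    by (intro LIMSEQ_le_const) blast+
qed

text \<open>With k = B G and G = s^2 in the disc, the factors are u = B s and v = s. Both have
  squared modulus at most |G|, and |G| = |k| on the circle.\<close>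

lemma poly_factorization_l2:
  fixes k :: "complex poly"
  shows "\<exists>u v :: nat \<Rightarrow> complex. (\<forall>n. coeff k n = (\<Sum>i\<le>n. u i * v (n - i))) \<and>
     (\<forall>M. 2 * pi * (\<Sum>n<M. (norm (u n))\<^sup>2) \<le> (\<integral>z. norm (poly k z) \<partial>arc_length)) \<and>
     (\<forall>M. 2 * pi * (\<Sum>n<M. (norm (v n))\<^sup>2) \<le> (\<integral>z. norm (poly k z) \<partial>arc_length))"
proof (cases "k = 0")
  case True
  then show ?thesis by (intro exI[of _ "\<lambda>_. 0"]) auto
next
  case False
  obtain G B where B: "B holomorphic_on ball 0 1"
    and in_disc: "\<And>z. z \<in> ball 0 1 \<Longrightarrow> norm (B z) \<le> 1 \<and> poly k z = B z * poly G z \<and> poly G z \<noteq> 0"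
    and on_circle: "\<And>z. norm z = 1 \<Longrightarrow> norm (poly G z) = norm (poly k z)"
    using blaschke_factor[OF False] by blast
  obtain s where s: "s holomorphic_on ball 0 1" and Gs: "\<And>z. z \<in> ball 0 1 \<Longrightarrow> poly G z = s z ^ 2"
    by (rule contractible_imp_holomorphic_sqrt[of "poly G" "ball 0 1"])
      (use in_disc in \<open>auto intro!: holomorphic_intros convex_imp_contractible\<close>)
  let ?u = "\<lambda>z. B z * s z"
  have u: "?u holomorphic_on ball 0 1" by (intro holomorphic_intros B s)
  have bound: "2 * pi * (\<Sum>n<M. (norm (taylor_coeff f n))\<^sup>2) \<le> (\<integral>z. norm (poly k z) \<partial>arc_length)"
    if f: "f holomorphic_on ball 0 1" and fs: "\<And>z. z \<in> ball 0 1 \<Longrightarrow> norm (f z) \<le> norm (s z)" for f M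
  proof -
    \<comment> \<open>The root s need not extend smoothly to the circle, where G may vanish. The
      bound is taken on circles of radius \<open>r j\<close>, and only the polynomial G has to be
      followed to the boundary.\<close>
    define r where "r j = real j / real (Suc j)" for j
    have r: "0 \<le> r j" "r j < 1" for j by (auto simp: r_def)
    have r1: "r \<longlonglongrightarrow> 1" unfolding r_def by (rule LIMSEQ_n_over_Suc_n)
    have "bounded (poly G ` cball 0 1)"
      by (intro compact_imp_bounded compact_continuous_image continuous_intros compact_cball)
    then obtain W where W: "\<forall>z\<in>cball 0 1. norm (poly G z) \<le> W" unfolding bounded_iff by blast
    have le: "2 * pi * (\<Sum>n<M. (norm (taylor_coeff f n))\<^sup>2 * (r j ^ n)\<^sup>2) \<le> (\<integral>z. norm (poly G (of_real (r j) * z)) \<partial>arc_length)" for j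
    proof -
      have sub: "of_real (r j) * z \<in> ball 0 1" if "norm z = 1" for z :: complex
        using r[of j] that by (simp add: norm_mult)
      have cf: "continuous_on (sphere 0 1) (\<lambda>z. f (of_real (r j) * z))"
        by (rule continuous_on_compose2[OF holomorphic_on_imp_continuous_on[OF f]])
          (use sub in \<open>auto intro!: continuous_intros\<close>)
      have "(\<integral>z. (norm (f (of_real (r j) * z)))\<^sup>2 \<partial>arc_length) \<le> (\<integral>z. norm (poly G (of_real (r j) * z)) \<partial>arc_length)"
      proof (rule integral_mono)
        fix z :: complex assume "z \<in> space arc_length"
        then have z: "of_real (r j) * z \<in> ball 0 1" by (intro sub) (simp add: space_arc_length)
        show "(norm (f (of_real (r j) * z)))\<^sup>2 \<le> norm (poly G (of_real (r j) * z))"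
          unfolding Gs[OF z] norm_power by (intro power_mono fs z) auto
      qed (intro integrable_arc_continuous continuous_intros cf)+
      with bessel_taylor[OF f r(1)[of j] r(2)[of j], of M] show ?thesis by (rule order_trans)
    qed
    have "(\<lambda>j. 2 * pi * (\<Sum>n<M. (norm (taylor_coeff f n))\<^sup>2 * (r j ^ n)\<^sup>2)) \<longlonglongrightarrow>
        2 * pi * (\<Sum>n<M. (norm (taylor_coeff f n))\<^sup>2 * (1 ^ n)\<^sup>2)"
      by (intro tendsto_intros r1)
    moreover have "(\<lambda>j. \<integral>z. norm (poly G (of_real (r j) * z)) \<partial>arc_length) \<longlonglongrightarrow> (\<integral>z. norm (poly G z) \<partial>arc_length)"
    proof (rule integral_dominated_convergence)
      show "(\<lambda>z. norm (poly G z)) \<in> borel_measurable arc_length"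
        by (intro borel_measurable_integrable integrable_arc_continuous continuous_intros)
      show "(\<lambda>z. norm (poly G (of_real (r j) * z))) \<in> borel_measurable arc_length" for j
        by (intro borel_measurable_integrable integrable_arc_continuous continuous_intros)
      have "(\<lambda>j. norm (poly G (of_real (r j) * z))) \<longlonglongrightarrow> norm (poly G (of_real 1 * z))" for z
        by (intro tendsto_intros r1)
      then show "AE z in arc_length. (\<lambda>j. norm (poly G (of_real (r j) * z))) \<longlonglongrightarrow> norm (poly G z)"
        by simp
      show "AE z in arc_length. norm (norm (poly G (of_real (r j) * z))) \<le> W" for j
        using W r[of j] by (intro AE_I2) (auto simp: space_arc_length norm_mult)
    qed auto
    ultimately have "2 * pi * (\<Sum>n<M. (norm (taylor_coeff f n))\<^sup>2 * (1 ^ n)\<^sup>2) \<le> (\<integral>z. norm (poly G z) \<partial>arc_length)"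
      by (rule LIMSEQ_le) (use le in blast)
    also have "(\<integral>z. norm (poly G z) \<partial>arc_length) = (\<integral>z. norm (poly k z) \<partial>arc_length)"
      by (rule integral_arc_cong) (rule on_circle)
    finally show ?thesis by simp
  qed
  show ?thesis
  proof (intro exI conjI allI)
    fix n
    have "coeff k n = taylor_coeff (poly k) n" by (simp add: taylor_coeff_poly)
    also have "\<dots> = taylor_coeff (\<lambda>z. ?u z * s z) n"
      unfolding taylor_coeff_def
      by (rule arg_cong[where f = "\<lambda>x. x / fact n"], rule higher_deriv_transform_within_open[of _ "ball 0 1"])
        (use in_disc Gs in \<open>auto intro!: holomorphic_intros u s simp: power2_eq_square\<close>)
    finally show "coeff k n = (\<Sum>i\<le>n. taylor_coeff ?u i * taylor_coeff s (n - i))"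
      by (simp add: taylor_coeff_mult[OF u s])
  next
    fix M
    have "norm (?u z) \<le> norm (s z)" if "z \<in> ball 0 1" for z
      using in_disc[OF that] mult_right_mono[of "norm (B z)" 1 "norm (s z)"] by (simp add: norm_mult)
    then show "2 * pi * (\<Sum>n<M. (norm (taylor_coeff ?u n))\<^sup>2) \<le> (\<integral>z. norm (poly k z) \<partial>arc_length)"
      by (intro bound u)
    show "2 * pi * (\<Sum>n<M. (norm (taylor_coeff s n))\<^sup>2) \<le> (\<integral>z. norm (poly k z) \<partial>arc_length)"
      by (intro bound s) auto
  qed
qed

section \<open>Fejer kernels and compactness\<close>

text \<open>The extremal test function cnj f / |f| breaks down at zeros of f. Adding d to the
  denominator makes it continuous and costs at most d times the total mass.\<close>

lemma integral_norm_le_by_duality: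
  fixes f :: "complex \<Rightarrow> complex"
  assumes f: "continuous_on (sphere 0 1) f"
    and dual: "\<And>q. continuous_on (sphere 0 1) q \<Longrightarrow> (\<And>z. norm z = 1 \<Longrightarrow> norm (q z) \<le> 1)
        \<Longrightarrow> norm (\<integral>z. f z * q z \<partial>arc_length) \<le> C"
  shows "(\<integral>z. norm (f z) \<partial>arc_length) \<le> C"
proof (rule field_le_epsilon)
  fix e :: real assume "e > 0"
  define d where "d = e / (measure arc_length (space arc_length) + 1)"
  have d: "d > 0" using \<open>e > 0\<close> by (auto simp: d_def intro!: divide_pos_pos add_nonneg_pos)
  have pos: "norm (f z) + d > 0" for z using d by (simp add: add_nonneg_pos)
  then have nz: "complex_of_real (norm (f z) + d) \<noteq> 0" for z
    by (metis less_irrefl of_real_eq_0_iff)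
  define q where "q z = cnj (f z) / of_real (norm (f z) + d)" for z
  have q: "continuous_on (sphere 0 1) q"
    unfolding q_def using nz by (intro continuous_intros f) auto
  have q1: "norm (q z) \<le> 1" for z
    unfolding q_def using pos[of z] d by (simp add: norm_divide del: of_real_add)
  have fq: "f z * q z = of_real ((norm (f z))\<^sup>2 / (norm (f z) + d))" for z
    by (simp add: q_def complex_norm_square del: of_real_power)
  have cont: "continuous_on (sphere 0 1) (\<lambda>z. (norm (f z))\<^sup>2 / (norm (f z) + d))"
    using pos by (intro continuous_intros f) (auto simp: less_le)
  have "(\<integral>z. norm (f z) - d \<partial>arc_length) \<le> (\<integral>z. (norm (f z))\<^sup>2 / (norm (f z) + d) \<partial>arc_length)"
  proof (rule integral_mono)
    fix z
    have "(norm (f z) - d) * (norm (f z) + d) \<le> (norm (f z))\<^sup>2"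
      by (simp add: power2_eq_square algebra_simps)
    then show "norm (f z) - d \<le> (norm (f z))\<^sup>2 / (norm (f z) + d)"
      using pos[of z] by (simp add: le_divide_eq)
  qed (intro integrable_arc_continuous cont continuous_intros f)+
  also have "\<dots> = Re (\<integral>z. f z * q z \<partial>arc_length)"
    by (simp only: fq integral_complex_of_real Re_complex_of_real)
  also have "\<dots> \<le> norm (\<integral>z. f z * q z \<partial>arc_length)" by (rule complex_Re_le_cmod)
  also have "\<dots> \<le> C" using dual[OF q q1] by blast
  finally have "(\<integral>z. norm (f z) - d \<partial>arc_length) \<le> C" .
  moreover have "(\<integral>z. norm (f z) - d \<partial>arc_length)
      = (\<integral>z. norm (f z) \<partial>arc_length) - d * measure arc_length (space arc_length)"
    by (subst Bochner_Integration.integral_diff)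
      (auto intro!: integrable_arc_continuous continuous_intros f)
  moreover have "d * measure arc_length (space arc_length) \<le> e"
    using \<open>e > 0\<close> by (simp add: d_def divide_le_eq add_nonneg_pos)
  ultimately show "(\<integral>z. norm (f z) \<partial>arc_length) \<le> C + e" by simp
qed

text \<open>The positive frequencies of the Fejer kernel, which on the unit circle equals
  \<open>1 + 2 * Re (fejer_half N w)\<close>. Pairing a function with this half yields a polynomial,
  the Cesaro version of its analytic projection.\<close>

definition fejer_half :: "nat \<Rightarrow> complex \<Rightarrow> complex" where
  "fejer_half N w = (\<Sum>n=1..<N. of_real (1 - real n / real N) * w ^ n)"

lemma norm_add_square:
  fixes a b :: complex
  shows "(norm (a + b))\<^sup>2 = (norm a)\<^sup>2 + (norm b)\<^sup>2 + 2 * Re (b * cnj a)"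
  unfolding cmod_power2 by (simp add: power2_eq_square algebra_simps)

text \<open>N times the Fejer kernel is the squared modulus of a geometric sum, whence its
  positivity. In the induction the cross term is w + ... + w^N and raises every weight N - n by
  one.\<close>

lemma fejer_sum_square:
  assumes "norm w = 1"
  shows "(norm (\<Sum>j<N. w ^ j))\<^sup>2 = real N + 2 * Re (\<Sum>n=1..<N. of_real (real N - real n) * w ^ n)"
proof (induction N)
  case 0
  then show ?case by simp
next
  case (Suc N)
  have wc: "w * cnj w = 1" using assms by (simp add: complex_norm_square[symmetric])
  have wp: "w ^ N * cnj (w ^ j) = w ^ (N - j)" if "j < N" for j
  proof -
    have "w ^ N = w ^ (N - j) * w ^ j" using that by (simp add: power_add[symmetric])
    then have "w ^ N * cnj (w ^ j) = w ^ (N - j) * (w * cnj w) ^ j" by (simp add: power_mult_distrib)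
    then show ?thesis by (simp add: wc)
  qed
  have "w ^ N * cnj (\<Sum>j<N. w ^ j) = (\<Sum>j<N. w ^ (N - j))"
    unfolding cnj_sum sum_distrib_left by (intro sum.cong refl wp) auto
  also have "\<dots> = (\<Sum>n=1..<Suc N. w ^ n)"
    by (rule sum.reindex_bij_witness[of _ "\<lambda>n. N - n" "\<lambda>j. N - j"]) auto
  finally have eq: "w ^ N * cnj (\<Sum>j<N. w ^ j) = (\<Sum>n=1..<Suc N. w ^ n)" .
  have "(norm (\<Sum>j<Suc N. w ^ j))\<^sup>2 = (norm (\<Sum>j<N. w ^ j))\<^sup>2 + (norm (w ^ N))\<^sup>2 + 2 * Re (w ^ N * cnj (\<Sum>j<N. w ^ j))"
    unfolding sum.lessThan_Suc by (rule norm_add_square)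
  also have "\<dots> = (real N + 2 * Re (\<Sum>n=1..<N. of_real (real N - real n) * w ^ n)) + 1
      + 2 * Re (\<Sum>n=1..<Suc N. w ^ n)"
    unfolding eq Suc by (simp add: norm_power assms)
  \<comment> \<open>The added index n = N has weight N - N = 0.\<close>
  also have "(\<Sum>n=1..<N. of_real (real N - real n) * w ^ n) = (\<Sum>n=1..<Suc N. of_real (real N - real n) * w ^ n)"
    by (cases "N = 0") auto
  also have "real N + 2 * Re (\<Sum>n=1..<Suc N. of_real (real N - real n) * w ^ n) + 1 + 2 * Re (\<Sum>n=1..<Suc N. w ^ n)
      = real (Suc N) + 2 * Re (\<Sum>n=1..<Suc N. (of_real (real N - real n) * w ^ n + w ^ n))"
    by (simp only: sum.distrib plus_complex.sel) simp
  also have "(\<Sum>n=1..<Suc N. (of_real (real N - real n) * w ^ n + w ^ n))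
      = (\<Sum>n=1..<Suc N. of_real (real (Suc N) - real n) * w ^ n)"
    by (intro sum.cong refl) (simp add: algebra_simps)
  finally show ?case .
qed

lemma fejer_nonneg:
  assumes "norm w = 1" "N \<ge> 1"
  shows "0 \<le> 1 + 2 * Re (fejer_half N w)"
proof -
  have "of_real (real N) * fejer_half N w = (\<Sum>n=1..<N. of_real (real N - real n) * w ^ n)"
    unfolding fejer_half_def sum_distrib_left using \<open>N \<ge> 1\<close>
    by (intro sum.cong refl) (simp add: field_simps)
  then have "real N * (1 + 2 * Re (fejer_half N w))
      = real N + 2 * Re (\<Sum>n=1..<N. of_real (real N - real n) * w ^ n)"
    by (metis Re_complex_of_real distrib_left mult.left_commute mult.right_neutral
        scaleR_complex.sel(1) scaleR_conv_of_real)
  also have "\<dots> \<ge> 0" unfolding fejer_sum_square[OF assms(1), symmetric] by simp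
  finally show ?thesis using \<open>N \<ge> 1\<close> by (simp add: zero_le_mult_iff)
qed

lemma integral_fejer_half:
  assumes "continuous_on (sphere 0 1) q"
  shows "(\<integral>z. q z * fejer_half N (w * cnj z) \<partial>arc_length)
    = (\<Sum>n=1..<N. of_real (1 - real n / real N) * (\<integral>z. q z * z powi (- int n) \<partial>arc_length) * w ^ n)"
proof -
  have "(\<integral>z. q z * fejer_half N (w * cnj z) \<partial>arc_length)
    = (\<integral>z. (\<Sum>n=1..<N. (of_real (1 - real n / real N) * w ^ n) * (q z * z powi (- int n))) \<partial>arc_length)"
    by (rule integral_arc_cong)
      (simp add: fejer_half_def sum_distrib_left power_mult_distrib cnj_eq_powi[symmetric] mult_ac)
  also have "\<dots> = (\<Sum>n=1..<N. (of_real (1 - real n / real N) * w ^ n) * (\<integral>z. q z * z powi (- int n) \<partial>arc_length))"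
    by (subst Bochner_Integration.integral_sum)
      (auto intro!: integrable_mult_right integrable_arc_continuous continuous_intros assms)
  finally show ?thesis by (simp add: mult_ac)
qed

lemma continuous_on_fejer_half: "continuous_on S (\<lambda>z. fejer_half N (w * cnj z))"
  unfolding fejer_half_def by (intro continuous_intros)

lemma measure_arc_length: "measure arc_length (space arc_length) = 2 * pi"
proof -
  have "complex_of_real (measure arc_length (space arc_length)) = complex_of_real (2 * pi)"
    using integral_arc_powi[of 0] by (simp add: scaleR_conv_of_real)
  then show ?thesis by (simp only: of_real_eq_iff)
qed

lemma integral_fejer_kernel:
  assumes "norm w = 1"
  shows "(\<integral>z. 1 + 2 * Re (fejer_half N (w * cnj z)) \<partial>arc_length) = 2 * pi"
proof -
  have "(\<integral>z. 1 * fejer_half N (w * cnj z) \<partial>arc_length) = 0"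
    by (subst integral_fejer_half) (auto intro!: continuous_intros simp: integral_arc_powi)
  then have "Re (\<integral>z. fejer_half N (w * cnj z) \<partial>arc_length) = 0" by simp
  then have "(\<integral>z. Re (fejer_half N (w * cnj z)) \<partial>arc_length) = 0"
    by (subst integral_Re) (auto intro!: integrable_arc_continuous continuous_on_fejer_half)
  then show ?thesis
    by (subst Bochner_Integration.integral_add)
      (auto intro!: integrable_arc_continuous continuous_intros continuous_on_fejer_half simp: measure_arc_length)
qed

text \<open>The Cesaro mean of the formal power series with coefficients c; the constant term is
  left out to match \<open>fejer_half\<close>.\<close>

definition fejer_poly :: "nat \<Rightarrow> (nat \<Rightarrow> complex) \<Rightarrow> complex poly" where
  "fejer_poly N c = (\<Sum>n=1..<N. monom (of_real (1 - real n / real N) * c n) n)"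

lemma coeff_fejer_poly:
  "coeff (fejer_poly N c) n = (if 1 \<le> n \<and> n < N then of_real (1 - real n / real N) * c n else 0)"
  by (auto simp: fejer_poly_def coeff_sum sum.delta)

lemma poly_fejer_poly: "poly (fejer_poly N c) z = (\<Sum>n=1..<N. of_real (1 - real n / real N) * c n * z ^ n)"
  by (simp add: fejer_poly_def poly_sum poly_monom)

text \<open>
  The sequence \<open>b\<close> consists of the Taylor coefficients of a product of two functions in \<open>H\<^sup>2\<close>,
  each of squared norm at most \<open>L\<close>.
\<close>

definition l2_factorable :: "real \<Rightarrow> (nat \<Rightarrow> complex) \<Rightarrow> bool" where
  "l2_factorable L b \<longleftrightarrow> (\<exists>u v. (\<forall>n. b n = (\<Sum>i\<le>n. u i * v (n - i))) \<and>
     (\<forall>M. (\<Sum>n<M. (norm (u n))\<^sup>2) \<le> L) \<and> (\<forall>M. (\<Sum>n<M. (norm (v n))\<^sup>2) \<le> L))"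

text \<open>Square sums at most L bound every entry of the factors by sqrt L, so a diagonal
  subsequence converges at each index. Every convolution and every partial square sum involves
  finitely many indices and passes to the limit.\<close>

lemma l2_factorable_limit:
  assumes fact: "\<And>N. l2_factorable L (a N)" and lim: "\<And>n. (\<lambda>N. a N n) \<longlonglongrightarrow> b n"
  shows "l2_factorable L b"
proof -
  have "\<forall>N. l2_factorable L (a N)" using fact by blast
  from choice[OF this[unfolded l2_factorable_def]] obtain u where "\<forall>N. \<exists>v. (\<forall>n. a N n = (\<Sum>i\<le>n. u N i * v (n - i))) \<and>
     (\<forall>M. (\<Sum>n<M. (norm (u N n))\<^sup>2) \<le> L) \<and> (\<forall>M. (\<Sum>n<M. (norm (v n))\<^sup>2) \<le> L)"
    by blast
  from choice[OF this] obtain v where a: "\<And>N n. a N n = (\<Sum>i\<le>n. u N i * v N (n - i))"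
    and u: "\<And>N M. (\<Sum>n<M. (norm (u N n))\<^sup>2) \<le> L" and v: "\<And>N M. (\<Sum>n<M. (norm (v N n))\<^sup>2) \<le> L"
    by blast
  have bounded: "norm x \<le> sqrt L" if "\<And>M. (\<Sum>n<M. (norm (w n))\<^sup>2) \<le> L" "x = w n" for w :: "nat \<Rightarrow> complex" and n x
  proof -
    have "(norm (w n))\<^sup>2 \<le> (\<Sum>i<Suc n. (norm (w i))\<^sup>2)" by (simp add: sum_nonneg)
    also have "\<dots> \<le> L" by (rule that)
    finally show ?thesis using that(2) by (simp add: real_le_rsqrt)
  qed
  interpret subseqs "\<lambda>n s. convergent (\<lambda>j. (u (s j) n, v (s j) n))"
  proof
    fix n and s :: "nat \<Rightarrow> nat"
    have "bounded (range (\<lambda>j. (u (s j) n, v (s j) n)))"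
      using bounded[OF u] bounded[OF v]
      by (intro bounded_subset[OF bounded_Times[OF bounded_cball[of 0 "sqrt L"] bounded_cball[of 0 "sqrt L"]]]) auto
    then obtain l r where "strict_mono r" "((\<lambda>j. (u (s j) n, v (s j) n)) \<circ> r) \<longlonglongrightarrow> l"
      using bounded_imp_convergent_subsequence by blast
    then show "\<exists>r. strict_mono r \<and> convergent (\<lambda>j. (u ((s \<circ> r) j) n, v ((s \<circ> r) j) n))"
      unfolding convergent_def comp_def by blast
  qed
  have conv: "convergent (\<lambda>j. (u (diagseq j) n, v (diagseq j) n))" for n
  proof -
    \<comment> \<open>Only the tail of the diagonal sequence is a subsequence of the one chosen for
      index n, hence the shift by \<open>Suc n\<close>.\<close>
    have "convergent (\<lambda>j. (u ((diagseq \<circ> ((+) (Suc n))) j) n, v ((diagseq \<circ> ((+) (Suc n))) j) n))"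
    proof (rule diagseq_holds)
      fix r s :: "nat \<Rightarrow> nat" and n
      assume r: "strict_mono r" and "convergent (\<lambda>j. (u (s j) n, v (s j) n))"
      from convergent_subseq_convergent[OF this(2,1)]
      show "convergent (\<lambda>j. (u ((s \<circ> r) j) n, v ((s \<circ> r) j) n))" by (simp add: comp_def)
    qed
    then have "convergent (\<lambda>j. (\<lambda>j. (u (diagseq j) n, v (diagseq j) n)) (j + Suc n))"
      by (simp add: comp_def add.commute)
    then show ?thesis
      by (rule convergent_ignore_initial_segment[of "\<lambda>j. (u (diagseq j) n, v (diagseq j) n)", THEN iffD1])
  qed
  define U where "U n = fst (lim (\<lambda>j. (u (diagseq j) n, v (diagseq j) n)))" for n
  define V where "V n = snd (lim (\<lambda>j. (u (diagseq j) n, v (diagseq j) n)))" for n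
  have U: "(\<lambda>j. u (diagseq j) n) \<longlonglongrightarrow> U n" and V: "(\<lambda>j. v (diagseq j) n) \<longlonglongrightarrow> V n" for n
    using tendsto_fst[OF convergent_LIMSEQ_iff[THEN iffD1, OF conv[of n]]]
      tendsto_snd[OF convergent_LIMSEQ_iff[THEN iffD1, OF conv[of n]]]
    by (simp_all add: U_def V_def)
  show ?thesis unfolding l2_factorable_def
  proof (intro exI conjI allI)
    fix n
    have "(\<lambda>j. a (diagseq j) n) \<longlonglongrightarrow> (\<Sum>i\<le>n. U i * V (n - i))"
      unfolding a by (intro tendsto_intros U V)
    moreover have "(\<lambda>j. a (diagseq j) n) \<longlonglongrightarrow> b n"
      using LIMSEQ_subseq_LIMSEQ[OF lim subseq_diagseq] by (simp add: comp_def)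
    ultimately show "b n = (\<Sum>i\<le>n. U i * V (n - i))" using LIMSEQ_unique by blast
  next
    fix M
    have "(\<lambda>j. \<Sum>n<M. (norm (u (diagseq j) n))\<^sup>2) \<longlonglongrightarrow> (\<Sum>n<M. (norm (U n))\<^sup>2)"
      by (intro tendsto_intros U)
    then show "(\<Sum>n<M. (norm (U n))\<^sup>2) \<le> L"
      by (rule LIMSEQ_le_const2) (use u in blast)
    have "(\<lambda>j. \<Sum>n<M. (norm (v (diagseq j) n))\<^sup>2) \<longlonglongrightarrow> (\<Sum>n<M. (norm (V n))\<^sup>2)"
      by (intro tendsto_intros V)
    then show "(\<Sum>n<M. (norm (V n))\<^sup>2) \<le> L"
      by (rule LIMSEQ_le_const2) (use v in blast)
  qed
qed

text \<open>The Fejer polynomials converge to b in each coefficient, and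
  \<open>poly_factorization_l2\<close> factors each of them with square sums at most L, the factor 2
  * pi cancelling. The order is \<open>Suc N\<close> because the bound is assumed from order 1
  on.\<close>

lemma l2_factorable_if_fejer_bounded:
  assumes "b 0 = 0" and bd: "\<And>N. N \<ge> 1 \<Longrightarrow> (\<integral>z. norm (poly (fejer_poly N b) z) \<partial>arc_length) \<le> 2 * pi * L"
  shows "l2_factorable L b"
proof (rule l2_factorable_limit)
  fix N
  obtain u v where c: "\<forall>n. coeff (fejer_poly (Suc N) b) n = (\<Sum>i\<le>n. u i * v (n - i))"
    and u: "\<forall>M. 2 * pi * (\<Sum>n<M. (norm (u n))\<^sup>2) \<le> (\<integral>z. norm (poly (fejer_poly (Suc N) b) z) \<partial>arc_length)"
    and v: "\<forall>M. 2 * pi * (\<Sum>n<M. (norm (v n))\<^sup>2) \<le> (\<integral>z. norm (poly (fejer_poly (Suc N) b) z) \<partial>arc_length)"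
    using poly_factorization_l2 by blast
  have "(\<Sum>n<M. (norm (u n))\<^sup>2) \<le> L" "(\<Sum>n<M. (norm (v n))\<^sup>2) \<le> L" for M
    using order_trans[OF spec[OF u, of M] bd] order_trans[OF spec[OF v, of M] bd] by auto
  with c show "l2_factorable L (coeff (fejer_poly (Suc N) b))"
    unfolding l2_factorable_def by blast
next
  fix n
  show "(\<lambda>N. coeff (fejer_poly (Suc N) b) n) \<longlonglongrightarrow> b n"
  proof (cases "n = 0")
    case True
    then show ?thesis using assms(1) by (simp add: coeff_fejer_poly)
  next
    case False
    have "(\<lambda>N. of_real (1 - real n * inverse (real (Suc N))) * b n) \<longlonglongrightarrow> of_real (1 - real n * 0) * b n"
      by (intro tendsto_intros LIMSEQ_inverse_real_of_nat)
    moreover have "\<forall>\<^sub>F N in sequentially. of_real (1 - real n * inverse (real (Suc N))) * b n = coeff (fejer_poly (Suc N) b) n"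
      using eventually_ge_at_top[of n]
      by eventually_elim (use False in \<open>auto simp: coeff_fejer_poly divide_inverse\<close>)
    ultimately show ?thesis by (simp add: Lim_transform_eventually)
  qed
qed

section \<open>Factorable sequences from dual bounds\<close>

lemma integral_cnj_fejer_poly:
  assumes "continuous_on (sphere 0 1) q"
  shows "(\<integral>z. cnj (poly (fejer_poly N b) z) * q z \<partial>arc_length)
    = (\<Sum>n=1..<N. of_real (1 - real n / real N) * cnj (b n) * (\<integral>z. q z * z powi (- int n) \<partial>arc_length))"
proof -
  have "(\<integral>z. cnj (poly (fejer_poly N b) z) * q z \<partial>arc_length)
    = (\<integral>z. (\<Sum>n=1..<N. (of_real (1 - real n / real N) * cnj (b n)) * (q z * z powi (- int n))) \<partial>arc_length)"
    by (rule integral_arc_cong)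
      (simp add: poly_fejer_poly sum_distrib_left cnj_eq_powi[symmetric] mult_ac)
  also have "\<dots> = (\<Sum>n=1..<N. (of_real (1 - real n / real N) * cnj (b n)) * (\<integral>z. q z * z powi (- int n) \<partial>arc_length))"
    by (subst Bochner_Integration.integral_sum)
      (auto intro!: integrable_mult_right integrable_arc_continuous continuous_intros assms)
  finally show ?thesis .
qed

lemma poly_fejer_poly_integral:
  assumes "continuous_on (sphere 0 1) q"
  shows "poly (fejer_poly N (\<lambda>n. \<integral>z. q z * z powi (- int n) \<partial>arc_length)) w
    = (\<integral>z. q z * fejer_half N (w * cnj z) \<partial>arc_length)"
  unfolding poly_fejer_poly integral_fejer_half[OF assms] ..

lemma norm_mult_cnj_circle: "norm w = 1 \<Longrightarrow> norm z = 1 \<Longrightarrow> norm (w * cnj z) = 1"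
  by (simp add: norm_mult)

text \<open>As f is real, the real part falls on the kernel. Positivity of 1 + 2 F, for F the real
  part of the half kernel, gives |F| \<le> 1 + F, whose integral is 2 * pi. The imaginary part has
  no bound independent of N.\<close>

lemma Re_fejer_integral_le:
  fixes f :: "complex \<Rightarrow> real"
  assumes f: "continuous_on (sphere 0 1) f" and f1: "\<And>z. norm z = 1 \<Longrightarrow> \<bar>f z\<bar> \<le> 1"
    and w: "norm w = 1" and "N \<ge> 1"
  shows "\<bar>Re (\<integral>z. of_real (f z) * fejer_half N (w * cnj z) \<partial>arc_length)\<bar> \<le> 2 * pi"
proof -
  let ?F = "\<lambda>z. Re (fejer_half N (w * cnj z))"
  have i: "integrable arc_length (\<lambda>z. of_real (f z) * fejer_half N (w * cnj z))"
    by (intro integrable_arc_continuous continuous_intros f continuous_on_fejer_half)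
  have "Re (\<integral>z. of_real (f z) * fejer_half N (w * cnj z) \<partial>arc_length) = (\<integral>z. f z * ?F z \<partial>arc_length)"
    unfolding integral_Re[OF i, symmetric] by simp
  also have "\<bar>\<dots>\<bar> \<le> (\<integral>z. \<bar>f z * ?F z\<bar> \<partial>arc_length)"
    using integral_norm_bound[of arc_length "\<lambda>z. f z * ?F z"] by simp
  also have "\<dots> \<le> (\<integral>z. ((1 + 2 * ?F z) + 1) / 2 \<partial>arc_length)"
  proof (rule integral_mono)
    fix z assume "z \<in> space arc_length"
    then have z: "norm z = 1" by (simp add: space_arc_length)
    have "\<bar>f z * ?F z\<bar> \<le> 1 * \<bar>?F z\<bar>"
      unfolding abs_mult by (intro mult_right_mono f1 z) auto
    also have "\<dots> \<le> ((1 + 2 * ?F z) + 1) / 2"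
      using fejer_nonneg[OF norm_mult_cnj_circle[OF w z] \<open>N \<ge> 1\<close>] by (auto simp: abs_le_iff field_simps)
    finally show "\<bar>f z * ?F z\<bar> \<le> ((1 + 2 * ?F z) + 1) / 2" .
  qed (intro integrable_arc_continuous continuous_intros f continuous_on_fejer_half; simp)+
  also have "\<dots> = ((\<integral>z. 1 + 2 * ?F z \<partial>arc_length) + (\<integral>z. 1 \<partial>arc_length)) / 2"
    unfolding integral_divide_zero
    by (subst Bochner_Integration.integral_add)
     (intro integrable_arc_continuous continuous_intros f continuous_on_fejer_half refl)+
  also have "\<dots> = 2 * pi"
    by (simp only: integral_fejer_kernel[OF w]) (simp add: measure_arc_length)
  finally show ?thesis .
qed

text \<open>A real test function f yields an admissible polynomial p: the analytic half of its Fejer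
  mean, divided by 2 * pi, has real part at most 1 in modulus by
  \<open>Re_fejer_integral_le\<close>. Pairing c with p amounts to pairing the Fejer polynomial with
  f. Complex test functions split into real and imaginary part, whence \<open>2 * C\<close>.\<close>

lemma l2_factorable_of_Re_bound:
  fixes c :: "nat \<Rightarrow> complex"
  assumes "c 0 = 0"
    and bd: "\<And>p. (\<And>z. norm z = 1 \<Longrightarrow> \<bar>Re (poly p z)\<bar> \<le> 1) \<Longrightarrow> norm (\<Sum>n\<le>degree p. c n * coeff p n) \<le> C"
  shows "l2_factorable (2 * C) (\<lambda>n. cnj (c n))"
proof (rule l2_factorable_if_fejer_bounded)
  fix N :: nat assume N: "N \<ge> 1"
  let ?k = "fejer_poly N (\<lambda>n. cnj (c n))"
  have real: "norm (\<integral>z. cnj (poly ?k z) * of_real (f z) \<partial>arc_length) \<le> 2 * pi * C"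
    if f: "continuous_on (sphere 0 1) f" and f1: "\<And>z. norm z = 1 \<Longrightarrow> \<bar>f z\<bar> \<le> 1" for f :: "complex \<Rightarrow> real"
  proof -
    have cf: "continuous_on (sphere 0 1) (\<lambda>z. complex_of_real (f z))" by (intro continuous_intros f)
    define Q where "Q = fejer_poly N (\<lambda>n. \<integral>z. of_real (f z) * z powi (- int n) \<partial>arc_length)"
    define p where "p = smult (of_real (inverse (2 * pi))) Q"
    have "\<bar>Re (poly p z)\<bar> \<le> 1" if "norm z = 1" for z
    proof -
      have "Re (poly p z) = inverse (2 * pi) * Re (poly Q z)"
        unfolding p_def poly_smult by (simp only: scaleR_conv_of_real[symmetric] scaleR_complex.sel)
      moreover have "\<bar>Re (poly Q z)\<bar> \<le> 2 * pi"
        unfolding Q_def poly_fejer_poly_integral[OF cf] by (rule Re_fejer_integral_le[OF f f1 that N])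
      ultimately have "\<bar>Re (poly p z)\<bar> \<le> inverse (2 * pi) * (2 * pi)"
        by (simp only: abs_mult) (intro mult_mono, auto)
      then show ?thesis by simp
    qed
    then have "norm (\<Sum>n\<le>degree p. c n * coeff p n) \<le> C" by (rule bd)
    also have "(\<Sum>n\<le>degree p. c n * coeff p n) = of_real (inverse (2 * pi)) * (\<Sum>n\<le>degree Q. c n * coeff Q n)"
      by (simp add: p_def sum_distrib_left mult_ac)
    also have "(\<Sum>n\<le>degree Q. c n * coeff Q n) = (\<integral>z. cnj (poly ?k z) * of_real (f z) \<partial>arc_length)"
    proof -
      have "degree Q \<le> N" unfolding Q_def by (rule degree_le) (auto simp: coeff_fejer_poly)
      then have "(\<Sum>n\<le>degree Q. c n * coeff Q n) = (\<Sum>n\<le>N. c n * coeff Q n)"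
        by (intro sum.mono_neutral_left) (auto simp: coeff_eq_0)
      also have "\<dots> = (\<Sum>n=1..<N. c n * coeff Q n)"
        by (intro sum.mono_neutral_right) (auto simp: Q_def coeff_fejer_poly)
      also have "\<dots> = (\<integral>z. cnj (poly ?k z) * of_real (f z) \<partial>arc_length)"
        unfolding integral_cnj_fejer_poly[OF cf] 
        by (intro sum.cong refl) (simp add: Q_def coeff_fejer_poly mult_ac)
      finally show ?thesis .
    qed
    finally show ?thesis unfolding norm_mult norm_of_real by (simp add: field_simps)
  qed
  have "(\<integral>z. norm (cnj (poly ?k z)) \<partial>arc_length) \<le> 2 * pi * (2 * C)"
  proof (rule integral_norm_le_by_duality)
    fix q assume q: "continuous_on (sphere 0 1) q" and q1: "\<And>z::complex. norm z = 1 \<Longrightarrow> norm (q z :: complex) \<le> 1"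
    have "(\<integral>z. cnj (poly ?k z) * q z \<partial>arc_length)
        = (\<integral>z. cnj (poly ?k z) * of_real (Re (q z)) + \<i> * (cnj (poly ?k z) * of_real (Im (q z))) \<partial>arc_length)"
      by (rule Bochner_Integration.integral_cong[OF refl]) (simp add: complex_eq_iff)
    also have "\<dots> = (\<integral>z. cnj (poly ?k z) * of_real (Re (q z)) \<partial>arc_length)
        + \<i> * (\<integral>z. cnj (poly ?k z) * of_real (Im (q z)) \<partial>arc_length)"
      unfolding integral_mult_right_zero[symmetric]
      by (rule Bochner_Integration.integral_add; intro integrable_arc_continuous continuous_intros q)
    also have "norm \<dots> \<le> norm (\<integral>z. cnj (poly ?k z) * of_real (Re (q z)) \<partial>arc_length)
        + norm (\<i> * (\<integral>z. cnj (poly ?k z) * of_real (Im (q z)) \<partial>arc_length))"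
      by (rule norm_triangle_ineq)
    also have "\<dots> \<le> 2 * pi * C + 2 * pi * C"
      unfolding norm_mult norm_ii mult_1
      by (intro add_mono real continuous_intros q)
        (use q1 abs_Re_le_cmod abs_Im_le_cmod order_trans in blast)+
    finally show "norm (\<integral>z. cnj (poly ?k z) * q z \<partial>arc_length) \<le> 2 * pi * (2 * C)" by (simp add: mult_ac)
  qed (intro continuous_intros)
  then show "(\<integral>z. norm (poly ?k z) \<partial>arc_length) \<le> 2 * pi * (2 * C)" by simp
qed (simp add: assms)

text \<open>Since h annihilates constants and conjugates of polynomials, its integral against the
  analytic half of a Fejer mean equals that against the whole mean T. The half has no uniform bound,
  whereas T is bounded by 2 * pi, the kernel being positive of mass 2 * pi.\<close>

lemma l2_factorable_of_integrable:
  assumes h: "integrable arc_length h"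
    and zero: "\<And>n::nat. (\<integral>z. h z * z powi (- int n) \<partial>arc_length) = 0"
  shows "l2_factorable (\<integral>z. norm (h z) \<partial>arc_length) (\<lambda>n. cnj (\<integral>z. h z * z ^ n \<partial>arc_length))"
proof (rule l2_factorable_if_fejer_bounded)
  show "cnj (\<integral>z. h z * z ^ 0 \<partial>arc_length) = 0" using zero[of 0] by simp
next
  fix N :: nat assume N: "N \<ge> 1"
  define c where "c n = (\<integral>z. h z * z ^ n \<partial>arc_length)" for n
  let ?k = "fejer_poly N (\<lambda>n. cnj (c n))"
  have "(\<integral>z. norm (cnj (poly ?k z)) \<partial>arc_length) \<le> 2 * pi * (\<integral>z. norm (h z) \<partial>arc_length)"
  proof (rule integral_norm_le_by_duality)
    fix q :: "complex \<Rightarrow> complex" assume q: "continuous_on (sphere 0 1) q" and q1: "\<And>z::complex. norm z = 1 \<Longrightarrow> norm (q z :: complex) \<le> 1"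
    have cq: "continuous_on (sphere 0 1) (\<lambda>z. cnj (q z))" by (intro continuous_intros q)
    define P where "P = fejer_poly N (\<lambda>n. \<integral>z. q z * z powi (- int n) \<partial>arc_length)"
    define P' where "P' = fejer_poly N (\<lambda>n. \<integral>z. cnj (q z) * z powi (- int n) \<partial>arc_length)"
    define T where "T w = (\<integral>z. q z * of_real (1 + 2 * Re (fejer_half N (w * cnj z))) \<partial>arc_length)" for w
    have T: "T w = (\<integral>z. q z \<partial>arc_length) + poly P w + cnj (poly P' w)" for w
    proof -
      have "T w = (\<integral>z. q z + q z * fejer_half N (w * cnj z) + cnj (cnj (q z) * fejer_half N (w * cnj z)) \<partial>arc_length)"
        unfolding T_def by (rule Bochner_Integration.integral_cong[OF refl])
         (simp add: complex_eq_iff algebra_simps)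
      also have "\<dots> = (\<integral>z. q z \<partial>arc_length) + (\<integral>z. q z * fejer_half N (w * cnj z) \<partial>arc_length)
         + (\<integral>z. cnj (cnj (q z) * fejer_half N (w * cnj z)) \<partial>arc_length)"
        by (subst Bochner_Integration.integral_add, (intro integrable_arc_continuous continuous_intros q continuous_on_fejer_half)+)+ simp
      also have "(\<integral>z. cnj (cnj (q z) * fejer_half N (w * cnj z)) \<partial>arc_length) = cnj (\<integral>z. cnj (q z) * fejer_half N (w * cnj z) \<partial>arc_length)"
        by (rule Bochner_Integration.integral_cnj)
      finally show ?thesis unfolding P_def P'_def poly_fejer_poly_integral[OF q] poly_fejer_poly_integral[OF cq] .
    qed
    have T_le: "norm (T w) \<le> 2 * pi" if w: "norm w = 1" for w
    proof -
      have "norm (T w) \<le> (\<integral>z. norm (q z * of_real (1 + 2 * Re (fejer_half N (w * cnj z)))) \<partial>arc_length)"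
        unfolding T_def by (rule integral_norm_bound)
      also have "\<dots> \<le> (\<integral>z. 1 + 2 * Re (fejer_half N (w * cnj z)) \<partial>arc_length)"
      proof (rule integral_mono)
        fix z assume "z \<in> space arc_length"
        then have z: "norm z = 1" by (simp add: space_arc_length)
        have nn: "0 \<le> 1 + 2 * Re (fejer_half N (w * cnj z))"
          by (rule fejer_nonneg[OF norm_mult_cnj_circle[OF w z] N])
        then show "norm (q z * of_real (1 + 2 * Re (fejer_half N (w * cnj z)))) \<le> 1 + 2 * Re (fejer_half N (w * cnj z))"
          unfolding norm_mult norm_of_real using mult_right_mono[OF q1[OF z] nn] by simp
      qed (intro integrable_arc_continuous continuous_intros q continuous_on_fejer_half)+
      also have "\<dots> = 2 * pi" by (rule integral_fejer_kernel[OF w])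
      finally show ?thesis .
    qed
    have cT: "continuous_on (sphere 0 1) T" unfolding T by (intro continuous_intros)
    have hp: "(\<integral>z. h z * poly (fejer_poly N b) z \<partial>arc_length) = (\<Sum>n=1..<N. of_real (1 - real n / real N) * b n * c n)" for b
    proof -
      have "(\<integral>z. h z * poly (fejer_poly N b) z \<partial>arc_length)
        = (\<integral>z. (\<Sum>n=1..<N. (of_real (1 - real n / real N) * b n) * (h z * z ^ n)) \<partial>arc_length)"
        by (simp add: poly_fejer_poly sum_distrib_left mult_ac)
      also have "\<dots> = (\<Sum>n=1..<N. (of_real (1 - real n / real N) * b n) * c n)"
        by (subst Bochner_Integration.integral_sum)
          (auto intro!: integrable_mult_right integrable_arc_mult continuous_intros h simp: c_def)
      finally show ?thesis .
    qed
    have hp': "(\<integral>z. h z * cnj (poly (fejer_poly N b) z) \<partial>arc_length) = 0" for b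
    proof -
      have "(\<integral>z. h z * cnj (poly (fejer_poly N b) z) \<partial>arc_length)
        = (\<integral>z. (\<Sum>n=1..<N. (of_real (1 - real n / real N) * cnj (b n)) * (h z * z powi (- int n))) \<partial>arc_length)"
        by (rule integral_arc_cong) (simp add: poly_fejer_poly sum_distrib_left cnj_eq_powi[symmetric] mult_ac)
      also have "\<dots> = (\<Sum>n=1..<N. (of_real (1 - real n / real N) * cnj (b n)) * 0)"
        by (subst Bochner_Integration.integral_sum)
          (auto intro!: integrable_mult_right integrable_arc_mult continuous_intros h simp: zero[simplified])
      finally show ?thesis by simp
    qed
    have "(\<integral>z. h z * T z \<partial>arc_length) = (\<integral>z. h z * (\<integral>z. q z \<partial>arc_length) \<partial>arc_length)
        + (\<integral>z. h z * poly P z \<partial>arc_length) + (\<integral>z. h z * cnj (poly P' z) \<partial>arc_length)"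
      unfolding T distrib_left
      by (subst Bochner_Integration.integral_add, (intro Bochner_Integration.integrable_add integrable_arc_mult continuous_intros h)+)+ simp
    also have "\<dots> = (\<integral>z. h z * poly P z \<partial>arc_length)"
      using zero[of 0] by (simp add: P'_def hp')
    also have "\<dots> = (\<integral>z. cnj (poly ?k z) * q z \<partial>arc_length)"
      unfolding P_def hp integral_cnj_fejer_poly[OF q] by (simp add: mult_ac)
    finally have eq: "(\<integral>z. cnj (poly ?k z) * q z \<partial>arc_length) = (\<integral>z. h z * T z \<partial>arc_length)" by simp
    have "norm (\<integral>z. h z * T z \<partial>arc_length) \<le> (\<integral>z. norm (h z * T z) \<partial>arc_length)"
      by (rule integral_norm_bound)
    also have "\<dots> \<le> (\<integral>z. 2 * pi * norm (h z) \<partial>arc_length)"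
    proof (rule integral_mono)
      fix z assume "z \<in> space arc_length"
      then have z: "norm z = 1" by (simp add: space_arc_length)
      show "norm (h z * T z) \<le> 2 * pi * norm (h z)"
        unfolding norm_mult using mult_right_mono[OF T_le[OF z] norm_ge_zero[of "h z"]] by (simp add: mult_ac)
    qed (use h integrable_arc_mult[OF h cT] in auto)
    finally show "norm (\<integral>z. cnj (poly ?k z) * q z \<partial>arc_length) \<le> 2 * pi * (\<integral>z. norm (h z) \<partial>arc_length)"
      unfolding eq by simp
  qed (intro continuous_intros)
  then show "(\<integral>z. norm (poly (fejer_poly N (\<lambda>n. cnj (\<integral>z. h z * z ^ n \<partial>arc_length))) z) \<partial>arc_length)
      \<le> 2 * pi * (\<integral>z. norm (h z) \<partial>arc_length)" by (simp add: c_def)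
qed

section \<open>From square summable factors to integrable functions\<close>

text \<open>An almost everywhere convergent subsequence supplies the limit. Fatou's lemma transfers
  the Cauchy bound to the distance from it, for the whole sequence.\<close>

lemma L1_complete:
  fixes s :: "nat \<Rightarrow> 'a \<Rightarrow> complex"
  assumes s: "\<And>n. integrable M (s n)"
    and cauchy: "\<And>e. e > 0 \<Longrightarrow> \<exists>N. \<forall>i\<ge>N. \<forall>j\<ge>N. (\<integral>x. norm (s i x - s j x) \<partial>M) < e"
  shows "\<exists>w. integrable M w \<and> (\<lambda>n. \<integral>x. norm (s n x - w x) \<partial>M) \<longlonglongrightarrow> 0"
proof -
  obtain r where r: "strict_mono r" and ae: "AE x in M. Cauchy (\<lambda>i. s (r i) x)"
    by (rule cauchy_L1_AE_cauchy_subseq[OF s cauchy])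
  define w where "w x = lim (\<lambda>i. s (r i) x)" for x
  have [measurable]: "s n \<in> borel_measurable M" for n using s by auto
  have [measurable]: "w \<in> borel_measurable M"
    unfolding w_def by (rule borel_measurable_lim_metric) auto
  have lim: "AE x in M. (\<lambda>i. s (r i) x) \<longlonglongrightarrow> w x"
    using ae by eventually_elim (simp add: w_def Cauchy_convergent_iff convergent_LIMSEQ_iff)
  have nn: "(\<integral>\<^sup>+x. ennreal (norm (s i x - w x)) \<partial>M) \<le> ennreal e"
    if i: "i \<ge> N" and N: "\<forall>i\<ge>N. \<forall>j\<ge>N. (\<integral>x. norm (s i x - s j x) \<partial>M) < e" for i N e
  proof -
    have "(\<integral>\<^sup>+x. ennreal (norm (s i x - w x)) \<partial>M) = (\<integral>\<^sup>+x. liminf (\<lambda>j. ennreal (norm (s i x - s (r j) x))) \<partial>M)"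
    proof (rule nn_integral_cong_AE)
      show "AE x in M. ennreal (norm (s i x - w x)) = liminf (\<lambda>j. ennreal (norm (s i x - s (r j) x)))"
        using lim
      proof eventually_elim
        case (elim x)
        then have "(\<lambda>j. ennreal (norm (s i x - s (r j) x))) \<longlonglongrightarrow> ennreal (norm (s i x - w x))"
          by (intro tendsto_ennrealI tendsto_intros)
        then show ?case by (metis lim_imp_Liminf sequentially_bot)
      qed
    qed
    also have "\<dots> \<le> liminf (\<lambda>j. \<integral>\<^sup>+x. ennreal (norm (s i x - s (r j) x)) \<partial>M)"
      by (rule nn_integral_liminf) auto
    also have "\<dots> \<le> liminf (\<lambda>j. ennreal e)"
    proof (rule Liminf_mono, rule eventually_sequentiallyI[of N])
      fix j assume "j \<ge> N"
      then have "r j \<ge> N" using seq_suble[OF r, of j] by simp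
      then have "(\<integral>x. norm (s i x - s (r j) x) \<partial>M) \<le> e" using N i by (simp add: less_imp_le)
      moreover have "(\<integral>\<^sup>+x. ennreal (norm (s i x - s (r j) x)) \<partial>M) = ennreal (\<integral>x. norm (s i x - s (r j) x) \<partial>M)"
        by (rule nn_integral_eq_integral) (auto intro!: s)
      ultimately show "(\<integral>\<^sup>+x. ennreal (norm (s i x - s (r j) x)) \<partial>M) \<le> ennreal e"
        by (simp add: ennreal_leI)
    qed
    also have "\<dots> = ennreal e" by (simp add: Liminf_const)
    finally show ?thesis .
  qed
  have w: "integrable M w"
  proof -
    obtain N where N: "\<forall>i\<ge>N. \<forall>j\<ge>N. (\<integral>x. norm (s i x - s j x) \<partial>M) < 1" using cauchy[of 1] by auto
    have "integrable M (\<lambda>x. s N x - w x)"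
      unfolding integrable_iff_bounded using nn[OF order_refl N] by (auto simp: le_less_trans)
    from Bochner_Integration.integrable_diff[OF s[of N] this] show ?thesis by simp
  qed
  have "(\<lambda>n. \<integral>x. norm (s n x - w x) \<partial>M) \<longlonglongrightarrow> 0"
  proof (rule LIMSEQ_I)
    fix e :: real assume e: "e > 0"
    then obtain N where N: "\<forall>i\<ge>N. \<forall>j\<ge>N. (\<integral>x. norm (s i x - s j x) \<partial>M) < e / 2" using cauchy[of "e / 2"] by auto
    have "norm ((\<integral>x. norm (s i x - w x) \<partial>M) - 0) < e" if "i \<ge> N" for i
    proof -
      have "ennreal (\<integral>x. norm (s i x - w x) \<partial>M) = (\<integral>\<^sup>+x. ennreal (norm (s i x - w x)) \<partial>M)"
        by (rule nn_integral_eq_integral[symmetric]) (auto intro!: s w)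
      also have "\<dots> \<le> ennreal (e / 2)" by (rule nn[OF that N])
      finally have "(\<integral>x. norm (s i x - w x) \<partial>M) \<le> e / 2" using e by (simp add: ennreal_le_iff)
      moreover have "(\<integral>x. norm (s i x - w x) \<partial>M) \<ge> 0" by (rule integral_nonneg_AE) auto
      ultimately show ?thesis using e by simp
    qed
    then show "\<exists>N. \<forall>n\<ge>N. norm ((\<integral>x. norm (s n x - w x) \<partial>M) - 0) < e" by blast
  qed
  with w show ?thesis by blast
qed

text \<open>Cauchy--Schwarz in additive form: |x y| is at most s |x|^2 / 2 + |y|^2 / (2 s). The free
  s serves to balance a factor with square sum at most L against one with square sum below d^2, with
  s = d.\<close>

lemma integral_norm_poly_mult_le:
  assumes "s > 0" "degree p \<le> N" "degree q \<le> N"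
  shows "(\<integral>z. norm (poly (p * q) z) \<partial>arc_length)
    \<le> pi * (s * (\<Sum>n\<le>N. (norm (coeff p n))\<^sup>2) + (\<Sum>n\<le>N. (norm (coeff q n))\<^sup>2) / s)"
proof -
  have "(\<integral>z. norm (poly (p * q) z) \<partial>arc_length)
     \<le> (\<integral>z. s / 2 * (norm (poly p z))\<^sup>2 + (norm (poly q z))\<^sup>2 / (2 * s) \<partial>arc_length)"
  proof (rule integral_mono)
    fix z
    have "0 \<le> (s * norm (poly p z) - norm (poly q z))\<^sup>2 / (2 * s)" using assms by simp
    also have "\<dots> = s / 2 * (norm (poly p z))\<^sup>2 + (norm (poly q z))\<^sup>2 / (2 * s) - norm (poly p z) * norm (poly q z)"
      using assms by (simp add: power2_eq_square field_simps)
    finally show "norm (poly (p * q) z) \<le> s / 2 * (norm (poly p z))\<^sup>2 + (norm (poly q z))\<^sup>2 / (2 * s)"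
      by (simp add: norm_mult)
  qed (use assms in \<open>auto intro!: integrable_arc_continuous continuous_intros\<close>)
  also have "\<dots> = s / 2 * (\<integral>z. (norm (poly p z))\<^sup>2 \<partial>arc_length) + (\<integral>z. (norm (poly q z))\<^sup>2 \<partial>arc_length) / (2 * s)"
    using assms(1) by (subst Bochner_Integration.integral_add) (auto intro!: integrable_arc_continuous continuous_intros)
  also have "\<dots> = pi * (s * (\<Sum>n\<le>N. (norm (coeff p n))\<^sup>2) + (\<Sum>n\<le>N. (norm (coeff q n))\<^sup>2) / s)"
    unfolding integral_arc_poly_norm_square[OF assms(2)] integral_arc_poly_norm_square[OF assms(3)]
    using assms(1) by (simp add: field_simps)
  finally show ?thesis .
qed

section \<open>Truncations of square summable sequences\<close>

definition seq_poly :: "(nat \<Rightarrow> complex) \<Rightarrow> nat \<Rightarrow> complex poly" where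
  "seq_poly u M = (\<Sum>i<M. monom (u i) i)"

lemma coeff_seq_poly: "coeff (seq_poly u M) n = (if n < M then u n else 0)"
  by (auto simp: seq_poly_def coeff_sum sum.delta)

lemma degree_seq_poly: "degree (seq_poly u M) \<le> M"
  by (rule degree_le) (auto simp: coeff_seq_poly)

lemma coeff_seq_poly_mult:
  assumes "n < M"
  shows "coeff (seq_poly u M * seq_poly v M) n = (\<Sum>i\<le>n. u i * v (n - i))"
  unfolding coeff_mult using assms by (intro sum.cong) (auto simp: coeff_seq_poly)

lemma sum_norm_coeff_seq_poly_le:
  assumes "\<And>M. (\<Sum>n<M. (norm (u n))\<^sup>2) \<le> L"
  shows "(\<Sum>n\<le>N. (norm (coeff (seq_poly u M) n))\<^sup>2) \<le> L"
proof -
  have "(\<Sum>n\<le>N. (norm (coeff (seq_poly u M) n))\<^sup>2) \<le> (\<Sum>n<Suc N. (norm (u n))\<^sup>2)"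
    unfolding lessThan_Suc_atMost by (intro sum_mono) (auto simp: coeff_seq_poly)
  with assms[of "Suc N"] show ?thesis by linarith
qed

lemma seq_poly_tail:
  assumes bd: "\<And>M. (\<Sum>n<M. (norm (u n))\<^sup>2) \<le> L" and "d > 0"
  shows "\<exists>K. \<forall>i\<ge>K. \<forall>j\<ge>K. \<forall>N. (\<Sum>n\<le>N. (norm (coeff (seq_poly u i - seq_poly u j) n))\<^sup>2) < d"
proof -
  have summ: "summable (\<lambda>n. (norm (u n))\<^sup>2)"
    by (rule summableI_nonneg_bounded[of _ L]) (use bd in auto)
  obtain K where K: "\<And>m n. m \<ge> K \<Longrightarrow> norm (\<Sum>k=m..<n. (norm (u k))\<^sup>2) < d"
    using summ[unfolded summable_Cauchy] \<open>d > 0\<close> by blast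
  have "(\<Sum>n\<le>N. (norm (coeff (seq_poly u i - seq_poly u j) n))\<^sup>2) < d" if "i \<ge> K" "j \<ge> K" for i j N
  proof -
    \<comment> \<open>The truncations agree below K; from there on a coefficient of the difference
      is u n, - u n or 0.\<close>
    have "(\<Sum>n\<le>N. (norm (coeff (seq_poly u i - seq_poly u j) n))\<^sup>2) \<le> (\<Sum>n\<le>N. if n \<in> {K..<Suc N} then (norm (u n))\<^sup>2 else 0)"
      using that by (intro sum_mono) (auto simp: coeff_seq_poly)
    also have "\<dots> = (\<Sum>n=K..<Suc N. (norm (u n))\<^sup>2)"
    proof -
      have "{..N} \<inter> {K..<Suc N} = {K..<Suc N}" by auto
      then show ?thesis by (simp only: sum.inter_restrict[OF finite_atMost, symmetric])
    qed
    also have "\<dots> < d" using K[of K "Suc N"] by simp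
    finally show ?thesis .
  qed
  then show ?thesis by blast
qed

text \<open>Products of truncations are Cauchy in L^1 because the factors are Cauchy in H^2. Fourier
  coefficients are continuous on L^1, and the n-th one is constant as soon as the truncation passes
  n.\<close>

lemma l2_factorable_imp_integrable:
  fixes b :: "nat \<Rightarrow> complex"
  assumes "l2_factorable L b"
  shows "\<exists>w. integrable arc_length w \<and> (\<integral>z. norm (w z) \<partial>arc_length) \<le> 2 * pi * L \<and>
    (\<forall>n::nat. (\<integral>z. w z * z powi (- int n) \<partial>arc_length) = 2 * pi * b n) \<and>
    (\<forall>n::nat>0. (\<integral>z. w z * z powi (int n) \<partial>arc_length) = 0)"
proof -
  obtain u v where b: "\<And>n. b n = (\<Sum>i\<le>n. u i * v (n - i))"
    and u: "\<And>M. (\<Sum>n<M. (norm (u n))\<^sup>2) \<le> L" and v: "\<And>M. (\<Sum>n<M. (norm (v n))\<^sup>2) \<le> L"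
    using assms unfolding l2_factorable_def by blast
  have L: "L \<ge> 0" using u[of 0] by simp
  define W where "W M z = poly (seq_poly u M * seq_poly v M) z" for M z
  have W: "integrable arc_length (W M)" for M
    unfolding W_def by (intro integrable_arc_continuous continuous_intros)
  have "\<exists>N. \<forall>i\<ge>N. \<forall>j\<ge>N. (\<integral>z. norm (W i z - W j z) \<partial>arc_length) < e" if "e > 0" for e
  proof -
    \<comment> \<open>The difference of two products splits into two pieces, each of norm below pi *
      (d * (L + 1)); together they stay below e.\<close>
    define d where "d = e / (2 * pi * (L + 1))"
    have d: "d > 0" using \<open>e > 0\<close> L by (simp add: d_def)
    obtain K1 where K1: "\<And>i j N. i \<ge> K1 \<Longrightarrow> j \<ge> K1 \<Longrightarrow> (\<Sum>n\<le>N. (norm (coeff (seq_poly u i - seq_poly u j) n))\<^sup>2) < d\<^sup>2"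
      using seq_poly_tail[OF u, of "d\<^sup>2"] d by fastforce
    obtain K2 where K2: "\<And>i j N. i \<ge> K2 \<Longrightarrow> j \<ge> K2 \<Longrightarrow> (\<Sum>n\<le>N. (norm (coeff (seq_poly v i - seq_poly v j) n))\<^sup>2) < d\<^sup>2"
      using seq_poly_tail[OF v, of "d\<^sup>2"] d by fastforce
    have piece: "(\<integral>z. norm (poly (p * q) z) \<partial>arc_length) < pi * (d * (L + 1))"
      if p: "\<And>N. (\<Sum>n\<le>N. (norm (coeff p n))\<^sup>2) \<le> L" and q: "\<And>N. (\<Sum>n\<le>N. (norm (coeff q n))\<^sup>2) < d\<^sup>2" for p q
    proof -
      let ?N = "max (degree p) (degree q)"
      have "(\<integral>z. norm (poly (p * q) z) \<partial>arc_length)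
        \<le> pi * (d * (\<Sum>n\<le>?N. (norm (coeff p n))\<^sup>2) + (\<Sum>n\<le>?N. (norm (coeff q n))\<^sup>2) / d)"
        by (rule integral_norm_poly_mult_le[OF d]) auto
      also have "\<dots> < pi * (d * L + d\<^sup>2 / d)"
        using d by (intro mult_strict_left_mono add_le_less_mono mult_left_mono p divide_strict_right_mono q) auto
      also have "\<dots> = pi * (d * (L + 1))" using d by (simp add: power2_eq_square field_simps)
      finally show ?thesis .
    qed
    have "(\<integral>z. norm (W i z - W j z) \<partial>arc_length) < e" if "i \<ge> max K1 K2" "j \<ge> max K1 K2" for i j
    proof -
      let ?a = "seq_poly u i * (seq_poly v i - seq_poly v j)" and ?b = "seq_poly v j * (seq_poly u i - seq_poly u j)"
      have "W i z - W j z = poly ?a z + poly ?b z" for z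
        unfolding W_def by (simp add: algebra_simps)
      then have "(\<integral>z. norm (W i z - W j z) \<partial>arc_length) \<le> (\<integral>z. norm (poly ?a z) + norm (poly ?b z) \<partial>arc_length)"
        by (intro integral_mono) (auto intro!: integrable_arc_continuous continuous_intros norm_triangle_ineq simp del: poly_mult)
      also have "\<dots> = (\<integral>z. norm (poly ?a z) \<partial>arc_length) + (\<integral>z. norm (poly ?b z) \<partial>arc_length)"
        by (intro Bochner_Integration.integral_add integrable_arc_continuous continuous_intros)
      also have "\<dots> < pi * (d * (L + 1)) + pi * (d * (L + 1))"
        using that by (intro add_strict_mono piece sum_norm_coeff_seq_poly_le u v K1 K2) auto
      also have "\<dots> = d * (2 * pi * (L + 1))" by (simp add: algebra_simps)
      also have "\<dots> = e" using L by (simp add: d_def add_nonneg_eq_0_iff)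
      finally show ?thesis .
    qed
    then show ?thesis by blast
  qed
  from L1_complete[OF W this] obtain w where w: "integrable arc_length w"
    and lim: "(\<lambda>n. \<integral>x. norm (W n x - w x) \<partial>arc_length) \<longlonglongrightarrow> 0" by blast
  have coeff_lim: "(\<lambda>M. \<integral>z. W M z * z powi k \<partial>arc_length) \<longlonglongrightarrow> (\<integral>z. w z * z powi k \<partial>arc_length)" for k
  proof (rule LIM_zero_cancel, rule Lim_null_comparison[OF always_eventually lim], rule allI)
    fix M
    have i1: "integrable arc_length (\<lambda>z. W M z * z powi k)" and i2: "integrable arc_length (\<lambda>z. w z * z powi k)"
      by (rule integrable_arc_mult, auto intro!: W w continuous_intros)+
    have "norm ((\<integral>z. W M z * z powi k \<partial>arc_length) - (\<integral>z. w z * z powi k \<partial>arc_length))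
      = norm (\<integral>z. W M z * z powi k - w z * z powi k \<partial>arc_length)"
      using i1 i2 by simp
    also have "\<dots> \<le> (\<integral>z. norm (W M z * z powi k - w z * z powi k) \<partial>arc_length)"
      by (rule integral_norm_bound)
    also have "\<dots> = (\<integral>z. norm (W M z - w z) \<partial>arc_length)"
      by (rule integral_arc_cong) (simp add: left_diff_distrib[symmetric] norm_mult norm_power_int)
    finally show "norm ((\<integral>z. W M z * z powi k \<partial>arc_length) - (\<integral>z. w z * z powi k \<partial>arc_length)) \<le> (\<integral>z. norm (W M z - w z) \<partial>arc_length)" .
  qed
  have "(\<integral>z. w z * z powi (- int n) \<partial>arc_length) = 2 * pi * b n" for n
  proof -
    have "\<forall>\<^sub>F M in sequentially. 2 * pi * b n = (\<integral>z. W M z * z powi (- int n) \<partial>arc_length)"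
      using eventually_gt_at_top[of n]
      by eventually_elim (simp only: W_def integral_arc_poly_powi coeff_seq_poly_mult b)
    then have "(\<lambda>M. \<integral>z. W M z * z powi (- int n) \<partial>arc_length) \<longlonglongrightarrow> 2 * pi * b n"
      by (rule Lim_transform_eventually[OF tendsto_const])
    with coeff_lim[of "- int n"] show ?thesis using LIMSEQ_unique by blast
  qed
  moreover have "(\<integral>z. w z * z powi (int n) \<partial>arc_length) = 0" if "n > 0" for n
  proof -
    have "(\<integral>z. W M z * z powi (int n) \<partial>arc_length) = 0" for M
    proof -
      \<comment> \<open>The extra factor z^n turns the integral into the constant coefficient of a
        polynomial divisible by z.\<close>
      have "(\<integral>z. W M z * z powi (int n) \<partial>arc_length)
        = (\<integral>z. poly (monom 1 n * (seq_poly u M * seq_poly v M)) z * z powi (- int 0) \<partial>arc_length)"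
        by (simp add: W_def poly_monom mult_ac)
      then show ?thesis unfolding integral_arc_poly_powi using that by (simp add: coeff_mult coeff_monom)
    qed
    with coeff_lim[of "int n"] show ?thesis by (simp add: LIMSEQ_const_iff)
  qed
  moreover have "(\<integral>z. norm (w z) \<partial>arc_length) \<le> 2 * pi * L"
  proof -
    have "(\<integral>z. norm (w z) \<partial>arc_length) \<le> 2 * pi * L + (\<integral>x. norm (W M x - w x) \<partial>arc_length)" for M
    proof -
      have "(\<integral>z. norm (w z) \<partial>arc_length) \<le> (\<integral>z. norm (W M z) + norm (W M z - w z) \<partial>arc_length)"
        using W w by (intro integral_mono) (auto simp: norm_triangle_sub norm_minus_commute[of "W M _"])
      also have "\<dots> = (\<integral>z. norm (W M z) \<partial>arc_length) + (\<integral>z. norm (W M z - w z) \<partial>arc_length)"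
        using W w by (intro Bochner_Integration.integral_add) auto
      also have "(\<integral>z. norm (W M z) \<partial>arc_length) \<le> pi * (1 * (\<Sum>n\<le>M. (norm (coeff (seq_poly u M) n))\<^sup>2) + (\<Sum>n\<le>M. (norm (coeff (seq_poly v M) n))\<^sup>2) / 1)"
        unfolding W_def by (rule integral_norm_poly_mult_le) (auto simp: degree_seq_poly)
      also have "\<dots> \<le> pi * (L + L)"
        using sum_norm_coeff_seq_poly_le[OF u, of M M] sum_norm_coeff_seq_poly_le[OF v, of M M]
        by (intro mult_left_mono) auto
      finally show ?thesis by simp
    qed
    moreover have "(\<lambda>M. 2 * pi * L + (\<integral>x. norm (W M x - w x) \<partial>arc_length)) \<longlonglongrightarrow> 2 * pi * L + 0"
      by (intro tendsto_intros lim)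
    ultimately show ?thesis using LIMSEQ_le_const[of _ "2 * pi * L + 0"] by fastforce
  qed
  ultimately show ?thesis using w by blast
qed

section \<open>Uniqueness of Fourier coefficients\<close>

text \<open>The induction varies h: for a product f g, the claim for g is applied to h f, all of
  whose Fourier coefficients vanish by the claim for f.\<close>

lemma real_polynomial_mult_fourier_zero:
  fixes g :: "complex \<Rightarrow> real"
  assumes "real_polynomial_function g"
  shows "integrable arc_length h \<Longrightarrow> (\<And>n. (\<integral>z. h z * z powi n \<partial>arc_length) = 0)
    \<Longrightarrow> (\<integral>z. h z * of_real (g z) * z powi n \<partial>arc_length) = 0"
  using assms
proof (induction g arbitrary: h n rule: real_polynomial_function.induct)
  case (linear f)
  have shift: "(\<integral>z. h z * (z powi k * z powi n) \<partial>arc_length) = 0" for k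
  proof -
    have "(\<integral>z. h z * (z powi k * z powi n) \<partial>arc_length) = (\<integral>z. h z * z powi (k + n) \<partial>arc_length)"
      by (rule integral_arc_cong) (subst power_int_add, auto)
    then show ?thesis using linear.prems(2) by simp
  qed
  \<comment> \<open>On the circle Re z and Im z are combinations of z and 1/z, so a real linear
    function takes the form c z + cnj c / z.\<close>
  define c where "c = (of_real (f 1) - \<i> * of_real (f \<i>)) / 2"
  have fz: "of_real (f z) = c * z powi 1 + cnj c * z powi (-1)" if "norm z = 1" for z
  proof -
    have inv: "z powi (-1) = cnj z"
      using cnj_eq_powi[OF that, of 1] by simp
    have "f z = f (Re z *\<^sub>R 1 + Im z *\<^sub>R \<i>)"
      by (rule arg_cong[where f = f]) (simp add: complex_eq_iff)
    also have "\<dots> = Re z * f 1 + Im z * f \<i>"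
      using linear(1) by (simp add: bounded_linear.linear linear_add linear_scale)
    finally show ?thesis unfolding inv by (simp add: c_def complex_eq_iff algebra_simps add_divide_distrib diff_divide_distrib)
  qed
  have "(\<integral>z. h z * of_real (f z) * z powi n \<partial>arc_length)
     = (\<integral>z. c * (h z * (z powi 1 * z powi n)) + cnj c * (h z * (z powi (-1) * z powi n)) \<partial>arc_length)"
    by (rule integral_arc_cong) (simp add: fz algebra_simps del: power_int_1_right)
  also have "\<dots> = 0"
    by (subst Bochner_Integration.integral_add)
      (auto intro!: integrable_mult_right integrable_arc_mult linear.prems(1) continuous_intros simp: shift[of 1, simplified] shift[of "-1", simplified])
  finally show ?case .
next
  case (const c)
  have "(\<integral>z. h z * of_real c * z powi n \<partial>arc_length) = of_real c * (\<integral>z. h z * z powi n \<partial>arc_length)"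
    by (simp add: mult_ac)
  then show ?case using const by simp
next
  case (add f g)
  have cont: "continuous_on (sphere 0 1) f" "continuous_on (sphere 0 1) g"
    using add.hyps continuous_on_polymonial_function by (auto simp: real_polynomial_function_eq)
  have "(\<integral>z. h z * of_real (f z + g z) * z powi n \<partial>arc_length)
    = (\<integral>z. h z * (of_real (f z) * z powi n) + h z * (of_real (g z) * z powi n) \<partial>arc_length)"
    by (simp add: algebra_simps)
  also have "\<dots> = (\<integral>z. h z * (of_real (f z) * z powi n) \<partial>arc_length) + (\<integral>z. h z * (of_real (g z) * z powi n) \<partial>arc_length)"
    by (rule Bochner_Integration.integral_add; intro integrable_arc_mult continuous_intros cont add.prems(1)) auto
  also have "\<dots> = 0" using add.IH[OF add.prems] by (simp add: mult.assoc)
  finally show ?case .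
next
  case (mult f g)
  have cont: "continuous_on (sphere 0 1) f" "continuous_on (sphere 0 1) g"
    using mult.hyps continuous_on_polymonial_function by (auto simp: real_polynomial_function_eq)
  have "integrable arc_length (\<lambda>z. h z * of_real (f z))"
    by (intro integrable_arc_mult continuous_intros cont mult.prems(1))
  from mult.IH(2)[OF this mult.IH(1)[OF mult.prems]] show ?case
    by (simp add: mult_ac)
qed

lemma continuous_fourier_zero:
  fixes q :: "complex \<Rightarrow> real"
  assumes h: "integrable arc_length h" and zero: "\<And>n. (\<integral>z. h z * z powi n \<partial>arc_length) = 0"
    and q: "continuous_on (sphere 0 1) q"
  shows "(\<integral>z. h z * of_real (q z) \<partial>arc_length) = 0"
proof -
  define K where "K = (\<integral>z. norm (h z) \<partial>arc_length)"
  have le: "norm (\<integral>z. h z * of_real (q z) \<partial>arc_length) \<le> e * K" if "e > 0" for e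
  proof -
    obtain g where g: "real_polynomial_function g" and near: "\<And>z. z \<in> sphere 0 1 \<Longrightarrow> \<bar>q z - g z\<bar> < e"
      by (rule Stone_Weierstrass_real_polynomial_function[OF compact_sphere q \<open>e > 0\<close>]) auto
    have cg: "continuous_on (sphere 0 1) g"
      using g continuous_on_polymonial_function by (auto simp: real_polynomial_function_eq)
    have i: "integrable arc_length (\<lambda>z. h z * of_real (q z))" "integrable arc_length (\<lambda>z. h z * of_real (g z))"
      by (intro integrable_arc_mult h continuous_intros q cg)+
    have "(\<integral>z. h z * of_real (g z) \<partial>arc_length) = 0"
      using real_polynomial_mult_fourier_zero[OF g h zero, of 0] by simp
    then have "(\<integral>z. h z * of_real (q z) \<partial>arc_length) = (\<integral>z. h z * of_real (q z) - h z * of_real (g z) \<partial>arc_length)"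
      using i by simp
    also have "norm \<dots> \<le> (\<integral>z. norm (h z * of_real (q z) - h z * of_real (g z)) \<partial>arc_length)"
      by (rule integral_norm_bound)
    also have "\<dots> \<le> (\<integral>z. e * norm (h z) \<partial>arc_length)"
    proof (rule integral_mono)
      fix z assume "z \<in> space arc_length"
      then have "\<bar>q z - g z\<bar> \<le> e" using near[of z] by (simp add: space_arc_length)
      moreover have "norm (h z * of_real (q z) - h z * of_real (g z)) = norm (h z) * \<bar>q z - g z\<bar>"
        unfolding right_diff_distrib[symmetric] of_real_diff[symmetric] norm_mult norm_of_real ..
      ultimately show "norm (h z * of_real (q z) - h z * of_real (g z)) \<le> e * norm (h z)"
        by (simp add: mult.commute[of e] mult_left_mono)
    qed (use i h in auto)
    finally show ?thesis by (simp add: K_def)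
  qed
  have "norm (\<integral>z. h z * of_real (q z) \<partial>arc_length) \<le> 0"
  proof -
    have K: "K \<ge> 0" unfolding K_def by (rule integral_nonneg_AE) auto
    show ?thesis
    proof (rule field_le_epsilon)
      fix e :: real assume "e > 0"
      then have "norm (\<integral>z. h z * of_real (q z) \<partial>arc_length) \<le> e / (K + 1) * K"
        using K by (intro le) simp
      also have "\<dots> \<le> 0 + e" using K \<open>e > 0\<close> by (simp add: field_simps)
      finally show "norm (\<integral>z. h z * of_real (q z) \<partial>arc_length) \<le> 0 + e" .
    qed
  qed
  then show ?thesis by simp
qed

text \<open>The tent functions q m are continuous and decrease to the indicator of C, because the
  distance to a closed set is positive off that set.\<close>

lemma closed_fourier_zero:
  assumes h: "integrable arc_length h" and zero: "\<And>n. (\<integral>z. h z * z powi n \<partial>arc_length) = 0"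
    and C: "closed C"
  shows "(\<integral>z. indicator C z *\<^sub>R h z \<partial>arc_length) = 0"
\<comment> \<open>The distance \<open>infdist\<close> to the empty set is 0 by convention, which
  would make every q m equal to 1.\<close>
proof (cases "C = {}")
  case False
  define q where "q m z = max 0 (1 - real m * infdist z C)" for m and z :: complex
  have q: "continuous_on UNIV (q m)" for m
    unfolding q_def by (intro continuous_intros)
  have "(\<lambda>m. \<integral>z. h z * of_real (q m z) \<partial>arc_length) \<longlonglongrightarrow> (\<integral>z. indicator C z *\<^sub>R h z \<partial>arc_length)"
  proof (rule integral_dominated_convergence[where w = "\<lambda>z. norm (h z)"])
    show "(\<lambda>z. indicator C z *\<^sub>R h z) \<in> borel_measurable arc_length"
    proof -
      have "C \<inter> space arc_length \<in> sets arc_length"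
        unfolding sets_arc_length space_arc_length sets_restrict_space using C by (auto simp: Int_commute)
      then have "(\<lambda>z. indicator (C \<inter> space arc_length) z *\<^sub>R h z) \<in> borel_measurable arc_length"
        using h by (intro borel_measurable_scaleR borel_measurable_indicator) auto
      then show ?thesis
        by (rule measurable_cong[THEN iffD1, rotated]) (auto simp: indicator_def)
    qed
    show "(\<lambda>z. h z * of_real (q m z)) \<in> borel_measurable arc_length" for m
      by (intro borel_measurable_integrable integrable_arc_mult h continuous_intros continuous_on_subset[OF q]) auto
    show "integrable arc_length (\<lambda>z. norm (h z))" using h by simp
    show "AE z in arc_length. (\<lambda>m. h z * of_real (q m z)) \<longlonglongrightarrow> indicator C z *\<^sub>R h z"
    proof (rule AE_I2)
      fix z
      show "(\<lambda>m. h z * of_real (q m z)) \<longlonglongrightarrow> indicator C z *\<^sub>R h z"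
      proof (cases "z \<in> C")
        case True
        then show ?thesis by (simp add: q_def)
      next
        case out: False
        then have d: "infdist z C > 0"
          using C False in_closed_iff_infdist_zero infdist_nonneg[of z C] by (metis less_le)
        obtain M :: nat where M: "1 / infdist z C < real M" using reals_Archimedean2 by blast
        have "\<forall>\<^sub>F m in sequentially. h z * of_real (q m z) = 0"
          using eventually_ge_at_top[of M]
        proof eventually_elim
          case (elim m)
          have "1 < real M * infdist z C" using M d by (simp add: divide_less_eq)
          also have "\<dots> \<le> real m * infdist z C" using elim d by (intro mult_right_mono) auto
          finally show ?case by (simp add: q_def)
        qed
        then show ?thesis using out by (simp add: tendsto_eventually)
      qed
    qed
    show "AE z in arc_length. norm (h z * of_real (q m z)) \<le> norm (h z)" for m
    proof (rule AE_I2)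
      fix z
      have "\<bar>q m z\<bar> \<le> 1" using infdist_nonneg[of z C] by (auto simp: q_def)
      then show "norm (h z * of_real (q m z)) \<le> norm (h z)"
        unfolding norm_mult norm_of_real by (intro mult_left_le) auto
    qed
  qed
  moreover have "(\<integral>z. h z * of_real (q m z) \<partial>arc_length) = 0" for m
    by (rule continuous_fourier_zero[OF h zero continuous_on_subset[OF q]]) auto
  ultimately show ?thesis by (simp add: LIMSEQ_const_iff)
qed simp

text \<open>Closed sets form an intersection-stable generator of the Borel sets, and the sets over
  which h has integral 0 form a Dynkin system. So h integrates to 0 over every Borel set.\<close>

lemma fourier_uniqueness:
  assumes h: "integrable arc_length h" and zero: "\<And>n. (\<integral>z. h z * z powi n \<partial>arc_length) = 0"
  shows "AE z in arc_length. h z = 0"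
proof -
  \<comment> \<open>The measurable sets of \<open>arc_length\<close> are the traces of Borel sets on
    the circle, hence the intersections with \<open>sphere 0 1\<close>.\<close>
  have mset: "B \<inter> sphere 0 1 \<in> sets arc_length" if "B \<in> sets borel" for B
    unfolding sets_arc_length sets_restrict_space using that by auto
  have indi: "(\<integral>z. indicator B z *\<^sub>R h z \<partial>arc_length) = set_lebesgue_integral arc_length (B \<inter> sphere 0 1) h" for B
    unfolding set_lebesgue_integral_def
    by (rule integral_arc_cong) (auto simp: indicator_def)
  have borel: "(\<integral>z. indicator B z *\<^sub>R h z \<partial>arc_length) = 0" if "B \<in> sets borel" for B :: "complex set"
  proof -
    have sb: "sigma_sets UNIV (Collect closed) = sets (borel :: complex measure)"
      unfolding borel_eq_closed by simp
    have B: "B \<in> sigma_sets UNIV (Collect closed)" using that sb by simp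
    show ?thesis
    proof (induction rule: sigma_sets_induct_disjoint[OF _ _ B])
      case 1
      then show ?case by (auto simp: Int_stable_def)
    next
      case (3 A)
      then show ?case using closed_fourier_zero[OF h zero] by simp
    next
      case (5 A)
      have iA: "integrable arc_length (\<lambda>z. indicator A z *\<^sub>R h z)"
      proof -
        have "set_integrable arc_length (A \<inter> sphere 0 1) h"
          unfolding set_integrable_def
          using 5 sb mset h by (intro integrable_mult_indicator) auto
        then show ?thesis unfolding set_integrable_def
          by (rule Bochner_Integration.integrable_cong[THEN iffD1, rotated 2]) (auto simp: space_arc_length indicator_def)
      qed
      have "(\<integral>z. indicator (UNIV - A) z *\<^sub>R h z \<partial>arc_length) = (\<integral>z. h z - indicator A z *\<^sub>R h z \<partial>arc_length)"
        by (rule integral_arc_cong) (auto simp: indicator_def)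
      also have "\<dots> = (\<integral>z. h z \<partial>arc_length) - (\<integral>z. indicator A z *\<^sub>R h z \<partial>arc_length)"
        using h iA by simp
      also have "\<dots> = 0" using zero[of 0] 5 by simp
      finally show ?case .
    next
      case (6 A)
      have A: "A i \<inter> sphere 0 1 \<in> sets arc_length" for i using 6 sb mset by auto
      have "(\<integral>z. indicator (\<Union>(range A)) z *\<^sub>R h z \<partial>arc_length)
        = set_lebesgue_integral arc_length (\<Union>(range (\<lambda>i. A i \<inter> sphere 0 1))) h"
        unfolding indi by (rule arg_cong2[where f = "set_lebesgue_integral arc_length"]) auto
      also have "\<dots> = (\<Sum>i. set_lebesgue_integral arc_length (A i \<inter> sphere 0 1) h)"
      proof (rule lebesgue_integral_countable_add[OF A])
        show "A i \<inter> sphere 0 1 \<inter> (A j \<inter> sphere 0 1) = {}" if "i \<noteq> j" for i j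
          using 6(1) that by (auto simp: disjoint_family_on_def)
        show "set_integrable arc_length (\<Union>(range (\<lambda>i. A i \<inter> sphere 0 1))) h"
          unfolding set_integrable_def
          by (intro integrable_mult_indicator h sets.countable_UN image_subsetI A)
      qed
      also have "\<dots> = 0" using 6 by (simp add: indi[symmetric])
      finally show ?case .
    qed auto
  qed
  show ?thesis
  proof (rule arc.density_unique_banach[OF h])
    fix A assume "A \<in> sets arc_length"
    then obtain B where B: "B \<in> sets borel" "A = B \<inter> sphere 0 1"
      unfolding sets_arc_length sets_restrict_space by auto
    then show "set_lebesgue_integral arc_length A h = set_lebesgue_integral arc_length A (\<lambda>z. 0)"
      using borel[OF B(1)] indi[of B] by (simp add: set_lebesgue_integral_def)
  qed simp
qed

section \<open>Representatives of classes in L^1\<close>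

lemma L1_circle_cases:
  obtains f where "integrable arc_length f" "h = abs_L1_circle f"
proof -
  have "\<exists>f. integrable arc_length f \<and> h = abs_L1_circle f"
    by (rule L1_circle.abs_induct[of _ h]) auto
  then show ?thesis using that by blast
qed

lemma norm_abs_L1: "integrable arc_length f \<Longrightarrow> norm (abs_L1_circle f) = (\<integral>z. norm (f z) \<partial>arc_length)"
  by (simp add: norm_L1_circle.abs_eq)

lemma circle_pairing_abs_L1:
  "integrable arc_length f \<Longrightarrow> circle_pairing F (abs_L1_circle f) = (\<integral>z. disc_fun F z * f z \<partial>arc_length)"
  using circle_pairing.abs_eq[of "disc_fun F" f] disc_fun[of F] by (simp add: eq_onp_def disc_fun_inverse)

text \<open>Conjugation is an involution that reverses frequencies: the condition on negative
  frequencies turns into one on positive frequencies, and the vanishing mean supplies n = 0.\<close>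

lemma conj_hardy_H1_0_abs_L1:
  assumes f: "integrable arc_length f"
  shows "abs_L1_circle f \<in> conj_hardy_H1_0 \<longleftrightarrow> (\<forall>n::nat. (\<integral>z. f z * z powi (- int n) \<partial>arc_length) = 0)"
proof -
  have inv: "cnj_L1 (cnj_L1 g) = g" for g
    by transfer auto
  have "h \<in> conj_hardy_H1_0 \<longleftrightarrow> cnj_L1 h \<in> hardy_H1_0" for h
    unfolding conj_hardy_H1_0_def using inv by (metis imageE imageI)
  moreover have "cnj_L1 (abs_L1_circle f) = abs_L1_circle (\<lambda>z. cnj (f z))"
    using f by (simp add: cnj_L1.abs_eq)
  moreover have fc: "integrable arc_length (\<lambda>z. cnj (f z))" using f by simp
  moreover have cn: "(\<integral>z. cnj (f z) * z powi (- n) \<partial>arc_length) = cnj (\<integral>z. f z * z powi n \<partial>arc_length)" for n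
  proof -
    have "(\<integral>z. cnj (f z) * z powi (- n) \<partial>arc_length) = (\<integral>z. cnj (f z * z powi n) \<partial>arc_length)"
    proof (rule integral_arc_cong)
      fix z :: complex assume z: "norm z = 1"
      then have "cnj z = inverse z" using cnj_eq_powi[OF z, of 1] by (simp add: power_int_minus)
      then show "cnj (f z) * z powi - n = cnj (f z * z powi n)" by (simp add: power_int_minus power_int_inverse)
    qed
    also have "\<dots> = cnj (\<integral>z. f z * z powi n \<partial>arc_length)" by (rule Bochner_Integration.integral_cnj)
    finally show ?thesis .
  qed
  moreover have "(\<integral>z. cnj (f z) \<partial>arc_length) = cnj (\<integral>z. f z \<partial>arc_length)" by simp
  ultimately have "abs_L1_circle f \<in> conj_hardy_H1_0 \<longleftrightarrow>
     (\<forall>n<0. (\<integral>z. f z * z powi n \<partial>arc_length) = 0) \<and> (\<integral>z. f z \<partial>arc_length) = 0"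
    by (simp add: hardy_H1_0_def hardy_H1_def fourier_coeff.abs_eq integral_L1.abs_eq)
  also have "\<dots> \<longleftrightarrow> (\<forall>n::nat. (\<integral>z. f z * z powi (- int n) \<partial>arc_length) = 0)"
  proof safe
    fix n :: nat assume "\<forall>n<0. (\<integral>z. f z * z powi n \<partial>arc_length) = 0" "(\<integral>z. f z \<partial>arc_length) = 0"
    then show "(\<integral>z. f z * z powi (- int n) \<partial>arc_length) = 0"
      by (cases "n = 0") auto
  next
    fix n :: int assume *: "\<forall>n::nat. (\<integral>z. f z * z powi (- int n) \<partial>arc_length) = 0" and "n < 0"
    then show "(\<integral>z. f z * z powi n \<partial>arc_length) = 0" using spec[OF *, of "nat (- n)"] by simp
  next
    assume "\<forall>n::nat. (\<integral>z. f z * z powi (- int n) \<partial>arc_length) = 0"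
    from spec[OF this, of 0] show "(\<integral>z. f z \<partial>arc_length) = 0" by simp
  qed
  finally show ?thesis .
qed

section \<open>Polynomials and exponentials in the disc algebra\<close>

text \<open>Completeness makes the exponential series converge. It holds because uniform limits stay
  continuous and holomorphic.\<close>

instance disc_algebra :: banach
proof
  fix X :: "nat \<Rightarrow> disc_algebra"
  assume X: "Cauchy X"
  have unif: "uniformly_Cauchy_on (cball 0 1) (\<lambda>n. disc_fun (X n))"
  proof (rule uniformly_Cauchy_onI)
    fix e :: real assume "e > 0"
    then obtain M where M: "\<forall>m\<ge>M. \<forall>n\<ge>M. norm (X m - X n) < e" using CauchyD[OF X] by blast
    have "dist (disc_fun (X m) z) (disc_fun (X n) z) < e" if "m \<ge> M" "n \<ge> M" for m n z
    proof -
      have "dist (disc_fun (X m) z) (disc_fun (X n) z) = norm (disc_fun (X m - X n) z)"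
        by (simp add: dist_norm minus_disc_algebra.rep_eq)
      also have "\<dots> \<le> norm (X m - X n)" by (rule norm_disc_algebra_upper)
      also have "\<dots> < e" using M that by blast
      finally show ?thesis .
    qed
    then show "\<exists>M. \<forall>z\<in>cball 0 1. \<forall>m\<ge>M. \<forall>n\<ge>M. dist (disc_fun (X m) z) (disc_fun (X n) z) < e"
      by blast
  qed
  then obtain l where l: "uniform_limit (cball 0 1) (\<lambda>n. disc_fun (X n)) l sequentially"
    using Cauchy_uniformly_convergent uniformly_convergent_on_def by blast
  have "\<forall>\<^sub>F n in sequentially. continuous_on (cball 0 1) (disc_fun (X n)) \<and> disc_fun (X n) holomorphic_on ball 0 1"
    by (simp add: disc_fun_continuous disc_fun_holomorphic)
  then have lc: "continuous_on (cball 0 1) l" and lh: "l holomorphic_on ball 0 1"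
    by (rule holomorphic_uniform_limit[OF _ l]; simp)+
  \<comment> \<open>Elements of the type vanish outside the closed disc, so the limit is cut off
    there.\<close>
  define g where "g z = (if z \<in> cball 0 1 then l z else 0)" for z
  have "continuous_on (cball 0 1) g" using lc by (rule continuous_on_eq) (simp add: g_def)
  moreover have "g holomorphic_on ball 0 1" using lh by (rule holomorphic_transform) (simp add: g_def)
  ultimately have g: "disc_fun (Abs_disc_algebra g) = g"
    by (intro Abs_disc_algebra_inverse) (auto simp: g_def)
  have "X \<longlonglongrightarrow> Abs_disc_algebra g"
  proof (rule LIMSEQ_I)
    fix e :: real assume "e > 0"
    then have "\<forall>\<^sub>F n in sequentially. \<forall>z\<in>cball 0 1. dist (disc_fun (X n) z) (l z) < e / 2"
      using uniform_limitD[OF l, of "e / 2"] by simp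
    then obtain M where M: "\<And>n z. n \<ge> M \<Longrightarrow> z \<in> cball 0 1 \<Longrightarrow> dist (disc_fun (X n) z) (l z) < e / 2"
      unfolding eventually_sequentially by blast
    have "norm (X n - Abs_disc_algebra g) \<le> e / 2" if "n \<ge> M" for n
      by (rule norm_disc_algebra_least)
        (use M[OF that] in \<open>auto simp: minus_disc_algebra.rep_eq g g_def dist_norm intro: less_imp_le\<close>)
    with \<open>e > 0\<close> show "\<exists>M. \<forall>n\<ge>M. norm (X n - Abs_disc_algebra g) < e"
      by (metis field_sum_of_halves less_add_same_cancel1 half_gt_zero order_le_less_trans)
  qed
  then show "convergent X" by (rule convergentI)
qed

lift_definition poly_disc :: "complex poly \<Rightarrow> disc_algebra" is
  "\<lambda>p z. if z \<in> cball 0 1 then poly p z else 0"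
proof (intro conjI allI impI)
  fix p :: "complex poly"
  show "continuous_on (cball 0 1) (\<lambda>z. if z \<in> cball 0 1 then poly p z else 0)"
    by (rule continuous_on_eq[of _ "poly p"]) (auto intro!: continuous_intros)
  show "(\<lambda>z. if z \<in> cball 0 1 then poly p z else 0) holomorphic_on ball 0 1"
    by (rule holomorphic_transform[of "poly p"]) (auto intro!: holomorphic_intros)
qed auto

lemma poly_disc_add: "poly_disc (p + q) = poly_disc p + poly_disc q"
  and poly_disc_diff: "poly_disc (p - q) = poly_disc p - poly_disc q"
  and poly_disc_mult: "poly_disc (p * q) = poly_disc p * poly_disc q"
  and poly_disc_smult: "poly_disc (smult c p) = c *\<^sub>C poly_disc p"
  and poly_disc_1: "poly_disc 1 = 1"
  and poly_disc_0: "poly_disc 0 = 0"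
  by (transfer; simp add: fun_eq_iff)+

lemma norm_poly_le_norm_poly_disc: "norm z \<le> 1 \<Longrightarrow> norm (poly p z) \<le> norm (poly_disc p)"
  using norm_disc_algebra_upper[of "poly_disc p" z] by (simp add: poly_disc.rep_eq)

lemma norm_diff_poly_disc_le:
  "(\<And>z. norm z \<le> 1 \<Longrightarrow> norm (disc_fun f z - poly p z) \<le> e) \<Longrightarrow> norm (f - poly_disc p) \<le> e"
  by (rule norm_disc_algebra_least) (auto simp: minus_disc_algebra.rep_eq poly_disc.rep_eq)

text \<open>A dilation by r < 1 changes f little by uniform continuity, and the Taylor series of the
  dilated function converges uniformly on the closed disc. Each of the two errors is at most e /
  4.\<close>

lemma poly_disc_dense:
  assumes "e > 0"
  shows "\<exists>p. norm (f - poly_disc p) < e"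
proof -
  have "uniformly_continuous_on (cball 0 1) (disc_fun f)"
    by (intro compact_uniformly_continuous disc_fun_continuous compact_cball)
  then obtain d where d: "d > 0"
    and dd: "\<And>x y. x \<in> cball 0 1 \<Longrightarrow> y \<in> cball 0 1 \<Longrightarrow> dist y x < d \<Longrightarrow> dist (disc_fun f y) (disc_fun f x) < e / 4"
    unfolding uniformly_continuous_on_def using \<open>e > 0\<close> by (metis zero_less_divide_iff zero_less_numeral)
  \<comment> \<open>The maximum keeps r positive for large d, and 1 - r stays below d.\<close>
  define r where "r = max (1 / 2) (1 - d / 2)"
  have r: "0 < r" "r < 1" "1 - r < d" using d by (auto simp: r_def)
  have near: "norm (disc_fun f z - disc_fun f (of_real r * z)) \<le> e / 4" if z: "norm z \<le> 1" for z
  proof -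
    have "of_real r * z \<in> cball 0 1" using z r mult_le_one[of r "norm z"] by (simp add: norm_mult)
    moreover have "dist z (of_real r * z) = (1 - r) * norm z"
    proof -
      have "z - of_real r * z = of_real (1 - r) * z" by (simp add: algebra_simps)
      then show ?thesis using r by (simp only: dist_norm norm_mult norm_of_real)
    qed
    moreover have "(1 - r) * norm z < d"
    proof -
      have "(1 - r) * norm z \<le> (1 - r) * 1" using z r by (intro mult_left_mono) auto
      also have "\<dots> < d" using r by simp
      finally show ?thesis .
    qed
    ultimately have "dist (disc_fun f z) (disc_fun f (of_real r * z)) < e / 4"
      using dd[of "of_real r * z" z] z r by simp
    then show ?thesis by (simp add: dist_norm)
  qed
  define a where "a n = taylor_coeff (disc_fun f) n * of_real r ^ n" for n
  have sums: "(\<lambda>n. a n * z ^ n) sums disc_fun f (of_real r * z)" if "norm z \<le> 1" for z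
  proof -
    have "norm (of_real r * z) \<le> r * 1"
      using r that unfolding norm_mult norm_of_real by (intro mult_mono) auto
    also have "\<dots> < 1" using r by simp
    finally have "norm (of_real r * z) < 1" .
    then have "of_real r * z \<in> ball 0 1" by simp
    from holomorphic_power_series[OF disc_fun_holomorphic this] show ?thesis
      by (simp add: a_def taylor_coeff_def power_mult_distrib mult_ac)
  qed
  have summ: "summable (\<lambda>n. norm (a n))"
  proof -
    obtain s where s: "r < s" "s < 1" using r dense by blast
    have "of_real s \<in> ball (0::complex) 1" using s r by simp
    from holomorphic_power_series[OF disc_fun_holomorphic this]
    have "summable (\<lambda>n. taylor_coeff (disc_fun f) n * of_real s ^ n)"
      by (auto simp: taylor_coeff_def sums_iff)
    then have "summable (\<lambda>n. norm (taylor_coeff (disc_fun f) n * of_real r ^ n))"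
      by (rule powser_insidea) (use s r in auto)
    then show ?thesis by (simp add: a_def)
  qed
  have "uniform_limit (cball 0 1) (\<lambda>n z. \<Sum>i<n. a i * z ^ i) (\<lambda>z. \<Sum>i. a i * z ^ i) sequentially"
  proof (rule Weierstrass_m_test[OF _ summ])
    fix n and z :: complex assume "z \<in> cball 0 1"
    then show "norm (a n * z ^ n) \<le> norm (a n)"
      by (auto simp: norm_mult norm_power intro!: mult_left_le power_le_one)
  qed
  then have "\<forall>\<^sub>F n in sequentially. \<forall>z\<in>cball 0 1. dist (\<Sum>i<n. a i * z ^ i) (\<Sum>i. a i * z ^ i) < e / 4"
    by (rule uniform_limitD) (use \<open>e > 0\<close> in simp)
  then obtain n where n: "\<And>z. z \<in> cball 0 1 \<Longrightarrow> dist (\<Sum>i<n. a i * z ^ i) (\<Sum>i. a i * z ^ i) < e / 4"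
    unfolding eventually_sequentially by blast
  have "norm (f - poly_disc (seq_poly a n)) \<le> e / 2"
  proof (rule norm_diff_poly_disc_le)
    fix z :: complex assume z: "norm z \<le> 1"
    have "poly (seq_poly a n) z = (\<Sum>i<n. a i * z ^ i)"
      by (simp add: seq_poly_def poly_sum poly_monom)
    then have "norm (disc_fun f (of_real r * z) - poly (seq_poly a n) z) \<le> e / 4"
      using n[of z] sums[OF z] z by (simp add: sums_iff dist_norm norm_minus_commute)
    with near[OF z] show "norm (disc_fun f z - poly (seq_poly a n) z) \<le> e / 2"
      using norm_diff_triangle_le[of "disc_fun f z" "disc_fun f (of_real r * z)" "e/4" "poly (seq_poly a n) z" "e/4"]
      by simp
  qed
  then show ?thesis using \<open>e > 0\<close> by (intro exI[of _ "seq_poly a n"]) simp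
qed

lemma poly_disc_approx: "\<exists>p. (\<lambda>n. poly_disc (p n)) \<longlonglongrightarrow> f"
proof -
  have "\<forall>n. \<exists>p. norm (f - poly_disc p) < inverse (real (Suc n))"
    using poly_disc_dense by simp
  from choice[OF this] obtain p where p: "\<And>n. norm (f - poly_disc (p n)) < inverse (real (Suc n))" by blast
  have "(\<lambda>n. poly_disc (p n) - f) \<longlonglongrightarrow> 0"
    by (rule Lim_null_comparison[OF always_eventually LIMSEQ_inverse_real_of_nat])
      (use p in \<open>auto simp: norm_minus_commute intro: less_imp_le\<close>)
  then show ?thesis by (auto intro: LIM_zero_cancel)
qed

lemma bounded_linear_disc_fun: "bounded_linear (\<lambda>f. disc_fun f z)"
  by (rule bounded_linear_intro[where K = 1])
    (simp_all add: plus_disc_algebra.rep_eq scaleR_disc_algebra.rep_eq scaleR_conv_of_real[where 'a = complex] norm_disc_algebra_upper)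

lemma disc_fun_power: "z \<in> cball 0 1 \<Longrightarrow> disc_fun (F ^ n) z = disc_fun F z ^ n"
  by (induction n) (simp_all add: one_disc_algebra.rep_eq times_disc_algebra.rep_eq)

text \<open>Evaluation at a point of the disc is a continuous homomorphism, so it commutes with the
  exponential series.\<close>

lemma disc_fun_exp:
  assumes "z \<in> cball 0 1"
  shows "disc_fun (exp F) z = exp (disc_fun F z)"
proof -
  have "(\<lambda>n. disc_fun (F ^ n /\<^sub>R fact n) z) sums disc_fun (exp F) z"
    by (rule bounded_linear.sums[OF bounded_linear_disc_fun exp_converges])
  then have "(\<lambda>n. disc_fun F z ^ n /\<^sub>R fact n) sums disc_fun (exp F) z"
    by (simp add: scaleR_disc_algebra.rep_eq disc_fun_power[OF assms] scaleR_conv_of_real[where 'a = complex])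
  then show ?thesis using exp_converges sums_unique2 by blast
qed

text \<open>The modulus of exp p is exp (Re p), and the maximum modulus principle reduces the
  estimate to the circle.\<close>

lemma norm_exp_poly_disc_le:
  assumes "\<And>z. norm z = 1 \<Longrightarrow> Re (poly p z) \<le> 1"
  shows "norm (exp (poly_disc p)) \<le> exp 1"
proof (rule norm_disc_algebra_least)
  fix z :: complex assume z: "z \<in> cball 0 1"
  have "norm (exp (poly p z)) \<le> exp 1"
  proof (rule maximum_modulus_frontier[of "\<lambda>z. exp (poly p z)" "cball 0 1"])
    fix w :: complex assume "w \<in> frontier (cball 0 1)"
    then show "norm (exp (poly p w)) \<le> exp 1" using assms by (simp add: norm_exp_eq_Re)
  qed (use z in \<open>auto intro!: holomorphic_intros continuous_intros\<close>)
  then show "norm (disc_fun (exp (poly_disc p)) z) \<le> exp 1"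
    using z by (simp add: disc_fun_exp[OF z] poly_disc.rep_eq)
qed

section \<open>Calculus of derivations\<close>

lemma derivation_mult:
  assumes "D \<in> disc_derivations"
  shows "blinfun_apply (blinfun_apply D (f * g)) k
    = blinfun_apply (blinfun_apply D g) (f * k) + blinfun_apply (blinfun_apply D f) (g * k)"
  using assms by (simp add: disc_derivations_def blinfun.add_left)

lemma derivation_one:
  assumes "D \<in> disc_derivations"
  shows "blinfun_apply (blinfun_apply D 1) k = 0"
  using derivation_mult[OF assms, of 1 1 k] by simp

lemma derivation_power:
  assumes D: "D \<in> disc_derivations"
  shows "blinfun_apply (blinfun_apply D (F ^ Suc n)) g = of_nat (Suc n) * blinfun_apply (blinfun_apply D F) (F ^ n * g)"
proof (induction n arbitrary: g)
  case (Suc n)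
  have "blinfun_apply (blinfun_apply D (F ^ Suc (Suc n))) g
    = blinfun_apply (blinfun_apply D (F ^ Suc n)) (F * g) + blinfun_apply (blinfun_apply D F) (F ^ Suc n * g)"
    using derivation_mult[OF D, of F "F ^ Suc n" g] by (simp add: power_commutes)
  also have "\<dots> = of_nat (Suc n) * blinfun_apply (blinfun_apply D F) (F ^ Suc n * g) + blinfun_apply (blinfun_apply D F) (F ^ Suc n * g)"
    unfolding Suc by (simp add: mult.assoc[symmetric] power_commutes)
  finally show ?case by (simp add: algebra_simps)
qed simp

text \<open>By continuity D acts termwise on the series. It kills the constant term, and F^(n+1) /
  (n+1)! goes to F^n / n! acting on D F, so a shift of index reproduces the exponential
  series.\<close>

lemma derivation_exp:
  assumes D: "D \<in> disc_derivations"
  shows "blinfun_apply (blinfun_apply D (exp F)) g = blinfun_apply (blinfun_apply D F) (exp F * g)"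
proof -
  let ?f = "\<lambda>n. blinfun_apply (blinfun_apply D F) ((F ^ n /\<^sub>R fact n) * g)"
  let ?h = "\<lambda>n. blinfun_apply (blinfun_apply D (F ^ n /\<^sub>R fact n)) g"
  have "bounded_linear (\<lambda>e. blinfun_apply (blinfun_apply D F) (e * g))"
    by (intro bounded_linear_intros)
  from bounded_linear.sums[OF this exp_converges]
  have f: "?f sums blinfun_apply (blinfun_apply D F) (exp F * g)" .
  have "bounded_linear (\<lambda>e. blinfun_apply (blinfun_apply D e) g)"
    by (intro bounded_linear_intros)
  from bounded_linear.sums[OF this exp_converges]
  have h: "?h sums blinfun_apply (blinfun_apply D (exp F)) g" .
  have hf: "?h (Suc n) = ?f n" for n
  proof -
    have "?h (Suc n) = (of_nat (Suc n) * blinfun_apply (blinfun_apply D F) (F ^ n * g)) /\<^sub>R fact (Suc n)"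
      by (simp only: blinfun.scaleR_left blinfun.scaleR_right derivation_power[OF D])
    also have "\<dots> = blinfun_apply (blinfun_apply D F) (F ^ n * g) /\<^sub>R fact n"
      by (simp add: scaleR_conv_of_real field_simps del: of_nat_Suc)
    finally show ?thesis by (simp add: blinfun.scaleR_right)
  qed
  have h0: "?h 0 = 0" using derivation_one[OF D] by simp
  have "(\<lambda>n. ?h (Suc n)) sums blinfun_apply (blinfun_apply D (exp F)) g"
    by (rule sums_Suc_iff[of ?h, THEN iffD2]) (simp only: h0 add_0_right h)
  then have "?f sums blinfun_apply (blinfun_apply D (exp F)) g" unfolding hf .
  with f show ?thesis using sums_unique2 by blast
qed

text \<open>
  Since \<open>D F 1 = D (exp F) (exp (- F))\<close>, only the real part of \<open>F\<close> matters.
\<close>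

lemma derivation_Re_bound:
  assumes D: "D \<in> disc_derivations" and p: "\<And>z. norm z = 1 \<Longrightarrow> \<bar>Re (poly p z)\<bar> \<le> 1"
  shows "norm (blinfun_apply (blinfun_apply D (poly_disc p)) 1) \<le> exp 2 * norm D"
proof -
  let ?F = "poly_disc p"
  have neg: "- ?F = poly_disc (- p)" by transfer (simp add: fun_eq_iff)
  have "blinfun_apply (blinfun_apply D ?F) 1 = blinfun_apply (blinfun_apply D (exp ?F)) (exp (- ?F))"
    unfolding derivation_exp[OF D] exp_minus_inverse ..
  also have "norm \<dots> \<le> norm (blinfun_apply D (exp ?F)) * norm (exp (- ?F))"
    by (rule norm_blinfun)
  also have "\<dots> \<le> (norm D * norm (exp ?F)) * norm (exp (- ?F))"
    by (intro mult_right_mono norm_blinfun) auto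
  also have "\<dots> \<le> (norm D * exp 1) * exp 1"
    unfolding neg using p by (intro mult_mono norm_exp_poly_disc_le order_refl) (fastforce simp: abs_le_iff)+
  also have "\<dots> = exp 2 * norm D" by (simp add: mult_exp_exp mult_ac)
  finally show ?thesis .
qed

section \<open>Derivations from conjugate Hardy functions\<close>

text \<open>The conclusion allows arbitrary approximating sequences, so that an identity between
  polynomials passes to the limit along whichever sequences fit it, such as products for the Leibniz
  rule. The norm bound makes the limit independent of the choice.\<close>

lemma bilinear_poly_extension:
  fixes \<Phi> :: "complex poly \<Rightarrow> complex poly \<Rightarrow> complex"
  assumes add1: "\<And>p p' q. \<Phi> (p + p') q = \<Phi> p q + \<Phi> p' q" and add2: "\<And>p q q'. \<Phi> p (q + q') = \<Phi> p q + \<Phi> p q'"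
    and smult1: "\<And>c p q. \<Phi> (smult c p) q = c * \<Phi> p q" and smult2: "\<And>c p q. \<Phi> p (smult c q) = c * \<Phi> p q"
    and bound: "\<And>p q. norm (\<Phi> p q) \<le> K * norm (poly_disc p) * norm (poly_disc q)"
  shows "\<exists>B :: disc_algebra \<Rightarrow>\<^sub>L disc_algebra \<Rightarrow>\<^sub>L complex. \<forall>p q f g.
    (\<lambda>n. poly_disc (p n)) \<longlonglongrightarrow> f \<longrightarrow> (\<lambda>n. poly_disc (q n)) \<longlonglongrightarrow> g \<longrightarrow>
    (\<lambda>n. \<Phi> (p n) (q n)) \<longlonglongrightarrow> blinfun_apply (blinfun_apply B f) g"
proof -
  have K0: "0 \<le> K"
    using order_trans[OF norm_ge_zero bound[of 1 1]] by (simp add: poly_disc_1)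
  have diff: "norm (\<Phi> p q - \<Phi> p' q') \<le> K * (norm (poly_disc p - poly_disc p') * norm (poly_disc q)
      + norm (poly_disc p') * norm (poly_disc q - poly_disc q'))" for p q p' q'
  proof -
    have "\<Phi> p q = \<Phi> (p - p') q + \<Phi> p' q" "\<Phi> p' q = \<Phi> p' (q - q') + \<Phi> p' q'"
      using add1[of "p - p'" p' q] add2[of p' "q - q'" q'] by auto
    then have "\<Phi> p q - \<Phi> p' q' = \<Phi> (p - p') q + \<Phi> p' (q - q')" by simp
    also have "norm \<dots> \<le> K * norm (poly_disc (p - p')) * norm (poly_disc q) + K * norm (poly_disc p') * norm (poly_disc (q - q'))"
      by (intro norm_triangle_le add_mono bound)
    finally show ?thesis by (simp add: poly_disc_diff algebra_simps)
  qed
  have "\<exists>ap. \<forall>f. (\<lambda>n. poly_disc (ap f n)) \<longlonglongrightarrow> f"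
    using poly_disc_approx by (intro choice) blast
  then obtain ap where ap: "\<And>f. (\<lambda>n. poly_disc (ap f n)) \<longlonglongrightarrow> f" by blast
  define b where "b f g = lim (\<lambda>n. \<Phi> (ap f n) (ap g n))" for f g
  have conv: "convergent (\<lambda>n. \<Phi> (ap f n) (ap g n))" for f g
  proof (rule Cauchy_convergent, rule CauchyI)
    fix e :: real assume "e > 0"
    have bf: "Bseq (\<lambda>n. poly_disc (ap f n))" for f
      using ap convergentI convergent_imp_Bseq by blast
    obtain A where A: "A > 0" "\<And>n. norm (poly_disc (ap f n)) \<le> A" using bf[of f] by (auto simp: Bseq_def)
    obtain C where C: "C > 0" "\<And>n. norm (poly_disc (ap g n)) \<le> C" using bf[of g] by (auto simp: Bseq_def)
    \<comment> \<open>Using \<open>K + 1\<close> keeps the denominator positive when K = 0.\<close>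
    define d where "d = e / ((K + 1) * (A + C))"
    have d: "d > 0" using \<open>e > 0\<close> K0 A C by (simp add: d_def)
    have cau: "Cauchy (\<lambda>n. poly_disc (ap f n))" for f using ap by (intro LIMSEQ_imp_Cauchy)
    obtain M1 where M1: "\<And>m n. m \<ge> M1 \<Longrightarrow> n \<ge> M1 \<Longrightarrow> norm (poly_disc (ap f m) - poly_disc (ap f n)) < d"
      using CauchyD[OF cau[of f] d] by blast
    obtain M2 where M2: "\<And>m n. m \<ge> M2 \<Longrightarrow> n \<ge> M2 \<Longrightarrow> norm (poly_disc (ap g m) - poly_disc (ap g n)) < d"
      using CauchyD[OF cau[of g] d] by blast
    have "norm (\<Phi> (ap f m) (ap g m) - \<Phi> (ap f n) (ap g n)) < e" if "m \<ge> max M1 M2" "n \<ge> max M1 M2" for m n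
    proof -
      have "norm (\<Phi> (ap f m) (ap g m) - \<Phi> (ap f n) (ap g n)) \<le> K * (d * C + A * d)"
        using that M1[of m n] M2[of m n] A C d K0
        by (intro order_trans[OF diff] mult_left_mono add_mono mult_mono) (auto simp: less_imp_le)
      also have "\<dots> < (K + 1) * (d * C + A * d)"
        using A C d by (intro mult_strict_right_mono) (auto intro: add_pos_pos)
      also have "\<dots> = d * ((K + 1) * (A + C))" by (simp add: algebra_simps)
      also have "\<dots> = e" using K0 A C by (simp add: d_def)
      finally show ?thesis .
    qed
    then show "\<exists>M. \<forall>m\<ge>M. \<forall>n\<ge>M. norm (\<Phi> (ap f m) (ap g m) - \<Phi> (ap f n) (ap g n)) < e" by blast
  qed
  have lim: "(\<lambda>n. \<Phi> (p n) (q n)) \<longlonglongrightarrow> b f g"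
    if p: "(\<lambda>n. poly_disc (p n)) \<longlonglongrightarrow> f" and q: "(\<lambda>n. poly_disc (q n)) \<longlonglongrightarrow> g" for p q f g
  proof -
    have "(\<lambda>n. \<Phi> (p n) (q n) - \<Phi> (ap f n) (ap g n)) \<longlonglongrightarrow> 0"
    proof (rule Lim_null_comparison[OF always_eventually])
      have "(\<lambda>n. K * (norm (poly_disc (p n) - poly_disc (ap f n)) * norm (poly_disc (q n))
        + norm (poly_disc (ap f n)) * norm (poly_disc (q n) - poly_disc (ap g n))))
        \<longlonglongrightarrow> K * (norm (f - f) * norm g + norm f * norm (g - g))"
        by (intro tendsto_intros p q ap)
      then show "(\<lambda>n. K * (norm (poly_disc (p n) - poly_disc (ap f n)) * norm (poly_disc (q n))
        + norm (poly_disc (ap f n)) * norm (poly_disc (q n) - poly_disc (ap g n)))) \<longlonglongrightarrow> 0" by simp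
    qed (use diff in blast)
    moreover have "(\<lambda>n. \<Phi> (ap f n) (ap g n)) \<longlonglongrightarrow> b f g"
      unfolding b_def using conv convergent_LIMSEQ_iff by blast
    ultimately have "(\<lambda>n. (\<Phi> (p n) (q n) - \<Phi> (ap f n) (ap g n)) + \<Phi> (ap f n) (ap g n)) \<longlonglongrightarrow> 0 + b f g"
      by (rule tendsto_add)
    then show ?thesis by simp
  qed
  have b_add1: "b (f + f') g = b f g + b f' g" for f f' g
  proof (rule LIMSEQ_unique)
    show "(\<lambda>n. \<Phi> (ap f n + ap f' n) (ap g n)) \<longlonglongrightarrow> b (f + f') g"
      by (rule lim) (simp_all add: poly_disc_add tendsto_add ap)
    show "(\<lambda>n. \<Phi> (ap f n + ap f' n) (ap g n)) \<longlonglongrightarrow> b f g + b f' g"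
      unfolding add1 by (intro tendsto_add lim ap)
  qed
  have b_add2: "b f (g + g') = b f g + b f g'" for f g g'
  proof (rule LIMSEQ_unique)
    show "(\<lambda>n. \<Phi> (ap f n) (ap g n + ap g' n)) \<longlonglongrightarrow> b f (g + g')"
      by (rule lim) (simp_all add: poly_disc_add tendsto_add ap)
    show "(\<lambda>n. \<Phi> (ap f n) (ap g n + ap g' n)) \<longlonglongrightarrow> b f g + b f g'"
      unfolding add2 by (intro tendsto_add lim ap)
  qed
  have scaleR_poly: "poly_disc (smult (of_real r) p) = r *\<^sub>R poly_disc p" for r p
    by (simp add: poly_disc_smult scaleC_of_real)
  have b_scale1: "b (r *\<^sub>R f) g = r *\<^sub>R b f g" for r f g
  proof (rule LIMSEQ_unique)
    show "(\<lambda>n. \<Phi> (smult (of_real r) (ap f n)) (ap g n)) \<longlonglongrightarrow> b (r *\<^sub>R f) g"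
      by (rule lim) (simp_all only: scaleR_poly tendsto_scaleR tendsto_const ap)
    show "(\<lambda>n. \<Phi> (smult (of_real r) (ap f n)) (ap g n)) \<longlonglongrightarrow> r *\<^sub>R b f g"
      unfolding smult1 scaleR_conv_of_real by (intro tendsto_mult tendsto_const lim ap)
  qed
  have b_scale2: "b f (r *\<^sub>R g) = r *\<^sub>R b f g" for r f g
  proof (rule LIMSEQ_unique)
    show "(\<lambda>n. \<Phi> (ap f n) (smult (of_real r) (ap g n))) \<longlonglongrightarrow> b f (r *\<^sub>R g)"
      by (rule lim) (simp_all only: scaleR_poly tendsto_scaleR tendsto_const ap)
    show "(\<lambda>n. \<Phi> (ap f n) (smult (of_real r) (ap g n))) \<longlonglongrightarrow> r *\<^sub>R b f g"
      unfolding smult2 scaleR_conv_of_real by (intro tendsto_mult tendsto_const lim ap)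
  qed
  have b_bound: "norm (b f g) \<le> K * norm f * norm g" for f g
  proof (rule LIMSEQ_le)
    show "(\<lambda>n. norm (\<Phi> (ap f n) (ap g n))) \<longlonglongrightarrow> norm (b f g)"
      by (intro tendsto_norm lim ap)
    show "(\<lambda>n. K * norm (poly_disc (ap f n)) * norm (poly_disc (ap g n))) \<longlonglongrightarrow> K * norm f * norm g"
      by (intro tendsto_intros ap)
  qed (use bound in blast)
  have blf: "bounded_linear (b f)" for f
  proof (rule bounded_linear_intro[where K = "K * norm f"])
    show "norm (b f g) \<le> norm g * (K * norm f)" for g
      using b_bound[of f g] by (simp add: mult_ac)
  qed (simp_all add: b_add2 b_scale2)
  have app: "blinfun_apply (Blinfun (b f)) = b f" for f
    by (rule bounded_linear_Blinfun_apply[OF blf])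
  have bl: "bounded_linear (\<lambda>f. Blinfun (b f))"
  proof (rule bounded_linear_intro[where K = K])
    fix f f' and r :: real
    show "Blinfun (b (f + f')) = Blinfun (b f) + Blinfun (b f')"
      by (rule blinfun_eqI) (simp add: app b_add1 blinfun.add_left)
    show "Blinfun (b (r *\<^sub>R f)) = r *\<^sub>R Blinfun (b f)"
      by (rule blinfun_eqI) (simp add: app b_scale1 blinfun.scaleR_left)
    show "norm (Blinfun (b f)) \<le> norm f * K"
    proof (rule norm_blinfun_bound)
      show "norm (blinfun_apply (Blinfun (b f)) g) \<le> norm f * K * norm g" for g
        using b_bound[of f g] by (simp add: app mult_ac)
    qed (simp add: K0)
  qed
  show ?thesis
    by (rule exI[of _ "Blinfun (\<lambda>f. Blinfun (b f))"])
      (use lim in \<open>auto simp: bounded_linear_Blinfun_apply[OF bl] app\<close>)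
qed

section \<open>Antiderivatives and pairings of polynomials with integrable functions\<close>

definition primitive_poly :: "complex poly \<Rightarrow> complex poly" where
  "primitive_poly p = (\<Sum>i\<le>degree p. monom (coeff p i / of_nat (Suc i)) (Suc i))"

lemma coeff_primitive_poly_Suc: "coeff (primitive_poly p) (Suc n) = coeff p n / of_nat (Suc n)"
  by (auto simp: primitive_poly_def coeff_sum sum.delta coeff_eq_0 simp del: of_nat_Suc)

lemma coeff_primitive_poly_0: "coeff (primitive_poly p) 0 = 0"
  by (simp add: primitive_poly_def coeff_sum)

lemma pderiv_primitive_poly: "pderiv (primitive_poly p) = p"
  by (rule poly_eqI) (simp add: coeff_pderiv coeff_primitive_poly_Suc del: of_nat_Suc)

lemma primitive_poly_add: "primitive_poly (p + q) = primitive_poly p + primitive_poly q"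
  and primitive_poly_smult: "primitive_poly (smult c p) = smult c (primitive_poly p)"
  by (rule poly_eqI, case_tac n; simp add: coeff_primitive_poly_Suc coeff_primitive_poly_0 add_divide_distrib)+

lemma primitive_poly_pderiv: "primitive_poly (pderiv p) = p - [:coeff p 0:]"
  by (rule poly_eqI, case_tac n)
    (simp_all add: coeff_primitive_poly_Suc coeff_primitive_poly_0 coeff_pderiv del: of_nat_Suc)

lemma integral_poly_mult:
  assumes f: "integrable arc_length f" and "degree p \<le> N"
  shows "(\<integral>z. poly p z * f z \<partial>arc_length) = (\<Sum>n\<le>N. coeff p n * (\<integral>z. f z * z ^ n \<partial>arc_length))"
proof -
  have "(\<integral>z. poly p z * f z \<partial>arc_length) = (\<integral>z. (\<Sum>n\<le>degree p. coeff p n * (f z * z ^ n)) \<partial>arc_length)"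
    by (simp add: poly_altdef sum_distrib_right sum_distrib_left mult_ac)
  also have "\<dots> = (\<Sum>n\<le>degree p. coeff p n * (\<integral>z. f z * z ^ n \<partial>arc_length))"
    by (subst Bochner_Integration.integral_sum)
      (auto intro!: integrable_mult_right integrable_arc_mult continuous_intros f)
  also have "\<dots> = (\<Sum>n\<le>N. coeff p n * (\<integral>z. f z * z ^ n \<partial>arc_length))"
    using assms(2) by (intro sum.mono_neutral_left) (auto simp: coeff_eq_0)
  finally show ?thesis .
qed

lemma bounded_linear_circle_integral:
  assumes f: "integrable arc_length f"
  shows "bounded_linear (\<lambda>g. \<integral>z. disc_fun g z * f z \<partial>arc_length)"
proof -
  have int: "integrable arc_length (\<lambda>z. disc_fun g z * f z)" for g
    using integrable_arc_mult[OF f continuous_on_subset[OF disc_fun_continuous sphere_cball]]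
    by (simp add: mult.commute)
  show ?thesis
  proof (rule bounded_linear_intro[where K = "\<integral>z. norm (f z) \<partial>arc_length"])
    fix g k :: disc_algebra and r :: real
    show "(\<integral>z. disc_fun (g + k) z * f z \<partial>arc_length) = (\<integral>z. disc_fun g z * f z \<partial>arc_length) + (\<integral>z. disc_fun k z * f z \<partial>arc_length)"
      by (simp add: plus_disc_algebra.rep_eq distrib_right int)
    show "(\<integral>z. disc_fun (r *\<^sub>R g) z * f z \<partial>arc_length) = r *\<^sub>R (\<integral>z. disc_fun g z * f z \<partial>arc_length)"
      by (simp add: scaleR_disc_algebra.rep_eq mult.assoc scaleR_conv_of_real[where 'a = complex])
    have "norm (\<integral>z. disc_fun g z * f z \<partial>arc_length) \<le> (\<integral>z. norm (disc_fun g z * f z) \<partial>arc_length)"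
      by (rule integral_norm_bound)
    also have "\<dots> \<le> (\<integral>z. norm g * norm (f z) \<partial>arc_length)"
    proof (rule integral_mono)
      show "integrable arc_length (\<lambda>z. norm (disc_fun g z * f z))" using int by (rule integrable_norm)
    qed (use f in \<open>auto simp: norm_mult intro!: mult_right_mono norm_disc_algebra_upper\<close>)
    finally show "norm (\<integral>z. disc_fun g z * f z \<partial>arc_length) \<le> norm g * (\<integral>z. norm (f z) \<partial>arc_length)" by simp
  qed
qed

lemma integral_poly_disc_mult:
  "(\<integral>z. disc_fun (poly_disc p) z * f z \<partial>arc_length) = (\<integral>z. poly p z * f z \<partial>arc_length)"
  by (rule integral_arc_cong) (simp add: poly_disc.rep_eq)

text \<open>\<open>l2_factorable_of_integrable\<close> factors the coefficients of f with square
  sums at most L. Truncating the factors above the degree of R leaves the pairing with R unchanged,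
  so \<open>primitive_pairing_bound\<close> applies and gives 2 * (L + L).\<close>

lemma integral_primitive_poly_le:
  assumes f: "integrable arc_length f"
    and zero: "\<And>n::nat. (\<integral>z. f z * z powi (- int n) \<partial>arc_length) = 0"
  shows "norm (\<integral>z. poly (primitive_poly (pderiv p * q)) z * f z \<partial>arc_length)
    \<le> 4 * (\<integral>z. norm (f z) \<partial>arc_length) * norm (poly_disc p) * norm (poly_disc q)"
proof (cases "p = 0")
  case True
  then have "primitive_poly (pderiv p * q) = 0" by (simp add: primitive_poly_def)
  then show ?thesis using True by (simp add: poly_disc_0)
next
  case False
  \<comment> \<open>\<open>primitive_pairing_bound\<close> asks for A > 0, here with A =
    \<open>norm (poly_disc p)\<close>.\<close>
  have nz: "poly_disc p \<noteq> 0"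
  proof
    assume "poly_disc p = 0"
    then have "cball 0 1 \<subseteq> {z. poly p z = 0}"
      using norm_poly_le_norm_poly_disc[of _ p] by auto
    moreover have "finite {z. poly p z = 0}" by (rule poly_roots_finite[OF False])
    moreover have "infinite (cball (0::complex) 1)"
      using uncountable_cball[of 1 "0::complex"] countable_finite by auto
    ultimately show False using finite_subset by blast
  qed
  define L where "L = (\<integral>z. norm (f z) \<partial>arc_length)"
  define R where "R = primitive_poly (pderiv p * q)"
  obtain u v where b: "\<And>n. cnj (\<integral>z. f z * z ^ n \<partial>arc_length) = (\<Sum>i\<le>n. u i * v (n - i))"
    and u: "\<And>M. (\<Sum>n<M. (norm (u n))\<^sup>2) \<le> L" and v: "\<And>M. (\<Sum>n<M. (norm (v n))\<^sup>2) \<le> L"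
    using l2_factorable_of_integrable[OF f zero] unfolding l2_factorable_def L_def by blast
  define M where "M = Suc (degree R)"
  define U where "U = seq_poly u M"
  define V where "V = seq_poly v M"
  define N where "N = degree R + degree p + degree U + degree V"
  have "(\<integral>z. poly R z * f z \<partial>arc_length) = (\<Sum>n\<le>N. coeff R n * (\<integral>z. f z * z ^ n \<partial>arc_length))"
    by (rule integral_poly_mult[OF f]) (simp add: N_def)
  also have "\<dots> = (\<Sum>n\<le>N. coeff R n * cnj (coeff (U * V) n))"
  proof (rule sum.cong[OF refl])
    fix n
    show "coeff R n * (\<integral>z. f z * z ^ n \<partial>arc_length) = coeff R n * cnj (coeff (U * V) n)"
    proof (cases "n < M")
      case True
      then have "coeff (U * V) n = cnj (\<integral>z. f z * z ^ n \<partial>arc_length)"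
        unfolding U_def V_def b by (rule coeff_seq_poly_mult)
      then show ?thesis by simp
    next
      case False
      then show ?thesis by (simp add: M_def coeff_eq_0)
    qed
  qed
  also have "norm \<dots> \<le> 2 * norm (poly_disc p) * norm (poly_disc q)
      * ((\<Sum>n\<le>N. (norm (coeff U n))\<^sup>2) + (\<Sum>n\<le>N. (norm (coeff V n))\<^sup>2))"
    by (rule primitive_pairing_bound)
      (auto simp: nz R_def pderiv_primitive_poly coeff_primitive_poly_0 norm_poly_le_norm_poly_disc N_def)
  also have "\<dots> \<le> 2 * norm (poly_disc p) * norm (poly_disc q) * (L + L)"
    unfolding U_def V_def by (intro mult_left_mono add_mono sum_norm_coeff_seq_poly_le u v) auto
  finally show ?thesis by (simp add: R_def L_def algebra_simps)
qed

text \<open>The form \<Phi> is forced by \<open>derivation_poly_disc_primitive\<close>. It depends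
  on p and q only through p' q, so the product rule for p' is the Leibniz rule for \<Phi>, and all
  identities extend from polynomials by density.\<close>

lemma derivation_of_conj_hardy:
  assumes f: "integrable arc_length f"
    and zero: "\<And>n::nat. (\<integral>z. f z * z powi (- int n) \<partial>arc_length) = 0"
  shows "\<exists>D\<in>disc_derivations. \<forall>g. blinfun_apply (blinfun_apply D g) 1 = (\<integral>z. disc_fun g z * f z \<partial>arc_length)"
proof -
  define \<Phi> where "\<Phi> p q = (\<integral>z. poly (primitive_poly (pderiv p * q)) z * f z \<partial>arc_length)" for p q
  have int: "integrable arc_length (\<lambda>z. poly p z * f z)" for p
    using integrable_arc_mult[OF f, of "poly p"] by (simp add: mult.commute continuous_intros)
  have int': "integrable arc_length (\<lambda>z. f z * poly p z)" for p
    using int[of p] by (simp add: mult.commute)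
  have add1: "\<Phi> (p + p') q = \<Phi> p q + \<Phi> p' q" and add2: "\<Phi> q (p + p') = \<Phi> q p + \<Phi> q p'"
    and smult1: "\<Phi> (smult c p) q = c * \<Phi> p q" and smult2: "\<Phi> p (smult c q) = c * \<Phi> p q"
    and deriv: "\<Phi> (p * p') q = \<Phi> p' (p * q) + \<Phi> p (p' * q)" for p p' q c
    unfolding \<Phi>_def
    by (simp_all add: pderiv_add pderiv_smult pderiv_mult algebra_simps primitive_poly_add primitive_poly_smult int')
  have "norm (\<Phi> p q) \<le> 4 * (\<integral>z. norm (f z) \<partial>arc_length) * norm (poly_disc p) * norm (poly_disc q)" for p q
    unfolding \<Phi>_def by (rule integral_primitive_poly_le[OF f zero])
  from bilinear_poly_extension[of \<Phi>, OF add1 add2 smult1 smult2 this]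
  obtain D :: "disc_algebra \<Rightarrow>\<^sub>L disc_algebra \<Rightarrow>\<^sub>L complex" where
    D: "\<And>p q g k. (\<lambda>n. poly_disc (p n)) \<longlonglongrightarrow> g \<Longrightarrow> (\<lambda>n. poly_disc (q n)) \<longlonglongrightarrow> k \<Longrightarrow>
      (\<lambda>n. \<Phi> (p n) (q n)) \<longlonglongrightarrow> blinfun_apply (blinfun_apply D g) k"
    by blast
  have lim_scaleC: "(\<lambda>n. poly_disc (smult c (p n))) \<longlonglongrightarrow> c *\<^sub>C g" if "(\<lambda>n. poly_disc (p n)) \<longlonglongrightarrow> g" for c p g
    unfolding poly_disc_smult by (rule bounded_linear.tendsto[OF bounded_linear_scaleC that])
  have lim_mult: "(\<lambda>n. poly_disc (p n * q n)) \<longlonglongrightarrow> g * k"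
    if "(\<lambda>n. poly_disc (p n)) \<longlonglongrightarrow> g" "(\<lambda>n. poly_disc (q n)) \<longlonglongrightarrow> k" for p q g k
    unfolding poly_disc_mult by (intro tendsto_mult that)
  have "D \<in> disc_derivations"
    unfolding disc_derivations_def complex_dual_def mem_Collect_eq
  proof (intro conjI allI)
    fix g k c
    obtain p q where p: "(\<lambda>n. poly_disc (p n)) \<longlonglongrightarrow> g" and q: "(\<lambda>n. poly_disc (q n)) \<longlonglongrightarrow> k"
      using poly_disc_approx by metis
    show "blinfun_apply (blinfun_apply D g) (c *\<^sub>C k) = c *\<^sub>C blinfun_apply (blinfun_apply D g) k"
    proof (rule LIMSEQ_unique[OF D[OF p lim_scaleC[OF q]]])
      show "(\<lambda>n. \<Phi> (p n) (smult c (q n))) \<longlonglongrightarrow> c *\<^sub>C blinfun_apply (blinfun_apply D g) k"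
        unfolding smult2 scaleC_complex_def by (intro tendsto_mult tendsto_const D p q)
    qed
  next
    fix g c
    show "blinfun_apply D (c *\<^sub>C g) = c *\<^sub>C blinfun_apply D g"
    proof (rule blinfun_eqI)
      fix k
      obtain p q where p: "(\<lambda>n. poly_disc (p n)) \<longlonglongrightarrow> g" and q: "(\<lambda>n. poly_disc (q n)) \<longlonglongrightarrow> k"
        using poly_disc_approx by metis
      show "blinfun_apply (blinfun_apply D (c *\<^sub>C g)) k = blinfun_apply (c *\<^sub>C blinfun_apply D g) k"
      proof (rule LIMSEQ_unique[OF D[OF lim_scaleC[OF p] q]])
        show "(\<lambda>n. \<Phi> (smult c (p n)) (q n)) \<longlonglongrightarrow> blinfun_apply (c *\<^sub>C blinfun_apply D g) k"
          unfolding smult1 scaleC_blinfun.rep_eq scaleC_complex_def by (intro tendsto_mult tendsto_const D p q)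
      qed
    qed
  next
    fix g g'
    show "blinfun_apply D (g * g') = dual_action g (blinfun_apply D g') + dual_action g' (blinfun_apply D g)"
    proof (rule blinfun_eqI)
      fix k
      obtain p p' q where p: "(\<lambda>n. poly_disc (p n)) \<longlonglongrightarrow> g" and p': "(\<lambda>n. poly_disc (p' n)) \<longlonglongrightarrow> g'"
        and q: "(\<lambda>n. poly_disc (q n)) \<longlonglongrightarrow> k"
        using poly_disc_approx by metis
      show "blinfun_apply (blinfun_apply D (g * g')) k
        = blinfun_apply (dual_action g (blinfun_apply D g') + dual_action g' (blinfun_apply D g)) k"
      proof (rule LIMSEQ_unique[OF D[OF lim_mult[OF p p'] q]])
        show "(\<lambda>n. \<Phi> (p n * p' n) (q n))
          \<longlonglongrightarrow> blinfun_apply (dual_action g (blinfun_apply D g') + dual_action g' (blinfun_apply D g)) k"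
          unfolding deriv blinfun.add_left dual_action_apply by (intro tendsto_add D lim_mult p p' q)
      qed
    qed
  qed
  moreover have "blinfun_apply (blinfun_apply D g) 1 = (\<integral>z. disc_fun g z * f z \<partial>arc_length)" for g
  proof -
    obtain p where p: "(\<lambda>n. poly_disc (p n)) \<longlonglongrightarrow> g" using poly_disc_approx by blast
    have "(\<lambda>n. poly_disc 1) \<longlonglongrightarrow> 1" by (simp add: poly_disc_1)
    from D[OF p this] have lim1: "(\<lambda>n. \<Phi> (p n) 1) \<longlonglongrightarrow> blinfun_apply (blinfun_apply D g) 1" .
    have f0: "(\<integral>z. f z \<partial>arc_length) = 0" using zero[of 0] by simp
    \<comment> \<open>The antiderivative of p' is p minus its constant term, and that constant is
      lost because f has mean zero.\<close>
    have "\<Phi> p 1 = (\<integral>z. poly p z * f z \<partial>arc_length)" for p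
    proof -
      have "\<Phi> p 1 = (\<integral>z. poly p z * f z - coeff p 0 * f z \<partial>arc_length)"
        by (simp add: \<Phi>_def primitive_poly_pderiv algebra_simps)
      also have "\<dots> = (\<integral>z. poly p z * f z \<partial>arc_length) - (\<integral>z. coeff p 0 * f z \<partial>arc_length)"
        using int f by (intro Bochner_Integration.integral_diff) auto
      finally show ?thesis by (simp add: f0)
    qed
    with lim1 have lim1': "(\<lambda>n. \<integral>z. poly (p n) z * f z \<partial>arc_length) \<longlonglongrightarrow> blinfun_apply (blinfun_apply D g) 1" by simp
    have "(\<lambda>n. \<integral>z. poly (p n) z * f z \<partial>arc_length) \<longlonglongrightarrow> (\<integral>z. disc_fun g z * f z \<partial>arc_length)"
      using bounded_linear.tendsto[OF bounded_linear_circle_integral[OF f] p]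
      by (simp add: integral_poly_disc_mult)
    with lim1' show ?thesis using LIMSEQ_unique by blast
  qed
  ultimately show ?thesis by blast
qed

section \<open>Representation of derivations\<close>

lemma derivation_scaleC:
  assumes "D \<in> disc_derivations"
  shows "blinfun_apply (blinfun_apply D (a *\<^sub>C g)) k = a * blinfun_apply (blinfun_apply D g) k"
  using assms by (simp add: disc_derivations_def scaleC_blinfun.rep_eq scaleC_complex_def)

lemma poly_disc_pCons: "poly_disc (pCons a p) = a *\<^sub>C 1 + poly_disc [:0, 1:] * poly_disc p"
proof -
  have "pCons a p = smult a 1 + [:0, 1:] * p" by simp
  then show ?thesis by (simp only: poly_disc_add poly_disc_mult poly_disc_smult poly_disc_1)
qed

text \<open>Both sides vanish on constants and obey the Leibniz rule, so the claim passes from p to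
  a + X p, with X the coordinate function.\<close>

lemma derivation_poly_disc:
  assumes D: "D \<in> disc_derivations"
  shows "blinfun_apply (blinfun_apply D (poly_disc p)) g
    = blinfun_apply (blinfun_apply D (poly_disc [:0, 1:])) (poly_disc (pderiv p) * g)"
proof (induction p arbitrary: g rule: pCons_induct)
  case 0
  then show ?case by (simp add: poly_disc_0)
next
  case (pCons a p)
  let ?X = "poly_disc [:0, 1:]"
  have "blinfun_apply (blinfun_apply D (poly_disc (pCons a p))) g = blinfun_apply (blinfun_apply D (?X * poly_disc p)) g"
    unfolding poly_disc_pCons[of a p] by (simp add: blinfun.add_right blinfun.add_left derivation_scaleC[OF D] derivation_one[OF D])
  also have "\<dots> = blinfun_apply (blinfun_apply D ?X) (poly_disc (pderiv p) * (?X * g) + poly_disc p * g)"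
    unfolding derivation_mult[OF D] pCons.IH by (simp add: blinfun.add_right)
  also have "poly_disc (pderiv p) * (?X * g) + poly_disc p * g = poly_disc (pderiv (pCons a p)) * g"
  proof -
    have "pderiv (pCons a p) = pderiv p * [:0, 1:] + p" by (simp add: pderiv_pCons)
    then show ?thesis by (simp only: poly_disc_add poly_disc_mult distrib_right mult.assoc)
  qed
  finally show ?case .
qed

text \<open>Both sides are the value of D X at p' q. By density, D is determined by its values at
  the function 1.\<close>

lemma derivation_poly_disc_primitive:
  assumes D: "D \<in> disc_derivations"
  shows "blinfun_apply (blinfun_apply D (poly_disc p)) (poly_disc q)
    = blinfun_apply (blinfun_apply D (poly_disc (primitive_poly (pderiv p * q)))) 1"
  by (simp add: derivation_poly_disc[OF D, of p] derivation_poly_disc[OF D, of "primitive_poly _"]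
      pderiv_primitive_poly poly_disc_mult)

text \<open>\<open>derivation_poly_disc_primitive\<close> writes every value of D on polynomials as
  an integral of an antiderivative against f, to which \<open>integral_primitive_poly_le\<close>
  applies. Density does the rest.\<close>

lemma norm_derivation_le:
  assumes D: "D \<in> disc_derivations" and f: "integrable arc_length f"
    and zero: "\<And>n::nat. (\<integral>z. f z * z powi (- int n) \<partial>arc_length) = 0"
    and eq: "\<And>g. blinfun_apply (blinfun_apply D g) 1 = (\<integral>z. disc_fun g z * f z \<partial>arc_length)"
  shows "norm D \<le> 4 * (\<integral>z. norm (f z) \<partial>arc_length)"
proof -
  define L where "L = (\<integral>z. norm (f z) \<partial>arc_length)"
  have L: "L \<ge> 0" unfolding L_def by (rule integral_nonneg_AE) auto
  have bd: "norm (blinfun_apply (blinfun_apply D g) k) \<le> 4 * L * norm g * norm k" for g k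
  proof -
    obtain p q where p: "(\<lambda>n. poly_disc (p n)) \<longlonglongrightarrow> g" and q: "(\<lambda>n. poly_disc (q n)) \<longlonglongrightarrow> k"
      using poly_disc_approx by metis
    show ?thesis
    proof (rule LIMSEQ_le)
      show "(\<lambda>n. norm (blinfun_apply (blinfun_apply D (poly_disc (p n))) (poly_disc (q n))))
        \<longlonglongrightarrow> norm (blinfun_apply (blinfun_apply D g) k)"
        by (intro tendsto_intros p q)
      show "(\<lambda>n. 4 * L * norm (poly_disc (p n)) * norm (poly_disc (q n))) \<longlonglongrightarrow> 4 * L * norm g * norm k"
        by (intro tendsto_intros p q)
      show "\<exists>N. \<forall>n\<ge>N. norm (blinfun_apply (blinfun_apply D (poly_disc (p n))) (poly_disc (q n)))
          \<le> 4 * L * norm (poly_disc (p n)) * norm (poly_disc (q n))"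
        unfolding derivation_poly_disc_primitive[OF D] eq integral_poly_disc_mult L_def
        using integral_primitive_poly_le[OF f zero] by blast
    qed
  qed
  show ?thesis unfolding L_def[symmetric]
    by (intro norm_blinfun_bound mult_nonneg_nonneg) (use bd L in auto)
qed

lemma derivation_poly_disc_sum:
  assumes D: "D \<in> disc_derivations"
  shows "blinfun_apply (blinfun_apply D (poly_disc p)) 1
    = (\<Sum>n\<le>degree p. blinfun_apply (blinfun_apply D (poly_disc (monom 1 n))) 1 * coeff p n)"
proof -
  let ?L = "\<lambda>p. blinfun_apply (blinfun_apply D (poly_disc p)) 1"
  have add: "?L (p + q) = ?L p + ?L q" for p q
    by (simp add: poly_disc_add blinfun.add_left blinfun.add_right)
  have zero: "?L 0 = 0" by (simp add: poly_disc_0)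
  have sum: "?L (\<Sum>i\<in>A. g i) = (\<Sum>i\<in>A. ?L (g i))" for g and A :: "nat set"
    by (induction A rule: infinite_finite_induct) (simp_all add: zero add)
  have "?L p = ?L (\<Sum>i\<le>degree p. smult (coeff p i) (monom 1 i))"
    by (simp add: smult_monom poly_as_sum_of_monoms)
  also have "\<dots> = (\<Sum>n\<le>degree p. ?L (monom 1 n) * coeff p n)"
    unfolding sum by (simp add: poly_disc_smult derivation_scaleC[OF D] mult.commute)
  finally show ?thesis .
qed

text \<open>The numbers cnj (c n) form a factorable sequence and are therefore, up to 2 * pi, the
  Fourier coefficients of some w in H^1. The function f is the conjugate of w over 2 * pi, and c 0 =
  0 puts w into H^1_0.\<close>

lemma derivation_representation:
  assumes D: "D \<in> disc_derivations"
  shows "\<exists>f. integrable arc_length f \<and> (\<forall>n::nat. (\<integral>z. f z * z powi (- int n) \<partial>arc_length) = 0) \<and>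
    (\<integral>z. norm (f z) \<partial>arc_length) \<le> 2 * exp 2 * norm D \<and>
    (\<forall>g. blinfun_apply (blinfun_apply D g) 1 = (\<integral>z. disc_fun g z * f z \<partial>arc_length))"
proof -
  define c where "c n = blinfun_apply (blinfun_apply D (poly_disc (monom 1 n))) 1" for n
  have c0: "c 0 = 0" by (simp add: c_def poly_disc_1 derivation_one[OF D])
  have "l2_factorable (2 * (exp 2 * norm D)) (\<lambda>n. cnj (c n))"
  proof (rule l2_factorable_of_Re_bound[where c = c, OF c0])
    fix p assume "\<And>z. norm z = 1 \<Longrightarrow> \<bar>Re (poly p z)\<bar> \<le> 1"
    from derivation_Re_bound[OF D this]
    show "norm (\<Sum>n\<le>degree p. c n * coeff p n) \<le> exp 2 * norm D"
      unfolding c_def derivation_poly_disc_sum[OF D, symmetric] .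
  qed
  from l2_factorable_imp_integrable[OF this] obtain w where w: "integrable arc_length w"
    and wn: "(\<integral>z. norm (w z) \<partial>arc_length) \<le> 2 * pi * (2 * (exp 2 * norm D))"
    and wc: "\<And>n::nat. (\<integral>z. w z * z powi (- int n) \<partial>arc_length) = 2 * pi * cnj (c n)"
    and w0: "\<And>n::nat. n > 0 \<Longrightarrow> (\<integral>z. w z * z powi (int n) \<partial>arc_length) = 0"
    by blast
  define f where "f z = cnj (w z) / of_real (2 * pi)" for z
  have f: "integrable arc_length f" unfolding f_def using w by simp
  have coef: "(\<integral>z. f z * z powi n \<partial>arc_length) = cnj (\<integral>z. w z * z powi (- n) \<partial>arc_length) / of_real (2 * pi)" for n
  proof -
    have "(\<integral>z. f z * z powi n \<partial>arc_length) = (\<integral>z. cnj (w z * z powi (- n)) / of_real (2 * pi) \<partial>arc_length)"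
    proof (rule integral_arc_cong)
      fix z :: complex assume z: "norm z = 1"
      then have "cnj z = inverse z" using cnj_eq_powi[OF z, of 1] by (simp add: power_int_minus)
      then show "f z * z powi n = cnj (w z * z powi (- n)) / of_real (2 * pi)"
        by (simp add: f_def power_int_minus power_int_inverse)
    qed
    also have "\<dots> = (\<integral>z. cnj (w z * z powi (- n)) \<partial>arc_length) / of_real (2 * pi)" by (rule integral_divide_zero)
    also have "(\<integral>z. cnj (w z * z powi (- n)) \<partial>arc_length) = cnj (\<integral>z. w z * z powi (- n) \<partial>arc_length)"
      by (rule Bochner_Integration.integral_cnj)
    finally show ?thesis .
  qed
  have fc: "(\<integral>z. f z * z ^ n \<partial>arc_length) = c n" for n
    using coef[of "int n"] wc[of n] by simp
  have f0: "(\<integral>z. f z * z powi (- int n) \<partial>arc_length) = 0" for n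
  proof (cases "n = 0")
    case True
    then show ?thesis using fc[of 0] c0 by simp
  next
    case False
    then show ?thesis unfolding coef minus_minus using w0[of n] by simp
  qed
  have fn: "(\<integral>z. norm (f z) \<partial>arc_length) \<le> 2 * exp 2 * norm D"
  proof -
    have "(\<integral>z. norm (f z) \<partial>arc_length) = (\<integral>z. norm (w z) / (2 * pi) \<partial>arc_length)"
      by (simp add: f_def norm_divide norm_mult)
    also have "\<dots> = (\<integral>z. norm (w z) \<partial>arc_length) / (2 * pi)" by (rule integral_divide_zero)
    also have "\<dots> \<le> 2 * exp 2 * norm D" using wn by (simp add: field_simps)
    finally show ?thesis .
  qed
  have "blinfun_apply (blinfun_apply D g) 1 = (\<integral>z. disc_fun g z * f z \<partial>arc_length)" for g
  proof -
    obtain p where p: "(\<lambda>n. poly_disc (p n)) \<longlonglongrightarrow> g" using poly_disc_approx by blast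
    have poly: "blinfun_apply (blinfun_apply D (poly_disc p)) 1 = (\<integral>z. disc_fun (poly_disc p) z * f z \<partial>arc_length)" for p
      unfolding integral_poly_disc_mult integral_poly_mult[OF f order_refl] fc derivation_poly_disc_sum[OF D, of p]
      by (simp add: c_def mult.commute)
    show ?thesis
    proof (rule LIMSEQ_unique)
      show "(\<lambda>n. blinfun_apply (blinfun_apply D (poly_disc (p n))) 1) \<longlonglongrightarrow> blinfun_apply (blinfun_apply D g) 1"
        by (intro tendsto_intros p)
      show "(\<lambda>n. blinfun_apply (blinfun_apply D (poly_disc (p n))) 1) \<longlonglongrightarrow> (\<integral>z. disc_fun g z * f z \<partial>arc_length)"
        unfolding poly by (rule bounded_linear.tendsto[OF bounded_linear_circle_integral[OF f] p])
    qed
  qed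
  with f f0 fn show ?thesis by blast
qed

section \<open>Uniqueness and linear structure in Conj H^1_0\<close>

lemma conj_hardy_H1_0_eqI:
  assumes h: "h \<in> conj_hardy_H1_0" and k: "k \<in> conj_hardy_H1_0"
    and eq: "\<And>g. circle_pairing g h = circle_pairing g k"
  shows "h = k"
proof -
  obtain f1 where f1: "integrable arc_length f1" "h = abs_L1_circle f1" by (rule L1_circle_cases)
  obtain f2 where f2: "integrable arc_length f2" "k = abs_L1_circle f2" by (rule L1_circle_cases)
  define f where "f z = f1 z - f2 z" for z
  have f: "integrable arc_length f" unfolding f_def using f1 f2 by simp
  have sub: "(\<integral>z. f z * z powi n \<partial>arc_length) = (\<integral>z. f1 z * z powi n \<partial>arc_length) - (\<integral>z. f2 z * z powi n \<partial>arc_length)" for n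
    unfolding f_def left_diff_distrib
    by (rule Bochner_Integration.integral_diff; rule integrable_arc_mult) (auto intro!: f1 f2 continuous_intros)
  \<comment> \<open>For n \<le> 0 the integral vanishes by membership; for n > 0 it is a difference
    of pairings with a monomial of the disc algebra.\<close>
  have "(\<integral>z. f z * z powi n \<partial>arc_length) = 0" for n
  proof (cases "n \<le> 0")
    case True
    then obtain m where "n = - int m" by (metis nonpos_int_cases)
    then show ?thesis
      unfolding sub using h k conj_hardy_H1_0_abs_L1[OF f1(1)] conj_hardy_H1_0_abs_L1[OF f2(1)] f1(2) f2(2) by simp
  next
    case False
    then obtain m where n: "n = int m" by (metis linear nonneg_int_cases)
    have "(\<integral>z. z ^ m * f1 z \<partial>arc_length) = (\<integral>z. z ^ m * f2 z \<partial>arc_length)"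
      using eq[of "poly_disc (monom 1 m)"]
      by (simp add: f1 f2 circle_pairing_abs_L1 integral_poly_disc_mult poly_monom)
    then show ?thesis unfolding sub n by (simp add: mult.commute)
  qed
  from fourier_uniqueness[OF f this] have "(\<integral>z. norm (f z) \<partial>arc_length) = 0"
    by (intro integral_eq_zero_AE) auto
  moreover have "h - k = abs_L1_circle f"
    using f1 f2 by (simp add: minus_L1_circle.abs_eq f_def[abs_def])
  ultimately have "norm (h - k) = 0" by (simp add: norm_abs_L1[OF f])
  then show ?thesis by simp
qed

lemma conj_hardy_H1_0_add_scaleC:
  assumes h: "h \<in> conj_hardy_H1_0"
  shows "k \<in> conj_hardy_H1_0 \<Longrightarrow> h + k \<in> conj_hardy_H1_0" "a *\<^sub>C h \<in> conj_hardy_H1_0"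
    "circle_pairing g (h + k) = circle_pairing g h + circle_pairing g k"
    "circle_pairing g (a *\<^sub>C h) = a * circle_pairing g h"
proof -
  obtain f1 where f1: "integrable arc_length f1" "h = abs_L1_circle f1" by (rule L1_circle_cases)
  obtain f2 where f2: "integrable arc_length f2" "k = abs_L1_circle f2" by (rule L1_circle_cases)
  have i: "integrable arc_length (\<lambda>z. f1 z + f2 z)" "integrable arc_length (\<lambda>z. a * f1 z)" using f1 f2 by auto
  have hk: "h + k = abs_L1_circle (\<lambda>z. f1 z + f2 z)" "a *\<^sub>C h = abs_L1_circle (\<lambda>z. a * f1 z)"
    using f1 f2 by (auto simp: plus_L1_circle.abs_eq scaleC_L1_circle.abs_eq)
  have z1: "(\<integral>z. f1 z * z powi (- int n) \<partial>arc_length) = 0" for n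
    using h conj_hardy_H1_0_abs_L1[OF f1(1)] f1(2) by simp
  have m: "integrable arc_length (\<lambda>z. f z * z powi n)" if "integrable arc_length f" for f n
    by (rule integrable_arc_mult[OF that]) (auto intro!: continuous_intros)
  show "a *\<^sub>C h \<in> conj_hardy_H1_0"
    unfolding hk conj_hardy_H1_0_abs_L1[OF i(2)] mult.assoc integral_mult_right_zero z1 by simp
  show "h + k \<in> conj_hardy_H1_0" if k: "k \<in> conj_hardy_H1_0"
  proof -
    have z2: "(\<integral>z. f2 z * z powi (- int n) \<partial>arc_length) = 0" for n
      using k conj_hardy_H1_0_abs_L1[OF f2(1)] f2(2) by simp
    show ?thesis
      unfolding hk conj_hardy_H1_0_abs_L1[OF i(1)] distrib_right
        Bochner_Integration.integral_add[OF m[OF f1(1)] m[OF f2(1)]] z1 z2 by simp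
  qed
  have d: "integrable arc_length (\<lambda>z. disc_fun g z * f z)" if "integrable arc_length f" for f
    using integrable_arc_mult[OF that continuous_on_subset[OF disc_fun_continuous sphere_cball]]
    by (simp add: mult.commute)
  show "circle_pairing g (h + k) = circle_pairing g h + circle_pairing g k"
    unfolding hk unfolding f1(2) f2(2) circle_pairing_abs_L1[OF i(1)] circle_pairing_abs_L1[OF f1(1)] circle_pairing_abs_L1[OF f2(1)]
      distrib_left by (rule Bochner_Integration.integral_add[OF d[OF f1(1)] d[OF f2(1)]])
  show "circle_pairing g (a *\<^sub>C h) = a * circle_pairing g h"
    unfolding hk unfolding f1(2) circle_pairing_abs_L1[OF i(2)] circle_pairing_abs_L1[OF f1(1)]
    by (simp add: mult.left_commute)
qed

lemma disc_derivations_diff: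
  assumes "D \<in> disc_derivations" "D' \<in> disc_derivations"
  shows "D - D' \<in> disc_derivations"
proof -
  have sub: "a *\<^sub>C (\<phi> - \<psi>) = a *\<^sub>C \<phi> - a *\<^sub>C \<psi>" for a and \<phi> \<psi> :: "disc_algebra \<Rightarrow>\<^sub>L complex"
    by (rule blinfun_eqI) (simp add: scaleC_blinfun.rep_eq blinfun.diff_left scaleC_complex_def right_diff_distrib)
  have act: "dual_action f (\<phi> - \<psi>) = dual_action f \<phi> - dual_action f \<psi>" for f \<phi> \<psi>
    by (rule blinfun_eqI) (simp add: blinfun.diff_left)
  show ?thesis
    using assms unfolding disc_derivations_def complex_dual_def mem_Collect_eq
    by (simp add: blinfun.diff_left scaleC_complex_def right_diff_distrib sub act)
qed

theorem theorem2p1: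
  shows "(\<forall>D\<in>disc_derivations. \<exists>!h. h \<in> conj_hardy_H1_0 \<and>
            (\<forall>f. blinfun_apply (blinfun_apply D f) 1 = circle_pairing f h)) \<and>
         bounded_linear_iso_on
           (\<lambda>D. THE h. h \<in> conj_hardy_H1_0 \<and>
              (\<forall>f. blinfun_apply (blinfun_apply D f) 1 = circle_pairing f h))
           disc_derivations conj_hardy_H1_0"
proof -
  define Q :: "(disc_algebra \<Rightarrow>\<^sub>L disc_algebra \<Rightarrow>\<^sub>L complex) \<Rightarrow> L1_circle \<Rightarrow> bool"
    where "Q D h \<longleftrightarrow> h \<in> conj_hardy_H1_0 \<and>
      (\<forall>f. blinfun_apply (blinfun_apply D f) 1 = circle_pairing f h)" for D h
  define E where "E D = (THE h. Q D h)" for D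
  have uniq: "h = k" if "Q D h" "Q D k" for D h k
    using that unfolding Q_def by (intro conj_hardy_H1_0_eqI) auto
  have E_eq: "E D = h" if "Q D h" for D h
    unfolding E_def using that uniq by blast
  have ex: "\<exists>h. Q D h \<and> norm h \<le> 2 * exp 2 * norm D" if D: "D \<in> disc_derivations" for D
  proof -
    obtain f where f: "integrable arc_length f" "\<forall>n::nat. (\<integral>z. f z * z powi (- int n) \<partial>arc_length) = 0"
      "(\<integral>z. norm (f z) \<partial>arc_length) \<le> 2 * exp 2 * norm D"
      "\<forall>g. blinfun_apply (blinfun_apply D g) 1 = (\<integral>z. disc_fun g z * f z \<partial>arc_length)"
      using derivation_representation[OF D] by blast
    then show ?thesis
      by (intro exI[of _ "abs_L1_circle f"])
        (simp add: Q_def conj_hardy_H1_0_abs_L1 circle_pairing_abs_L1 norm_abs_L1)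
  qed
  have QE: "Q D (E D)" and E_le: "norm (E D) \<le> 2 * exp 2 * norm D" if "D \<in> disc_derivations" for D
    using ex[OF that] E_eq by auto
  \<comment> \<open>Stated for every representing h, it serves both the bound of the inverse and,
    applied to D - D', injectivity.\<close>
  have lower: "norm D \<le> 4 * norm h" if D: "D \<in> disc_derivations" and Q: "Q D h" for D h
  proof -
    obtain f where f: "integrable arc_length f" "h = abs_L1_circle f" by (rule L1_circle_cases)
    show ?thesis
      using norm_derivation_le[OF D f(1)] Q f conj_hardy_H1_0_abs_L1[OF f(1)]
      by (simp add: Q_def circle_pairing_abs_L1 norm_abs_L1)
  qed
  have "bij_betw E disc_derivations conj_hardy_H1_0"
    unfolding bij_betw_def
  proof
    show "inj_on E disc_derivations"
    proof (rule inj_onI)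
      fix D D' assume D: "D \<in> disc_derivations" "D' \<in> disc_derivations" and eq: "E D = E D'"
      \<comment> \<open>Writing zero as \<open>0 *\<^sub>C E D\<close> lets
        \<open>conj_hardy_H1_0_add_scaleC\<close> supply its membership and its zero
        pairings.\<close>
      have "Q (D - D') (0 *\<^sub>C E D)"
        using QE[OF D(1)] QE[OF D(2)] eq
        by (simp add: Q_def conj_hardy_H1_0_add_scaleC blinfun.diff_left)
      then have "norm (D - D') \<le> 4 * norm (0 *\<^sub>C E D)"
        by (rule lower[OF disc_derivations_diff[OF D]])
      then show "D = D'" by (simp add: norm_scaleC)
    qed
    show "E ` disc_derivations = conj_hardy_H1_0"
    proof (intro equalityI subsetI)
      fix h assume "h \<in> E ` disc_derivations"
      then show "h \<in> conj_hardy_H1_0" using QE by (auto simp: Q_def)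
    next
      fix h assume h: "h \<in> conj_hardy_H1_0"
      obtain f where f: "integrable arc_length f" "h = abs_L1_circle f" by (rule L1_circle_cases)
      obtain D where D: "D \<in> disc_derivations"
        "\<forall>g. blinfun_apply (blinfun_apply D g) 1 = (\<integral>z. disc_fun g z * f z \<partial>arc_length)"
        using derivation_of_conj_hardy[OF f(1)] h conj_hardy_H1_0_abs_L1[OF f(1)] f(2) by blast
      then have "Q D h" using h f by (simp add: Q_def circle_pairing_abs_L1)
      then show "h \<in> E ` disc_derivations" using D E_eq by blast
    qed
  qed
  moreover have "E (D + D') = E D + E D'" if "D \<in> disc_derivations" "D' \<in> disc_derivations" for D D'
    using QE[OF that(1)] QE[OF that(2)]
    by (intro E_eq) (simp add: Q_def conj_hardy_H1_0_add_scaleC blinfun.add_left)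
  moreover have "E (a *\<^sub>C D) = a *\<^sub>C E D" if "D \<in> disc_derivations" for a D
    using QE[OF that]
    by (intro E_eq) (simp add: Q_def conj_hardy_H1_0_add_scaleC scaleC_blinfun.rep_eq scaleC_complex_def)
  ultimately have "bounded_linear_iso_on E disc_derivations conj_hardy_H1_0"
    unfolding bounded_linear_iso_on_def using E_le lower QE by blast
  moreover have "\<exists>!h. Q D h" if "D \<in> disc_derivations" for D
    using QE[OF that] uniq by blast
  ultimately show ?thesis unfolding E_def Q_def by blast
qed

end
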